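(* Let $n\ge2$, let $\Omega\subset\mathbb{R}^n$ be an infinitely long nozzle (as defined in the context) and $m>0$. There is a constant $l$ depending only on $\Omega$, and a constant $C$ not depending on $L$, such that for any $a,b$ with $b-a>l$ and $\Omega_{(a-1,b+1)}\subset\Omega_{L/2}$, the solution $\bar\varphi_L\in H_L$ of the truncated incompressible problem $$\Delta\bar\varphi_L=0\ \text{in }\Omega_L,\quad \frac{\partial\bar\varphi_L}{\partial\mathbf n}=0\ \text{on }\partial\Omega\cap\partial\Omega_L,\quad \frac{\partial\bar\varphi_L}{\partial x_n}=\frac{m}{|S_L^+|}\ \text{on }S_L^+,\quad \bar\varphi_L=0\ \text{on }S_L^-$$ satisfies $$\frac1{|\Omega_{(a,b)}|}\int_{\Omega_{(a,b)}}|\nabla\bar\varphi_L|^2dx\le Cm^2.$$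
   Context: Nozzle: $\Omega\subset\mathbb{R}^n$ is a domain for which there is an invertible $C^{2,\alpha}$ map ($0<\alpha<1$) $T:\bar\Omega\to\bar{\mathbf C}$, $\mathbf C=B(0,1)\times\mathbb{R}$ with $B(0,1)$ the unit ball of $\mathbb{R}^{n-1}$, such that $T(\partial\Omega)=\partial\mathbf C$; $T(\Omega\cap\{x_n=k\})=B(0,1)\times\{y_n=k\}$ for every $k\in\mathbb{R}$; and $\|T\|_{C^{2,\alpha}}+\|T^{-1}\|_{C^{2,\alpha}}\le K<\infty$. Notation: for $L>0$, $\Omega_L=\{x\in\Omega: |x_n|<L\}$, $S_L^\pm=\Omega\cap\{x_n=\pm L\}$, $|S_L^+|$ is the area of $S_L^+$, $\Omega_{(a,b)}=\{x\in\Omega: a<x_n<b\}$, and $|\Omega_{(a,b)}|$ is its measure. $H_L=\{\varphi\in H^1(\Omega_L):\varphi|_{S_L^-}=0\}$. The problem is understood weakly: $\int_{\Omega_L}\nabla\bar\varphi_L\cdot\nabla\eta\,dx=\frac{m}{|S_L^+|}\int_{S_L^+}\eta\,dx'$ for all $\eta\in H_L$.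
   Formalization: The C^{2,α} norms of T and T^{-1} as written are infinite for every nozzle, since the axial component is unbounded (T preserves x_n); here the zeroth-order part of each norm is taken only on the components transversal to the axis, the derivative terms being unchanged. *)

theory Defs
  imports "HOL-Analysis.Analysis"
begin

text \<open>
  The space \<open>\<real>\<^sup>n\<close> with \<open>n \<ge> 2\<close> is \<^typ>\<open>'a::euclidean_space \<times> real\<close>: the first factor is
  \<open>\<real>\<close> to the power \<open>n - 1\<close> (a Euclidean space has dimension at least 1, so \<open>n = DIM('a) + 1\<close>
  ranges over all \<open>n \<ge> 2\<close>), and \<open>snd x\<close> is the axial coordinate \<open>x\<^sub>n\<close>.
\<close>

section \<open>Nozzles\<close>

definition cylinder :: "('a::euclidean_space \<times> real) set" where
  "cylinder = ball 0 1 \<times> UNIV"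

text \<open>
  \<open>C\<^sup>2\<close> up to the boundary: \<open>f1\<close> and \<open>f2\<close> are the first and second derivatives of \<open>f\<close> in the
  open set \<open>U\<close>, continuously extended to the closure.
\<close>

definition C2_up_to_boundary ::
  "'b::euclidean_space set \<Rightarrow> ('b \<Rightarrow> 'b) \<Rightarrow> ('b \<Rightarrow> 'b \<Rightarrow>\<^sub>L 'b) \<Rightarrow> ('b \<Rightarrow> 'b \<Rightarrow>\<^sub>L 'b \<Rightarrow>\<^sub>L 'b) \<Rightarrow> bool" where
  "C2_up_to_boundary U f f1 f2 \<longleftrightarrow>
     continuous_on (closure U) f \<and> continuous_on (closure U) f1 \<and> continuous_on (closure U) f2 \<and>
     (\<forall>x\<in>U. (f has_derivative blinfun_apply (f1 x)) (at x)) \<and>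
     (\<forall>x\<in>U. (f1 has_derivative blinfun_apply (f2 x)) (at x))"

text \<open>
  The \<open>C\<^sup>2\<^sup>,\<^sup>\<alpha>\<close> norm of a nozzle map.  Since such a map preserves the axial coordinate, its
  axial component is \<open>x\<^sub>n\<close>, which is unbounded; the zeroth-order term is therefore the supremum of
  the transversal components only (with the full supremum no map would have finite norm).
  In the last term the diagonal \<open>x = y\<close> contributes \<open>0 / 0 = 0\<close>.
\<close>

definition C2_holder_norm ::
  "real \<Rightarrow> ('a::euclidean_space \<times> real) set \<Rightarrow> ('a \<times> real \<Rightarrow> 'a \<times> real) \<Rightarrow>
   ('a \<times> real \<Rightarrow> ('a \<times> real) \<Rightarrow>\<^sub>L ('a \<times> real)) \<Rightarrow>
   ('a \<times> real \<Rightarrow> ('a \<times> real) \<Rightarrow>\<^sub>L ('a \<times> real) \<Rightarrow>\<^sub>L ('a \<times> real)) \<Rightarrow> ennreal" where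
  "C2_holder_norm \<alpha> U f f1 f2 =
     (SUP x\<in>U. ennreal (norm (fst (f x)))) + (SUP x\<in>U. ennreal (norm (f1 x))) +
     (SUP x\<in>U. ennreal (norm (f2 x))) +
     (SUP x\<in>U. SUP y\<in>U. ennreal (norm (f2 x - f2 y) / dist x y powr \<alpha>))"

definition nozzle :: "('a::euclidean_space \<times> real) set \<Rightarrow> bool" where
  "nozzle \<Omega> \<longleftrightarrow> open \<Omega> \<and> connected \<Omega> \<and> \<Omega> \<noteq> {} \<and>
     (\<exists>\<alpha> K T T1 T2 S S1 S2. 0 < \<alpha> \<and> \<alpha> < 1 \<and>
        homeomorphism (closure \<Omega>) (closure cylinder) T S \<and>
        C2_up_to_boundary \<Omega> T T1 T2 \<and> C2_up_to_boundary cylinder S S1 S2 \<and>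
        T ` frontier \<Omega> = frontier cylinder \<and>
        (\<forall>k. T ` (\<Omega> \<inter> {x. snd x = k}) = ball 0 1 \<times> {k}) \<and>
        C2_holder_norm \<alpha> \<Omega> T T1 T2 + C2_holder_norm \<alpha> cylinder S S1 S2 \<le> ennreal K)"

definition truncation :: "('a::euclidean_space \<times> real) set \<Rightarrow> real \<Rightarrow> ('a \<times> real) set" where
  "truncation \<Omega> L = {x\<in>\<Omega>. \<bar>snd x\<bar> < L}"

definition slab :: "('a::euclidean_space \<times> real) set \<Rightarrow> real \<Rightarrow> real \<Rightarrow> ('a \<times> real) set" where
  "slab \<Omega> a b = {x\<in>\<Omega>. a < snd x \<and> snd x < b}"

text \<open>
  The slice of \<open>\<Omega>\<close> at height \<open>t\<close>, as a subset of the transversal factor, so that its area is its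
  Lebesgue measure there.  The faces \<open>S\<close> at the ends of the truncation are \<open>t = L\<close> and \<open>t = -L\<close>.
\<close>

definition cross_section :: "('a::euclidean_space \<times> real) set \<Rightarrow> real \<Rightarrow> 'a set" where
  "cross_section \<Omega> t = {x'. (x', t) \<in> \<Omega>}"

section \<open>Sobolev functions and traces on flat boundary pieces\<close>

definition L2 :: "'b::euclidean_space set \<Rightarrow> ('b \<Rightarrow> 'c::euclidean_space) set" where
  "L2 U = {f. set_borel_measurable lebesgue U f \<and> set_integrable lebesgue U (\<lambda>x. (norm (f x))\<^sup>2)}"

definition L2_tendsto ::
  "'b::euclidean_space set \<Rightarrow> (nat \<Rightarrow> 'b \<Rightarrow> 'c::euclidean_space) \<Rightarrow> ('b \<Rightarrow> 'c) \<Rightarrow> bool" where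
  "L2_tendsto U F f \<longleftrightarrow> (\<forall>k. (\<lambda>x. F k x - f x) \<in> L2 U) \<and>
     (\<lambda>k. LINT x:U|lebesgue. (norm (F k x - f x))\<^sup>2) \<longlonglongrightarrow> 0"

definition C1_with_gradient :: "('b::euclidean_space \<Rightarrow> real) \<Rightarrow> ('b \<Rightarrow> 'b) \<Rightarrow> bool" where
  "C1_with_gradient v Dv \<longleftrightarrow> (\<forall>x. GDERIV v x :> Dv x) \<and> continuous_on UNIV Dv"

text \<open>
  \<open>u\<close> is in \<open>H\<^sup>1(U)\<close> with weak gradient \<open>G\<close> (which is unique up to null sets).  As in Gilbarg and
  Trudinger, first-order weak derivatives are tested against compactly supported \<open>C\<^sup>1\<close> functions.
\<close>

definition has_weak_gradient ::
  "'b::euclidean_space set \<Rightarrow> ('b \<Rightarrow> real) \<Rightarrow> ('b \<Rightarrow> 'b) \<Rightarrow> bool" where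
  "has_weak_gradient U u G \<longleftrightarrow> u \<in> L2 U \<and> G \<in> L2 U \<and>
     (\<forall>\<eta> D\<eta>. C1_with_gradient \<eta> D\<eta> \<and> compact (closure {x. \<eta> x \<noteq> 0}) \<and> closure {x. \<eta> x \<noteq> 0} \<subseteq> U \<longrightarrow>
        (LINT x:U|lebesgue. u x *\<^sub>R D\<eta> x) = - (LINT x:U|lebesgue. \<eta> x *\<^sub>R G x))"

definition H1 :: "'b::euclidean_space set \<Rightarrow> ('b \<Rightarrow> real) set" where
  "H1 U = {u. \<exists>G. has_weak_gradient U u G}"

text \<open>
  \<open>g\<close> is the trace of \<open>u \<in> H\<^sup>1(U)\<close> on the flat boundary piece \<open>A \<times> {t}\<close>: the trace operator is the
  continuous extension of restriction from \<open>C\<^sup>1\<close> functions on the closure of \<open>U\<close>.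
\<close>

definition has_trace ::
  "('a::euclidean_space \<times> real) set \<Rightarrow> 'a set \<Rightarrow> real \<Rightarrow> ('a \<times> real \<Rightarrow> real) \<Rightarrow> ('a \<Rightarrow> real) \<Rightarrow> bool" where
  "has_trace U A t u g \<longleftrightarrow>
     (\<exists>G v Dv. has_weak_gradient U u G \<and> (\<forall>k. C1_with_gradient (v k) (Dv k)) \<and>
        L2_tendsto U v u \<and> L2_tendsto U Dv G \<and>
        L2_tendsto A (\<lambda>k x'. v k (x', t)) g)"

section \<open>The truncated problem\<close>

definition H_trunc :: "('a::euclidean_space \<times> real) set \<Rightarrow> real \<Rightarrow> ('a \<times> real \<Rightarrow> real) set" where
  "H_trunc \<Omega> L = {\<phi> \<in> H1 (truncation \<Omega> L).
     has_trace (truncation \<Omega> L) (cross_section \<Omega> (- L)) (- L) \<phi> (\<lambda>_. 0)}"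

definition truncated_solution ::
  "('a::euclidean_space \<times> real) set \<Rightarrow> real \<Rightarrow> real \<Rightarrow> ('a \<times> real \<Rightarrow> real) \<Rightarrow> bool" where
  "truncated_solution \<Omega> L m \<phi> \<longleftrightarrow> \<phi> \<in> H_trunc \<Omega> L \<and>
     (\<forall>\<eta> \<in> H_trunc \<Omega> L. \<forall>G\<phi> G\<eta> g.
        has_weak_gradient (truncation \<Omega> L) \<phi> G\<phi> \<and> has_weak_gradient (truncation \<Omega> L) \<eta> G\<eta> \<and>
        has_trace (truncation \<Omega> L) (cross_section \<Omega> L) L \<eta> g \<longrightarrow>
        (LINT x:truncation \<Omega> L|lebesgue. G\<phi> x \<bullet> G\<eta> x) =
        m / measure lebesgue (cross_section \<Omega> L) * (LINT x':cross_section \<Omega> L|lebesgue. g x'))"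

end

theory Submission
  imports Defs
begin

text \<open>
  Let \<open>E a b\<close> be the energy in the slab \<open>a < x\<^sub>n < b\<close>. Testing with a function that equals
  \<open>\<phi> - c\<^sub>1\<close> in the slab, \<open>0\<close> below and the constant \<open>c\<^sub>2 - c\<^sub>1\<close> above, where \<open>c\<^sub>1, c\<^sub>2\<close> are means of \<open>\<phi>\<close>
  over the two adjacent unit slabs, bounds \<open>E a b\<close> by \<open>m (c\<^sub>2 - c\<^sub>1)\<close> plus the energy in these two
  slabs: the Poincare inequality holds in unit slabs with a constant that does not depend on their
  position, since it transfers from the convex cylinder through the nozzle map. As
  \<open>\<bar>c\<^sub>2 - c\<^sub>1\<bar>\<^sup>2\<close> is at most linear in \<open>b - a\<close> times the energy, this gives
  \<open>E a b \<le> \<theta> E (a - 1) (b + 1) + C m\<^sup>2 (b - a + 2)\<close> with \<open>\<theta> < 1\<close>. Iterating it about \<open>L / 2\<close>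
  times multiplies the total energy, which is at most \<open>C m\<^sup>2 L\<close>, by \<open>\<theta>\<close> to the power \<open>L / 2\<close>.
\<close>

text \<open>The \<open>C\<^sup>1\<close> functions on which every inequality is proved come from the
  definition of \<open>H_trunc\<close>: its trace condition supplies a sequence converging to \<phi>
  together with gradient and bottom trace, and each estimate is passed to the limit along it. The
  chart acts only through Lipschitz bounds: image measures are compared with a constant in place of
  a Jacobian, in both directions. The ratio \<theta> < 1 is hole filling. The energy of the two end
  slabs is at most \<open>E (a - 1) (b + 1) - E a b\<close>; moving the negative part to the left
  leaves coefficients whose quotient is below 1, because Young's inequality lets the drift
  \<open>m (c2 - c1)\<close> cost only half of \<open>E (a - 1) (b + 1)\<close>. The total energy
  bound, linear in \<open>L\<close>, comes from testing with \<phi> itself. This requires a trace on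
  the top face, which is constructed as an \<open>L\<^sup>2\<close> limit. The linear growth is
  harmless because \<open>(N + 1) * \<theta> ^ N\<close> is bounded, and the inclusion in the
  half-length truncation leaves room for about \<open>L / 2\<close> enlargements by one unit on each
  side.\<close>

subsection \<open>Square integrable functions\<close>

lemma set_borel_measurable_continuous:
  fixes f :: "'b::euclidean_space \<Rightarrow> 'c::euclidean_space"
  assumes "continuous_on UNIV f" "U \<in> sets lebesgue"
  shows "set_borel_measurable lebesgue U f"
proof -
  have "f \<in> borel_measurable borel" by (rule borel_measurable_continuous_onI[OF assms(1)])
  then have "f \<in> borel_measurable lebesgue" by (simp add: measurable_completion)
  then show ?thesis using assms(2) by (auto simp: set_borel_measurable_def)
qed

lemma set_borel_measurable_norm_power2:
  fixes f :: "'b::euclidean_space \<Rightarrow> 'c::euclidean_space"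
  assumes "set_borel_measurable lebesgue U f"
  shows "set_borel_measurable lebesgue U (\<lambda>x. (norm (f x))\<^sup>2)"
proof -
  have "(\<lambda>x. indicator U x *\<^sub>R (norm (f x))\<^sup>2) = (\<lambda>x. (norm (indicator U x *\<^sub>R f x))\<^sup>2)"
    by (auto simp: indicator_def)
  moreover have "(\<lambda>x. (norm (indicator U x *\<^sub>R f x))\<^sup>2) \<in> borel_measurable lebesgue"
    using assms unfolding set_borel_measurable_def by measurable
  ultimately show ?thesis by (simp add: set_borel_measurable_def)
qed

lemma set_borel_measurable_add_lebesgue:
  fixes f g :: "'b::euclidean_space \<Rightarrow> 'c::euclidean_space"
  assumes "set_borel_measurable lebesgue U f" "set_borel_measurable lebesgue U g"
  shows "set_borel_measurable lebesgue U (\<lambda>x. f x + g x)"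
  using assms unfolding set_borel_measurable_def by (auto simp: scaleR_add_right)

lemma set_borel_measurable_scaleR_lebesgue:
  fixes g :: "'b::euclidean_space \<Rightarrow> 'c::euclidean_space" and f :: "'b \<Rightarrow> real"
  assumes "set_borel_measurable lebesgue U f" "set_borel_measurable lebesgue U g"
  shows "set_borel_measurable lebesgue U (\<lambda>x. f x *\<^sub>R g x)"
proof -
  have "(\<lambda>x. indicator U x *\<^sub>R f x *\<^sub>R g x) = (\<lambda>x. (indicator U x *\<^sub>R f x) *\<^sub>R (indicator U x *\<^sub>R g x))"
    by (auto simp: indicator_def)
  moreover have "(\<lambda>x. (indicator U x *\<^sub>R f x) *\<^sub>R (indicator U x *\<^sub>R g x)) \<in> borel_measurable lebesgue"
    using assms unfolding set_borel_measurable_def by (rule borel_measurable_scaleR)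
  ultimately show ?thesis by (simp add: set_borel_measurable_def)
qed

lemma set_borel_measurable_inner_lebesgue:
  fixes f g :: "'b::euclidean_space \<Rightarrow> 'c::euclidean_space"
  assumes "set_borel_measurable lebesgue U f" "set_borel_measurable lebesgue U g"
  shows "set_borel_measurable lebesgue U (\<lambda>x. f x \<bullet> g x)"
proof -
  have "(\<lambda>x. indicator U x *\<^sub>R (f x \<bullet> g x)) = (\<lambda>x. (indicator U x *\<^sub>R f x) \<bullet> (indicator U x *\<^sub>R g x))"
    by (auto simp: indicator_def)
  moreover have "(\<lambda>x. (indicator U x *\<^sub>R f x) \<bullet> (indicator U x *\<^sub>R g x)) \<in> borel_measurable lebesgue"
    using assms unfolding set_borel_measurable_def by (rule borel_measurable_inner)
  ultimately show ?thesis by (simp add: set_borel_measurable_def)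
qed

lemma set_borel_measurable_subset_lebesgue:
  fixes f :: "'b::euclidean_space \<Rightarrow> 'c::euclidean_space"
  assumes "set_borel_measurable lebesgue U f" "D \<in> sets lebesgue" "D \<subseteq> U"
  shows "set_borel_measurable lebesgue D f"
proof -
  have "(\<lambda>x. indicator D x *\<^sub>R f x) = (\<lambda>x. indicator D x *\<^sub>R (indicator U x *\<^sub>R f x))"
    using assms(3) by (intro ext) (auto simp: indicator_def)
  moreover have "(\<lambda>x. indicator D x *\<^sub>R (indicator U x *\<^sub>R f x)) \<in> borel_measurable lebesgue"
    by (rule borel_measurable_scaleR[OF borel_measurable_indicator[OF assms(2)] assms(1)[unfolded set_borel_measurable_def]])
  ultimately show ?thesis unfolding set_borel_measurable_def by simp
qed

lemma set_integrable_dominated: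
  fixes f :: "'b::euclidean_space \<Rightarrow> 'c::euclidean_space"
  assumes "set_borel_measurable lebesgue U f" "set_integrable lebesgue U h"
    and "\<And>x. x \<in> U \<Longrightarrow> norm (f x) \<le> h x"
  shows "set_integrable lebesgue U f"
  using assms(2) unfolding set_integrable_def
  by (rule Bochner_Integration.integrable_bound)
     (use assms in \<open>auto simp: set_borel_measurable_def indicator_def intro: order_trans[OF _ abs_ge_self]\<close>)

lemma set_integral_mono_domain:
  fixes f :: "'b::euclidean_space \<Rightarrow> real"
  assumes "set_integrable lebesgue U f" "D \<in> sets lebesgue" "D \<subseteq> U" "\<And>x. 0 \<le> f x"
  shows "(LINT x:D|lebesgue. f x) \<le> (LINT x:U|lebesgue. f x)"
  unfolding set_lebesgue_integral_def
proof (rule integral_mono)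
  show "integrable lebesgue (\<lambda>x. indicat_real D x *\<^sub>R f x)"
    using set_integrable_subset[OF assms(1-3)] by (simp add: set_integrable_def)
  show "integrable lebesgue (\<lambda>x. indicat_real U x *\<^sub>R f x)"
    using assms(1) by (simp add: set_integrable_def)
qed (use assms in \<open>auto simp: indicator_def\<close>)

lemma set_integral_nonneg_lebesgue:
  fixes f :: "'b::euclidean_space \<Rightarrow> real"
  assumes "\<And>x. 0 \<le> f x"
  shows "0 \<le> (LINT x:U|lebesgue. f x)"
  unfolding set_lebesgue_integral_def using assms by (intro integral_nonneg_AE) (auto simp: indicator_def)

lemma L2I:
  fixes f :: "'b::euclidean_space \<Rightarrow> 'c::euclidean_space"
  assumes "set_borel_measurable lebesgue U f" "set_integrable lebesgue U h"
    and "\<And>x. x \<in> U \<Longrightarrow> (norm (f x))\<^sup>2 \<le> h x"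
  shows "f \<in> L2 U"
  unfolding L2_def
  using set_integrable_dominated[OF set_borel_measurable_norm_power2[OF assms(1)] assms(2)] assms
  by auto

lemma L2D:
  assumes "f \<in> L2 U"
  shows "set_borel_measurable lebesgue U f" "set_integrable lebesgue U (\<lambda>x. (norm (f x))\<^sup>2)"
  using assms by (auto simp: L2_def)

lemma norm_add_power2_le: "(norm (x + y :: 'c::real_inner))\<^sup>2 \<le> 2 * (norm x)\<^sup>2 + 2 * (norm y)\<^sup>2"
proof -
  have "0 \<le> (norm (x - y))\<^sup>2" by simp
  then show ?thesis
    by (simp add: power2_norm_eq_inner inner_add inner_diff inner_commute algebra_simps)
qed

lemma norm_mult_le_power2: "norm x * norm y \<le> (norm x)\<^sup>2 + (norm y)\<^sup>2"
  using sum_squares_bound[of "norm x" "norm y"] mult_nonneg_nonneg[OF norm_ge_zero[of x] norm_ge_zero[of y]]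
  by linarith

lemma L2_add:
  fixes f g :: "'b::euclidean_space \<Rightarrow> 'c::euclidean_space"
  assumes "f \<in> L2 U" "g \<in> L2 U"
  shows "(\<lambda>x. f x + g x) \<in> L2 U"
    "(LINT x:U|lebesgue. (norm (f x + g x))\<^sup>2) \<le>
      2 * (LINT x:U|lebesgue. (norm (f x))\<^sup>2) + 2 * (LINT x:U|lebesgue. (norm (g x))\<^sup>2)"
proof -
  have i: "set_integrable lebesgue U (\<lambda>x. 2 * (norm (f x))\<^sup>2)" "set_integrable lebesgue U (\<lambda>x. 2 * (norm (g x))\<^sup>2)"
    using assms by (auto simp: L2_def)
  show 1: "(\<lambda>x. f x + g x) \<in> L2 U"
    by (rule L2I[OF set_borel_measurable_add_lebesgue set_integral_add(1)[OF i]])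
       (use assms norm_add_power2_le in \<open>auto simp: L2_def\<close>)
  show "(LINT x:U|lebesgue. (norm (f x + g x))\<^sup>2) \<le>
      2 * (LINT x:U|lebesgue. (norm (f x))\<^sup>2) + 2 * (LINT x:U|lebesgue. (norm (g x))\<^sup>2)"
    using set_integral_mono[OF L2D(2)[OF 1] set_integral_add(1)[OF i] norm_add_power2_le] set_integral_add(2)[OF i]
    by simp
qed

lemma L2_uminus: "f \<in> L2 U \<Longrightarrow> (\<lambda>x. - f x) \<in> L2 U"
  by (auto simp: L2_def set_borel_measurable_def)

lemma L2_diff:
  fixes f g :: "'b::euclidean_space \<Rightarrow> 'c::euclidean_space"
  assumes "f \<in> L2 U" "g \<in> L2 U"
  shows "(\<lambda>x. f x - g x) \<in> L2 U"
    "(LINT x:U|lebesgue. (norm (f x - g x))\<^sup>2) \<le>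
      2 * (LINT x:U|lebesgue. (norm (f x))\<^sup>2) + 2 * (LINT x:U|lebesgue. (norm (g x))\<^sup>2)"
  using L2_add[OF assms(1) L2_uminus[OF assms(2)]] by simp_all

lemma L2_subset:
  fixes f :: "'b::euclidean_space \<Rightarrow> 'c::euclidean_space"
  assumes "f \<in> L2 U" "D \<in> sets lebesgue" "D \<subseteq> U"
  shows "f \<in> L2 D" "(LINT x:D|lebesgue. (norm (f x))\<^sup>2) \<le> (LINT x:U|lebesgue. (norm (f x))\<^sup>2)"
  using assms set_integrable_subset set_borel_measurable_subset_lebesgue set_integral_mono_domain[OF L2D(2)]
  by (fastforce simp: L2_def)+

lemma set_integrable_power2_add:
  fixes f :: "'b::euclidean_space \<Rightarrow> 'c::euclidean_space" and g :: "'b \<Rightarrow> 'd::euclidean_space"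
  assumes "f \<in> L2 U" "g \<in> L2 U"
  shows "set_integrable lebesgue U (\<lambda>x. (norm (f x))\<^sup>2 + (norm (g x))\<^sup>2)"
  using assms by (auto simp: L2_def intro: set_integral_add)

lemma L2_scaleR_integrable:
  fixes f :: "'b::euclidean_space \<Rightarrow> real" and g :: "'b \<Rightarrow> 'c::euclidean_space"
  assumes "f \<in> L2 U" "g \<in> L2 U"
  shows "set_integrable lebesgue U (\<lambda>x. f x *\<^sub>R g x)"
proof (rule set_integrable_dominated[OF _ set_integrable_power2_add[OF assms]])
  show "norm (f x *\<^sub>R g x) \<le> (norm (f x))\<^sup>2 + (norm (g x))\<^sup>2" for x
    using norm_mult_le_power2[of "f x" "g x"] by simp
qed (use assms in \<open>auto simp: L2_def intro: set_borel_measurable_scaleR_lebesgue\<close>)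

lemma L2_inner_integrable:
  fixes f g :: "'b::euclidean_space \<Rightarrow> 'c::euclidean_space"
  assumes "f \<in> L2 U" "g \<in> L2 U"
  shows "set_integrable lebesgue U (\<lambda>x. f x \<bullet> g x)"
proof (rule set_integrable_dominated[OF _ set_integrable_power2_add[OF assms]])
  show "norm (f x \<bullet> g x) \<le> (norm (f x))\<^sup>2 + (norm (g x))\<^sup>2" for x
    using Cauchy_Schwarz_ineq2[of "f x" "g x"] norm_mult_le_power2[of "f x" "g x"] by simp
qed (use assms in \<open>auto simp: L2_def intro: set_borel_measurable_inner_lebesgue\<close>)

lemma set_integrable_const_lebesgue:
  assumes "U \<in> lmeasurable"
  shows "set_integrable lebesgue U (\<lambda>_. c::real)"
  using assms unfolding set_integrable_def by (auto simp: fmeasurable_def)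

lemma continuous_bounded_on_bounded:
  fixes f :: "'b::euclidean_space \<Rightarrow> 'c::euclidean_space"
  assumes "continuous_on UNIV f" "bounded U"
  obtains B where "0 \<le> B" "\<And>x. x \<in> U \<Longrightarrow> norm (f x) \<le> B"
proof -
  have "compact (f ` closure U)"
    using assms by (intro compact_continuous_image continuous_on_subset[OF assms(1)]) (auto simp: compact_closure)
  then obtain B where "\<And>x. x \<in> closure U \<Longrightarrow> norm (f x) \<le> B"
    by (metis bounded_iff compact_imp_bounded imageI)
  then show ?thesis
    using closure_subset[of U] by (intro that[of "max 0 B"]) force+
qed

lemma L2_continuous:
  fixes f :: "'b::euclidean_space \<Rightarrow> 'c::euclidean_space"
  assumes "continuous_on UNIV f" "U \<in> sets lebesgue" "bounded U"
  shows "f \<in> L2 U"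
proof -
  obtain B where B: "0 \<le> B" "\<And>x. x \<in> U \<Longrightarrow> norm (f x) \<le> B"
    using continuous_bounded_on_bounded assms by metis
  show ?thesis
    by (rule L2I[OF set_borel_measurable_continuous[OF assms(1,2)]
          set_integrable_const_lebesgue[OF bounded_set_imp_lmeasurable[OF assms(3,2)], of "B\<^sup>2"]])
       (use B in \<open>auto intro: power_mono\<close>)
qed

lemma L2_bounded_scaleR:
  fixes \<psi> :: "'b::euclidean_space \<Rightarrow> real" and f :: "'b \<Rightarrow> 'c::euclidean_space"
  assumes "continuous_on UNIV \<psi>" "U \<in> sets lebesgue" "bounded U" "f \<in> L2 U"
  shows "(\<lambda>x. \<psi> x *\<^sub>R f x) \<in> L2 U"
proof -
  obtain B where B: "0 \<le> B" "\<And>x. x \<in> U \<Longrightarrow> norm (\<psi> x) \<le> B"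
    using continuous_bounded_on_bounded assms by metis
  show ?thesis
  proof (rule L2I)
    show "set_borel_measurable lebesgue U (\<lambda>x. \<psi> x *\<^sub>R f x)"
      by (intro set_borel_measurable_scaleR_lebesgue set_borel_measurable_continuous assms L2D)
    show "set_integrable lebesgue U (\<lambda>x. B\<^sup>2 * (norm (f x))\<^sup>2)"
      using L2D(2)[OF assms(4)] by simp
    show "(norm (\<psi> x *\<^sub>R f x))\<^sup>2 \<le> B\<^sup>2 * (norm (f x))\<^sup>2" if "x \<in> U" for x
      using B(2)[OF that] by (simp add: power_mult_distrib mult_right_mono power2_le_iff_abs_le B(1) abs_le_square_iff)
  qed
qed

lemma L2_scaleR_bounded:
  fixes u :: "'b::euclidean_space \<Rightarrow> real" and f :: "'b \<Rightarrow> 'c::euclidean_space"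
  assumes "u \<in> L2 U" "continuous_on UNIV f" "U \<in> sets lebesgue" "bounded U"
  shows "(\<lambda>x. u x *\<^sub>R f x) \<in> L2 U"
proof -
  obtain B where B: "0 \<le> B" "\<And>x. x \<in> U \<Longrightarrow> norm (f x) \<le> B"
    using continuous_bounded_on_bounded assms by metis
  show ?thesis
  proof (rule L2I)
    show "set_borel_measurable lebesgue U (\<lambda>x. u x *\<^sub>R f x)"
      by (intro set_borel_measurable_scaleR_lebesgue set_borel_measurable_continuous assms L2D)
    show "set_integrable lebesgue U (\<lambda>x. B\<^sup>2 * (norm (u x))\<^sup>2)"
      using L2D(2)[OF assms(1)] by simp
    show "(norm (u x *\<^sub>R f x))\<^sup>2 \<le> B\<^sup>2 * (norm (u x))\<^sup>2" if "x \<in> U" for x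
      using power_mono[OF B(2)[OF that] norm_ge_zero, of 2]
      by (simp add: power_mult_distrib mult.commute[of "B\<^sup>2"] mult_left_mono)
  qed
qed

text \<open>Expands the nonnegative integral of \<open>(g x - c)\<^sup>2\<close> with
  \<open>c\<close> the mean of \<open>g\<close> over \<open>A\<close>; a null set \<open>A\<close>
  has no mean and is treated apart.\<close>

lemma set_integral_Cauchy_Schwarz_const:
  fixes g :: "'b::euclidean_space \<Rightarrow> real"
  assumes "g \<in> L2 A" "A \<in> lmeasurable"
  shows "(LINT x:A|lebesgue. g x)\<^sup>2 \<le> measure lebesgue A * (LINT x:A|lebesgue. (norm (g x))\<^sup>2)"
proof (cases "measure lebesgue A = 0")
  case True
  then have "A \<in> null_sets lebesgue"
    using assms(2) measure_eq_0_null_sets by (auto simp: null_sets_def emeasure_eq_measure2)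
  then have "(LINT x:A|lebesgue. g x) = 0"
    by (auto simp: set_lebesgue_integral_def intro!: integral_eq_zero_AE AE_I'[of A] simp: indicator_def)
  then show ?thesis using True by simp
next
  case False
  define M where "M = measure lebesgue A"
  have M: "0 < M" using False by (simp add: M_def zero_less_measure_iff)
  define J where "J = (LINT x:A|lebesgue. g x)"
  define c where "c = J / M"
  have one: "(\<lambda>_. 1::real) \<in> L2 A"
    by (rule L2I[OF set_borel_measurable_continuous set_integrable_const_lebesgue[OF assms(2), of 1]])
       (use assms in auto)
  have ig: "set_integrable lebesgue A g"
    using L2_scaleR_integrable[OF assms(1) one] by simp
  have ig2: "set_integrable lebesgue A (\<lambda>x. (norm (g x))\<^sup>2)" using assms(1) L2D by blast
  have ic: "set_integrable lebesgue A (\<lambda>x. c\<^sup>2)" by (rule set_integrable_const_lebesgue[OF assms(2)])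
  have "0 \<le> (LINT x:A|lebesgue. (g x - c)\<^sup>2)" by (rule set_integral_nonneg_lebesgue) simp
  also have "\<dots> = (LINT x:A|lebesgue. ((norm (g x))\<^sup>2 - 2 * c * g x) + c\<^sup>2)"
    by (rule set_lebesgue_integral_cong) (use assms(2) in \<open>auto simp: power2_eq_square algebra_simps\<close>)
  also have "\<dots> = (LINT x:A|lebesgue. (norm (g x))\<^sup>2) - 2 * c * J + c\<^sup>2 * M"
    using ig ig2 ic assms(2)
    by (subst set_integral_add(2), simp, simp, subst set_integral_diff(2))
       (auto simp: J_def M_def set_lebesgue_integral_def[of _ _ "\<lambda>_. c\<^sup>2"])
  also have "\<dots> = (LINT x:A|lebesgue. (norm (g x))\<^sup>2) - J\<^sup>2 / M"
    using M by (simp add: c_def power2_eq_square field_simps)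
  finally show ?thesis using M by (simp add: J_def M_def field_simps)
qed

text \<open>Two dominating sequences are allowed because the error in the gradient of a product
  \<psi> \<open>v\<close> involves both the error of \<open>v\<close> and that of its
  gradient.\<close>

lemma L2_tendstoI:
  fixes H :: "nat \<Rightarrow> 'b::euclidean_space \<Rightarrow> 'c::euclidean_space" and F :: "nat \<Rightarrow> 'b \<Rightarrow> 'd::euclidean_space"
    and F' :: "nat \<Rightarrow> 'b \<Rightarrow> 'e::euclidean_space"
  assumes F: "L2_tendsto U F f" "L2_tendsto U F' f'"
    and meas: "\<And>k. set_borel_measurable lebesgue U (\<lambda>x. H k x - h x)"
    and le: "\<And>k x. x \<in> U \<Longrightarrow> (norm (H k x - h x))\<^sup>2 \<le> B * (norm (F k x - f x))\<^sup>2 + B * (norm (F' k x - f' x))\<^sup>2"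
  shows "L2_tendsto U H h"
  unfolding L2_tendsto_def
proof
  have int: "set_integrable lebesgue U (\<lambda>x. B * (norm (F k x - f x))\<^sup>2)"
     "set_integrable lebesgue U (\<lambda>x. B * (norm (F' k x - f' x))\<^sup>2)" for k
    using F by (auto simp: L2_tendsto_def L2_def)
  show L: "\<forall>k. (\<lambda>x. H k x - h x) \<in> L2 U"
    by (intro allI L2I[OF meas set_integral_add(1)[OF int] le])
  let ?b = "\<lambda>k. B * (LINT x:U|lebesgue. (norm (F k x - f x))\<^sup>2) + B * (LINT x:U|lebesgue. (norm (F' k x - f' x))\<^sup>2)"
  have le_b: "(LINT x:U|lebesgue. (norm (H k x - h x))\<^sup>2) \<le> ?b k" for k
    using set_integral_mono[OF L2D(2)[OF L[rule_format, of k]] set_integral_add(1)[OF int] le] set_integral_add(2)[OF int[of k]]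
    by simp
  have "?b \<longlonglongrightarrow> B * 0 + B * 0"
    using F unfolding L2_tendsto_def by (intro tendsto_add tendsto_mult tendsto_const) blast+
  then have lim_b: "?b \<longlonglongrightarrow> 0" by simp
  show "(\<lambda>k. LINT x:U|lebesgue. (norm (H k x - h x))\<^sup>2) \<longlonglongrightarrow> 0"
    by (rule real_tendsto_sandwich[OF always_eventually always_eventually tendsto_const lim_b])
       (simp_all add: set_integral_nonneg_lebesgue le_b)
qed

text \<open>Riesz-Fischer on a set of finite measure, from which the trace on the top face is
  obtained. A rapidly converging subsequence converges almost everywhere, and Fatou's lemma turns
  this into convergence of the whole sequence.\<close>

lemma L2_complete:
  fixes F :: "nat \<Rightarrow> 'b::euclidean_space \<Rightarrow> real"
  assumes A: "A \<in> lmeasurable" and F: "\<And>k. F k \<in> L2 A"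
    and Cauchy: "\<And>e. 0 < e \<Longrightarrow> \<exists>N. \<forall>j\<ge>N. \<forall>k\<ge>N. (LINT x:A|lebesgue. (norm (F j x - F k x))\<^sup>2) < e"
  obtains g where "L2_tendsto A F g"
proof -
  define f where "f = (\<lambda>k x. indicator A x *\<^sub>R F k x)"
  have f_meas[measurable]: "f k \<in> borel_measurable lebesgue" for k
    using L2D(1)[OF F] by (simp add: f_def set_borel_measurable_def)
  have diff_int: "integrable lebesgue (\<lambda>x. (f j x - f k x)\<^sup>2)"
    and diff_eq: "(LINT x:A|lebesgue. (norm (F j x - F k x))\<^sup>2) = (\<integral>x. (f j x - f k x)\<^sup>2 \<partial>lebesgue)" for j k
  proof -
    have "(\<lambda>x. (f j x - f k x)\<^sup>2) = (\<lambda>x. indicator A x *\<^sub>R (norm (F j x - F k x))\<^sup>2)"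
      by (auto simp: f_def indicator_def)
    then show "integrable lebesgue (\<lambda>x. (f j x - f k x)\<^sup>2)"
      "(LINT x:A|lebesgue. (norm (F j x - F k x))\<^sup>2) = (\<integral>x. (f j x - f k x)\<^sup>2 \<partial>lebesgue)"
      using L2D(2)[OF L2_diff(1)[OF F[of j] F[of k]]]
      by (simp_all add: set_integrable_def set_lebesgue_integral_def)
  qed
  have "\<exists>N. \<forall>j\<ge>N. \<forall>k\<ge>N. (LINT x:A|lebesgue. (norm (F j x - F k x))\<^sup>2) < (1/4)^i" for i
    by (rule Cauchy) simp
  then obtain N where N: "\<And>i j k. N i \<le> j \<Longrightarrow> N i \<le> k \<Longrightarrow> (\<integral>x. (f j x - f k x)\<^sup>2 \<partial>lebesgue) < (1/4)^i"
    unfolding diff_eq by metis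
  \<comment> \<open>Partial sums of the thresholds are at least \<open>N i\<close> and increase with
    \<open>i\<close>, so no minimality of \<open>N\<close> has to be arranged.\<close>
  define r where "r i = (\<Sum>l\<le>i. N l)" for i
  have rN: "N i \<le> r i" for i unfolding r_def by (rule member_le_sum) auto
  have r_mono: "r i \<le> r j" if "i \<le> j" for i j unfolding r_def by (rule sum_mono2) (use that in auto)
  define d where "d i x = f (r (Suc i)) x - f (r i) x" for i x
  have d_meas[measurable]: "d i \<in> borel_measurable lebesgue" for i
    unfolding d_def by measurable
  let ?M = "measure lebesgue A"
  have d_le: "(\<integral>\<^sup>+x. ennreal \<bar>d i x\<bar> \<partial>lebesgue) \<le> ennreal ((?M + 1) * (1/2)^i)" for i
  proof -
    \<comment> \<open>Obtained from the square of \<open>1 - 2^i * \<bar>d i x\<bar>\<close>: it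
      trades the \<open>L\<^sup>2\<close> bound \<open>(1/4)^i\<close> for an
      \<open>L\<^sup>1\<close> bound of order \<open>(1/2)^i\<close>, which is summable. Outside
      \<open>A\<close> both sides vanish.\<close>
    let ?h = "\<lambda>x. (1/2)^i * indicator A x + 2^i * (d i x)\<^sup>2"
    have ind: "integrable lebesgue (\<lambda>x. indicator A x :: real)" using fmeasurableD2[OF A] fmeasurableD[OF A]
      by (intro integrable_real_indicator) (simp_all only: top.not_eq_extremum infinity_ennreal_def)
    have int: "integrable lebesgue ?h"
      unfolding d_def by (intro Bochner_Integration.integrable_add integrable_mult_right ind diff_int)
    have "\<bar>d i x\<bar> \<le> ?h x" for x
    proof (cases "x \<in> A")
      case True
      have "0 \<le> (1 - 2^i * \<bar>d i x\<bar>)\<^sup>2" by simp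
      also have "\<dots> = 1 - 2 * 2^i * \<bar>d i x\<bar> + 2^i * (2^i * (d i x)\<^sup>2)"
        by (simp add: power2_eq_square algebra_simps)
      finally have "2^i * (2 * \<bar>d i x\<bar>) \<le> 2^i * ?h x"
        using True by (simp add: distrib_left power_mult_distrib[symmetric] algebra_simps)
      then have "2 * \<bar>d i x\<bar> \<le> ?h x" by simp
      then show ?thesis by linarith
    qed (simp add: d_def f_def)
    then have "(\<integral>\<^sup>+x. ennreal \<bar>d i x\<bar> \<partial>lebesgue) \<le> (\<integral>\<^sup>+x. ennreal (?h x) \<partial>lebesgue)"
      by (intro nn_integral_mono ennreal_leI)
    also have "\<dots> = ennreal (\<integral>x. ?h x \<partial>lebesgue)"
      by (rule nn_integral_eq_integral[OF int]) simp
    also have "(\<integral>x. ?h x \<partial>lebesgue) = (1/2)^i * ?M + 2^i * (\<integral>x. (d i x)\<^sup>2 \<partial>lebesgue)"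
      using ind diff_int[of "r (Suc i)" "r i"] A unfolding d_def
      by (subst Bochner_Integration.integral_add) auto
    also have "\<dots> \<le> (1/2)^i * ?M + 2^i * (1/4)^i"
    proof -
      have "(\<integral>x. (d i x)\<^sup>2 \<partial>lebesgue) < (1/4)^i"
        unfolding d_def using rN[of i] r_mono[of i "Suc i"] by (intro N) auto
      then show ?thesis by (intro add_left_mono mult_left_mono) auto
    qed
    also have "\<dots> = (?M + 1) * (1/2)^i"
      by (simp add: algebra_simps power_mult_distrib[symmetric])
    finally show ?thesis by (simp add: ennreal_leI)
  qed
  have "(\<integral>\<^sup>+x. (\<Sum>i. ennreal \<bar>d i x\<bar>) \<partial>lebesgue) = (\<Sum>i. \<integral>\<^sup>+x. ennreal \<bar>d i x\<bar> \<partial>lebesgue)"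
    by (rule nn_integral_suminf) measurable
  also have "\<dots> \<le> (\<Sum>i. ennreal ((?M + 1) * (1/2)^i))"
    by (intro suminf_le d_le) auto
  also have "\<dots> = ennreal (\<Sum>i. (?M + 1) * (1/2)^i)"
    by (rule suminf_ennreal2) (auto intro!: summable_mult summable_geometric)
  finally have "(\<integral>\<^sup>+x. (\<Sum>i. ennreal \<bar>d i x\<bar>) \<partial>lebesgue) \<noteq> \<infinity>"
    using le_less_trans[OF _ ennreal_less_top] by fastforce
  then have "AE x in lebesgue. (\<Sum>i. ennreal \<bar>d i x\<bar>) \<noteq> \<infinity>"
    by (intro nn_integral_PInf_AE) measurable
  then have conv: "AE x in lebesgue. (\<lambda>i. f (r i) x) \<longlonglongrightarrow> lim (\<lambda>i. f (r i) x)"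
  proof eventually_elim
    fix x assume "(\<Sum>i. ennreal \<bar>d i x\<bar>) \<noteq> \<infinity>"
    then have "summable (\<lambda>i. \<bar>d i x\<bar>)" by (intro summable_suminf_not_top) auto
    then have "summable (\<lambda>i. d i x)" by (rule summable_rabs_cancel)
    then have "convergent (\<lambda>n. \<Sum>i<n. d i x)" by (simp add: summable_iff_convergent)
    then have "convergent (\<lambda>n. (\<Sum>i<n. d i x) + f (r 0) x)" by (intro convergent_add convergent_const)
    moreover have "(\<Sum>i<n. d i x) + f (r 0) x = f (r n) x" for n
      unfolding d_def by (subst sum_lessThan_telescope) simp
    ultimately show "(\<lambda>i. f (r i) x) \<longlonglongrightarrow> lim (\<lambda>i. f (r i) x)"
      by (simp add: convergent_LIMSEQ_iff)
  qed
  define g where "g x = lim (\<lambda>i. f (r i) x)" for x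
  have g_meas[measurable]: "g \<in> borel_measurable lebesgue"
    unfolding g_def by (rule borel_measurable_lim_metric) simp
  have gA: "g x = 0" if "x \<notin> A" for x using that by (simp add: g_def f_def)
  have eqg: "indicator A x *\<^sub>R (F k x - g x)\<^sup>2 = (f k x - g x)\<^sup>2" for k x
    using gA[of x] by (auto simp: f_def indicator_def)
  \<comment> \<open>Fatou's lemma with \<open>k\<close> fixed and the index of the subsequence
    tending to infinity; the Cauchy property bounds each term of the limes inferior.\<close>
  have close: "\<exists>K. \<forall>k\<ge>K. (\<integral>\<^sup>+x. ennreal ((f k x - g x)\<^sup>2) \<partial>lebesgue) \<le> ennreal e" if e: "0 < e" for e
  proof -
    obtain K where K: "\<And>j k. K \<le> j \<Longrightarrow> K \<le> k \<Longrightarrow> (\<integral>x. (f j x - f k x)\<^sup>2 \<partial>lebesgue) < e"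
      using Cauchy[OF e] unfolding diff_eq by blast
    obtain i0 where i0: "(1/4::real)^i0 < e" using real_arch_pow_inv[OF e, of "1/4"] by auto
    show ?thesis
    proof (intro exI[of _ "max K (N i0)"] allI impI)
      fix k assume k: "max K (N i0) \<le> k"
      have "(\<integral>\<^sup>+x. ennreal ((f k x - g x)\<^sup>2) \<partial>lebesgue) \<le>
          (\<integral>\<^sup>+x. liminf (\<lambda>i. ennreal ((f k x - f (r i) x)\<^sup>2)) \<partial>lebesgue)"
      proof (rule nn_integral_mono_AE, use conv in eventually_elim)
        case (elim x)
        then have "(\<lambda>i. ennreal ((f k x - f (r i) x)\<^sup>2)) \<longlonglongrightarrow> ennreal ((f k x - g x)\<^sup>2)"
          unfolding g_def by (intro tendsto_intros)
        from lim_imp_Liminf[OF sequentially_bot this] show ?case by (simp only: order_refl)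
      qed
      also have "\<dots> \<le> liminf (\<lambda>i. \<integral>\<^sup>+x. ennreal ((f k x - f (r i) x)\<^sup>2) \<partial>lebesgue)"
        by (rule nn_integral_liminf) measurable
      also have "\<dots> \<le> ennreal e"
      proof (rule Liminf_le)
        show "\<forall>\<^sub>F i in sequentially. (\<integral>\<^sup>+x. ennreal ((f k x - f (r i) x)\<^sup>2) \<partial>lebesgue) \<le> ennreal e"
          using eventually_ge_at_top[of i0]
        proof eventually_elim
          case (elim i)
          have "(\<integral>x. (f k x - f (r i) x)\<^sup>2 \<partial>lebesgue) < (1/4)^i0"
            using k rN[of i0] r_mono[OF elim] by (intro N) auto
          with i0 show ?case
            by (subst nn_integral_eq_integral[OF diff_int]) (auto intro!: ennreal_leI)
        qed
      qed simp
      finally show "(\<integral>\<^sup>+x. ennreal ((f k x - g x)\<^sup>2) \<partial>lebesgue) \<le> ennreal e" .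
    qed
  qed
  have L2I': "(\<lambda>x. F k x - g x) \<in> L2 A" if "(\<integral>\<^sup>+x. ennreal ((f k x - g x)\<^sup>2) \<partial>lebesgue) \<le> ennreal e" for k e
  proof -
    have "integrable lebesgue (\<lambda>x. (f k x - g x)\<^sup>2)"
      using that le_less_trans[OF _ ennreal_less_top] by (intro integrableI_nonneg) auto
    moreover have "(\<lambda>x. indicat_real A x *\<^sub>R (F k x - g x)) \<in> borel_measurable lebesgue"
    proof -
      have "(\<lambda>x. indicat_real A x *\<^sub>R (F k x - g x)) = (\<lambda>x. f k x - g x)"
        using gA by (auto simp: f_def indicator_def)
      then show ?thesis by simp
    qed
    ultimately show ?thesis
      by (simp add: L2_def set_borel_measurable_def set_integrable_def eqg del: real_scaleR_def)
  qed
  have all_L2: "(\<lambda>x. F k x - g x) \<in> L2 A" for k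
  proof -
    obtain K where "(\<lambda>x. F K x - g x) \<in> L2 A" using close[of 1] L2I' by fastforce
    from L2_add(1)[OF L2_diff(1)[OF F[of k] F[of K]] this] show ?thesis by simp
  qed
  have "L2_tendsto A F g"
    unfolding L2_tendsto_def
  proof (intro conjI allI all_L2 LIMSEQ_I)
    fix e :: real assume e: "0 < e"
    then obtain K where K: "\<And>k. K \<le> k \<Longrightarrow> (\<integral>\<^sup>+x. ennreal ((f k x - g x)\<^sup>2) \<partial>lebesgue) \<le> ennreal (e / 2)"
      using close[of "e/2"] by auto
    have "norm ((LINT x:A|lebesgue. (norm (F k x - g x))\<^sup>2) - 0) < e" if "K \<le> k" for k
    proof -
      have int: "integrable lebesgue (\<lambda>x. (f k x - g x)\<^sup>2)"
        using L2D(2)[OF all_L2[of k]] by (simp add: set_integrable_def eqg del: real_scaleR_def)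
      have "ennreal (\<integral>x. (f k x - g x)\<^sup>2 \<partial>lebesgue) \<le> ennreal (e/2)"
        using K[OF that] by (subst (asm) nn_integral_eq_integral[OF int]) auto
      then have "(\<integral>x. (f k x - g x)\<^sup>2 \<partial>lebesgue) \<le> e/2" using e by (subst (asm) ennreal_le_iff) auto
      moreover have "0 \<le> (\<integral>x. (f k x - g x)\<^sup>2 \<partial>lebesgue)" by simp
      ultimately show ?thesis
        using e by (simp add: set_lebesgue_integral_def eqg del: real_scaleR_def)
    qed
    then show "\<exists>no. \<forall>n\<ge>no. norm ((LINT x:A|lebesgue. (norm (F n x - g x))\<^sup>2) - 0) < e" by blast
  qed
  then show ?thesis by (rule that)
qed

subsection \<open>Weak gradients\<close>

lemma C1_with_gradientD:
  assumes "C1_with_gradient v Dv"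
  shows "(v has_derivative (\<lambda>h. h \<bullet> Dv x)) (at x)" "continuous_on UNIV v" "continuous_on UNIV Dv"
proof -
  show 1: "(v has_derivative (\<lambda>h. h \<bullet> Dv x)) (at x)" for x
    using assms by (simp add: C1_with_gradient_def gderiv_def)
  show "continuous_on UNIV v"
    by (simp add: continuous_on_eq_continuous_at has_derivative_continuous[OF 1])
qed (use assms in \<open>simp add: C1_with_gradient_def\<close>)

lemma C1_with_gradient_mult:
  assumes "C1_with_gradient f Df" "C1_with_gradient g Dg"
  shows "C1_with_gradient (\<lambda>x. f x * g x) (\<lambda>x. f x *\<^sub>R Dg x + g x *\<^sub>R Df x)"
  using assms C1_with_gradientD(2)[OF assms(1)] C1_with_gradientD(2)[OF assms(2)]
  unfolding C1_with_gradient_def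
  by (auto intro!: GDERIV_mult continuous_intros)

lemma C1_with_gradient_add:
  assumes "C1_with_gradient f Df" "C1_with_gradient g Dg"
  shows "C1_with_gradient (\<lambda>x. f x + g x) (\<lambda>x. Df x + Dg x)"
  using assms unfolding C1_with_gradient_def
  by (auto intro!: GDERIV_add continuous_intros)

lemma C1_with_gradient_outside_support:
  assumes "C1_with_gradient f Df" "x \<notin> closure {x. f x \<noteq> 0}"
  shows "f x = 0" "Df x = 0"
proof -
  show "f x = 0" using assms(2) closure_subset[of "{x. f x \<noteq> 0}"] by auto
  have "(f has_derivative (\<lambda>h. 0)) (at x)"
    by (rule has_derivative_transform_within_open[of "\<lambda>_. 0" _ _ _ "- closure {x. f x \<noteq> 0}"])
       (use assms(2) closure_subset[of "{x. f x \<noteq> 0}"] in auto)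
  then have "(\<lambda>h. h \<bullet> Df x) = (\<lambda>h. 0)"
    by (rule has_derivative_unique[OF C1_with_gradientD(1)[OF assms(1)]])
  then have "Df x \<bullet> Df x = 0" by metis
  then show "Df x = 0" by simp
qed

text \<open>By translation invariance every difference quotient of \<open>f\<close> has integral 0,
  and dominated convergence carries this over to the derivative in any direction \<open>e\<close>.
  Choosing \<open>e\<close> as the integral of the gradient itself shows that the integral is
  0.\<close>

lemma integral_gradient_eq_0:
  fixes f :: "'b::euclidean_space \<Rightarrow> real"
  assumes f: "C1_with_gradient f Df" and S: "compact (closure {x. f x \<noteq> 0})"
  shows "integrable lborel Df" "(\<integral>x. Df x \<partial>lborel) = 0"
proof -
  let ?S = "closure {x. f x \<noteq> 0}"
  note out = C1_with_gradient_outside_support[OF f]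
  have ind: "(\<lambda>x. indicator ?S x *\<^sub>R Df x) = Df" "(\<lambda>x. indicator ?S x *\<^sub>R f x) = f"
  proof -
    have "indicator ?S x *\<^sub>R Df x = Df x" "indicator ?S x *\<^sub>R f x = f x" for x
      using out[of x] by (cases "x \<in> ?S"; simp)+
    then show "(\<lambda>x. indicator ?S x *\<^sub>R Df x) = Df" "(\<lambda>x. indicator ?S x *\<^sub>R f x) = f" by blast+
  qed
  show int: "integrable lborel Df"
    using borel_integrable_compact[OF S continuous_on_subset[OF C1_with_gradientD(3)[OF f]]] ind(1) by simp
  have intf: "integrable lborel f"
    using borel_integrable_compact[OF S continuous_on_subset[OF C1_with_gradientD(2)[OF f]]] ind(2) by simp
  obtain M where M: "0 \<le> M" "\<And>x. norm (Df x) \<le> M"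
  proof -
    obtain M where "0 \<le> M" "\<And>x. x \<in> ?S \<Longrightarrow> norm (Df x) \<le> M"
      using continuous_bounded_on_bounded[OF C1_with_gradientD(3)[OF f] compact_imp_bounded[OF S]] by metis
    then show ?thesis using out(2) by (metis norm_zero that)
  qed
  have "(\<integral>x. Df x \<partial>lborel) \<bullet> e = 0" for e
  proof -
    define t where "t i = inverse (real (Suc i))" for i
    have t: "0 < t i" "t i \<le> 1" for i by (auto simp: t_def inverse_le_1_iff)
    have t0: "t \<longlonglongrightarrow> 0" unfolding t_def by (rule LIMSEQ_inverse_real_of_nat)
    define s where "s i x = (f (x + t i *\<^sub>R e) - f x) / t i" for i x
    \<comment> \<open>The support enlarged by the length of \<open>e\<close>. As
      \<open>t i \<le> 1\<close>, all difference quotients vanish outside this compact set, which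
      provides the integrable majorant.\<close>
    define K where "K = {x + y | x y. x \<in> ?S \<and> y \<in> cball 0 (norm e)}"
    have K: "compact K" unfolding K_def by (intro compact_sums S compact_cball)
    have lip: "\<bar>f (x + t i *\<^sub>R e) - f x\<bar> \<le> M * (t i * norm e)" for x i
    proof -
      have "norm (f (x + t i *\<^sub>R e) - f x) \<le> M * norm (x + t i *\<^sub>R e - x)"
      proof (rule differentiable_bound[of UNIV f "\<lambda>x h. h \<bullet> Df x"])
        show "onorm (\<lambda>h. h \<bullet> Df x) \<le> M" for x
          using Cauchy_Schwarz_ineq2[of _ "Df x"] M
          by (intro onorm_le) (metis mult.commute mult_left_mono norm_ge_zero order_trans real_norm_def)
      qed (use C1_with_gradientD(1)[OF f] in auto)
      then show ?thesis using t[of i] by (simp add: less_imp_le)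
    qed
    have s_bound: "norm (s i x) \<le> indicator K x *\<^sub>R (M * norm e)" for i x
    proof (cases "x \<in> K")
      case True
      then show ?thesis using lip[of x i] t[of i] by (simp add: s_def abs_mult field_simps)
    next
      case False
      have x: "x \<notin> ?S"
      proof
        assume "x \<in> ?S" then have "x + 0 \<in> K" unfolding K_def by (intro CollectI exI conjI) auto
        with False show False by simp
      qed
      have x': "x + t i *\<^sub>R e \<notin> ?S"
      proof
        assume "x + t i *\<^sub>R e \<in> ?S"
        moreover have "- (t i *\<^sub>R e) \<in> cball 0 (norm e)"
          using t[of i] by (simp add: mult_left_le_one_le less_imp_le)
        ultimately have "(x + t i *\<^sub>R e) + - (t i *\<^sub>R e) \<in> K" unfolding K_def by blast
        with False show False by simp
      qed
      show ?thesis using False out(1)[OF x] out(1)[OF x'] by (simp add: s_def)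
    qed
    have s_lim: "(\<lambda>i. s i x) \<longlonglongrightarrow> Df x \<bullet> e" for x
    proof -
      have "((\<lambda>u. f (x + u *\<^sub>R e)) has_derivative (\<lambda>u. (u *\<^sub>R e) \<bullet> Df (x + 0 *\<^sub>R e))) (at 0)"
        by (rule has_derivative_compose[of "\<lambda>u. x + u *\<^sub>R e" "\<lambda>u. u *\<^sub>R e" 0 UNIV f, simplified])
           (auto intro!: derivative_eq_intros C1_with_gradientD(1)[OF f, of x, simplified])
      then have "((\<lambda>u. f (x + u *\<^sub>R e)) has_field_derivative (e \<bullet> Df x)) (at 0)"
        by (rule has_derivative_imp_has_field_derivative) (simp add: mult.commute)
      then have "((\<lambda>u. (f (x + u *\<^sub>R e) - f x) / u) \<longlongrightarrow> e \<bullet> Df x) (at 0)"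
        by (simp add: has_field_derivative_iff)
      moreover have "filterlim t (at 0) sequentially"
        using t0 t(1) by (auto simp: filterlim_at less_imp_neq[symmetric] intro!: always_eventually)
      ultimately show ?thesis
        unfolding s_def inner_commute[of "Df x"] by (rule filterlim_compose)
    qed
    have meas: "f \<in> borel_measurable borel" by (rule borel_measurable_continuous_onI[OF C1_with_gradientD(2)[OF f]])
    have "(\<lambda>i. \<integral>x. s i x \<partial>lborel) \<longlonglongrightarrow> (\<integral>x. Df x \<bullet> e \<partial>lborel)"
    proof (rule integral_dominated_convergence)
      show "integrable lborel (\<lambda>x. indicat_real K x *\<^sub>R (M * norm e))"
        by (rule borel_integrable_compact[OF K]) auto
      show "s i \<in> borel_measurable lborel" for i unfolding s_def using meas by measurable
      show "(\<lambda>x. Df x \<bullet> e) \<in> borel_measurable lborel" using int by auto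
    qed (use s_lim s_bound in auto)
    moreover have "(\<integral>x. s i x \<partial>lborel) = 0" for i
    proof -
      have *: "integrable lborel (\<lambda>x. f (x + t i *\<^sub>R e))" "(\<integral>x. f (x + t i *\<^sub>R e) \<partial>lborel) = (\<integral>x. f x \<partial>lborel)"
      proof -
        have d: "distr lborel borel (\<lambda>x. x + t i *\<^sub>R e) = lborel"
        proof -
          have "(\<lambda>x. x + t i *\<^sub>R e) = (+) (t i *\<^sub>R e)" by (rule ext) (rule add.commute)
          then show ?thesis using lborel_distr_plus[of "t i *\<^sub>R e"] by (simp only:)
        qed
        show "integrable lborel (\<lambda>x. f (x + t i *\<^sub>R e))"
          using intf meas by (subst (asm) d[symmetric], subst (asm) integrable_distr_eq) auto
        show "(\<integral>x. f (x + t i *\<^sub>R e) \<partial>lborel) = (\<integral>x. f x \<partial>lborel)"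
          using meas by (subst (2) d[symmetric], subst integral_distr) auto
      qed
      show ?thesis
        unfolding s_def using * intf by (simp add: Bochner_Integration.integral_diff)
    qed
    ultimately have "(\<integral>x. Df x \<bullet> e \<partial>lborel) = 0" by (simp add: LIMSEQ_const_iff)
    then show ?thesis using int by simp
  qed
  then have "(\<integral>x. Df x \<partial>lborel) \<bullet> (\<integral>x. Df x \<partial>lborel) = 0" .
  then show "(\<integral>x. Df x \<partial>lborel) = 0" by simp
qed

text \<open>The product of \<open>v\<close> with the test function has compact support, so the
  integral of its gradient vanishes; outside \<open>U\<close> the test function and its gradient are
  zero, so integrating over \<open>U\<close> or over the whole space is the same.\<close>

lemma has_weak_gradient_C1:
  fixes v :: "'b::euclidean_space \<Rightarrow> real"
  assumes U: "U \<in> sets lebesgue" "bounded U" and v: "C1_with_gradient v Dv"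
  shows "has_weak_gradient U v Dv"
  unfolding has_weak_gradient_def
proof (intro conjI allI impI)
  show "v \<in> L2 U" "Dv \<in> L2 U" using C1_with_gradientD[OF v] U by (auto intro: L2_continuous)
  fix \<eta> :: "'b \<Rightarrow> real" and D\<eta>
  assume \<eta>: "C1_with_gradient \<eta> D\<eta> \<and> compact (closure {x. \<eta> x \<noteq> 0}) \<and> closure {x. \<eta> x \<noteq> 0} \<subseteq> U"
  let ?D = "\<lambda>x. v x *\<^sub>R D\<eta> x + \<eta> x *\<^sub>R Dv x"
  have C1: "C1_with_gradient (\<lambda>x. v x * \<eta> x) ?D"
    using C1_with_gradient_mult[OF v, of \<eta> D\<eta>] \<eta> by simp
  have "closure {x. v x * \<eta> x \<noteq> 0} \<subseteq> closure {x. \<eta> x \<noteq> 0}" by (rule closure_mono) auto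
  then have "compact (closure {x. v x * \<eta> x \<noteq> 0})"
    using \<eta> by (meson bounded_subset closed_closure compact_eq_bounded_closed)
  from integral_gradient_eq_0[OF C1 this] have z: "integrable lborel ?D" "(\<integral>x. ?D x \<partial>lborel) = 0" .
  have L: "\<eta> \<in> L2 U" "D\<eta> \<in> L2 U"
    by (intro L2_continuous U C1_with_gradientD[OF conjunct1[OF \<eta>]])+
  have "(LINT x:U|lebesgue. ?D x) = (\<integral>x. ?D x \<partial>lebesgue)"
    unfolding set_lebesgue_integral_def
  proof (rule Bochner_Integration.integral_cong)
    fix x
    show "indicat_real U x *\<^sub>R ?D x = ?D x"
    proof (cases "x \<in> U")
      case False
      then have "x \<notin> closure {x. \<eta> x \<noteq> 0}" using \<eta> by blast
      from C1_with_gradient_outside_support[OF conjunct1[OF \<eta>] this] show ?thesis by simp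
    qed simp
  qed simp
  also have "\<dots> = 0" using z by (simp add: integral_completion)
  finally show "(LINT x:U|lebesgue. v x *\<^sub>R D\<eta> x) = - (LINT x:U|lebesgue. \<eta> x *\<^sub>R Dv x)"
    using set_integral_add(2)[OF L2_scaleR_integrable[OF \<open>v \<in> L2 U\<close> L(2)] L2_scaleR_integrable[OF L(1) \<open>Dv \<in> L2 U\<close>]]
    by (simp add: eq_neg_iff_add_eq_0)
qed

text \<open>The product rule, obtained by testing the weak gradient of \<open>u\<close> with \<psi>
  times \<eta>, whose support lies in that of \<eta>.\<close>

lemma has_weak_gradient_mult_C1:
  fixes u :: "'b::euclidean_space \<Rightarrow> real"
  assumes U: "U \<in> sets lebesgue" "bounded U" and u: "has_weak_gradient U u G" and \<psi>: "C1_with_gradient \<psi> D\<psi>"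
  shows "has_weak_gradient U (\<lambda>x. \<psi> x * u x) (\<lambda>x. \<psi> x *\<^sub>R G x + u x *\<^sub>R D\<psi> x)"
  unfolding has_weak_gradient_def
proof (intro conjI allI impI)
  have uL: "u \<in> L2 U" "G \<in> L2 U" using u by (auto simp: has_weak_gradient_def)
  note \<psi>c = C1_with_gradientD(2,3)[OF \<psi>]
  show "(\<lambda>x. \<psi> x * u x) \<in> L2 U" using L2_bounded_scaleR[OF \<psi>c(1) U uL(1)] by simp
  show "(\<lambda>x. \<psi> x *\<^sub>R G x + u x *\<^sub>R D\<psi> x) \<in> L2 U"
    by (intro L2_add(1) L2_bounded_scaleR L2_scaleR_bounded \<psi>c U uL)
  fix \<eta> :: "'b \<Rightarrow> real" and D\<eta>
  assume \<eta>: "C1_with_gradient \<eta> D\<eta> \<and> compact (closure {x. \<eta> x \<noteq> 0}) \<and> closure {x. \<eta> x \<noteq> 0} \<subseteq> U"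
  let ?D = "\<lambda>x. \<psi> x *\<^sub>R D\<eta> x + \<eta> x *\<^sub>R D\<psi> x"
  have C1: "C1_with_gradient (\<lambda>x. \<psi> x * \<eta> x) ?D"
    using C1_with_gradient_mult[OF \<psi>, of \<eta> D\<eta>] \<eta> by simp
  have sub: "closure {x. \<psi> x * \<eta> x \<noteq> 0} \<subseteq> closure {x. \<eta> x \<noteq> 0}" by (rule closure_mono) auto
  then have "compact (closure {x. \<psi> x * \<eta> x \<noteq> 0})"
    using \<eta> by (meson bounded_subset closed_closure compact_eq_bounded_closed)
  moreover have "closure {x. \<psi> x * \<eta> x \<noteq> 0} \<subseteq> U" using sub \<eta> by (meson subset_trans)
  ultimately have eq: "(LINT x:U|lebesgue. u x *\<^sub>R ?D x) = - (LINT x:U|lebesgue. (\<psi> x * \<eta> x) *\<^sub>R G x)"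
    using u C1 unfolding has_weak_gradient_def by blast
  have \<eta>c: "continuous_on UNIV \<eta>" "continuous_on UNIV D\<eta>" using \<eta> C1_with_gradientD by blast+
  have i1: "set_integrable lebesgue U (\<lambda>x. u x *\<^sub>R (\<psi> x *\<^sub>R D\<eta> x))"
    by (intro L2_scaleR_integrable uL L2_continuous U continuous_intros \<psi>c \<eta>c)
  have i2: "set_integrable lebesgue U (\<lambda>x. u x *\<^sub>R (\<eta> x *\<^sub>R D\<psi> x))"
    by (intro L2_scaleR_integrable uL L2_continuous U continuous_intros \<psi>c \<eta>c)
  have i3: "set_integrable lebesgue U (\<lambda>x. (\<psi> x * \<eta> x) *\<^sub>R G x)"
    by (intro L2_scaleR_integrable uL L2_continuous U continuous_intros \<psi>c \<eta>c)
  have e1: "(LINT x:U|lebesgue. u x *\<^sub>R (\<psi> x *\<^sub>R D\<eta> x)) + (LINT x:U|lebesgue. u x *\<^sub>R (\<eta> x *\<^sub>R D\<psi> x))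
      = - (LINT x:U|lebesgue. (\<psi> x * \<eta> x) *\<^sub>R G x)"
    using eq set_integral_add(2)[OF i1 i2] by (simp add: scaleR_add_right)
  have e2: "(LINT x:U|lebesgue. \<eta> x *\<^sub>R (\<psi> x *\<^sub>R G x + u x *\<^sub>R D\<psi> x)) =
     (LINT x:U|lebesgue. (\<psi> x * \<eta> x) *\<^sub>R G x) + (LINT x:U|lebesgue. u x *\<^sub>R (\<eta> x *\<^sub>R D\<psi> x))"
    using set_integral_add(2)[OF i3 i2] by (simp add: scaleR_add_right mult.commute)
  have e3: "(LINT x:U|lebesgue. (\<psi> x * u x) *\<^sub>R D\<eta> x) = (LINT x:U|lebesgue. u x *\<^sub>R (\<psi> x *\<^sub>R D\<eta> x))"
    by (simp add: mult.commute)
  show "(LINT x:U|lebesgue. (\<psi> x * u x) *\<^sub>R D\<eta> x) = - (LINT x:U|lebesgue. \<eta> x *\<^sub>R (\<psi> x *\<^sub>R G x + u x *\<^sub>R D\<psi> x))"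
    unfolding e2 e3 using e1 by (simp add: eq_diff_eq)
qed

lemma has_weak_gradient_add:
  fixes u v :: "'b::euclidean_space \<Rightarrow> real"
  assumes U: "U \<in> sets lebesgue" "bounded U" and u: "has_weak_gradient U u G" and v: "has_weak_gradient U v H"
  shows "has_weak_gradient U (\<lambda>x. u x + v x) (\<lambda>x. G x + H x)"
  unfolding has_weak_gradient_def
proof (intro conjI allI impI)
  have L: "u \<in> L2 U" "G \<in> L2 U" "v \<in> L2 U" "H \<in> L2 U" using u v by (auto simp: has_weak_gradient_def)
  show "(\<lambda>x. u x + v x) \<in> L2 U" "(\<lambda>x. G x + H x) \<in> L2 U" using L by (auto intro: L2_add)
  fix \<eta> :: "'b \<Rightarrow> real" and D\<eta>
  assume \<eta>: "C1_with_gradient \<eta> D\<eta> \<and> compact (closure {x. \<eta> x \<noteq> 0}) \<and> closure {x. \<eta> x \<noteq> 0} \<subseteq> U"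
  have \<eta>L: "\<eta> \<in> L2 U" "D\<eta> \<in> L2 U"
    by (intro L2_continuous U C1_with_gradientD[OF conjunct1[OF \<eta>]])+
  have "(LINT x:U|lebesgue. u x *\<^sub>R D\<eta> x) = - (LINT x:U|lebesgue. \<eta> x *\<^sub>R G x)"
    "(LINT x:U|lebesgue. v x *\<^sub>R D\<eta> x) = - (LINT x:U|lebesgue. \<eta> x *\<^sub>R H x)"
    using u v \<eta> unfolding has_weak_gradient_def by blast+
  then show "(LINT x:U|lebesgue. (u x + v x) *\<^sub>R D\<eta> x) = - (LINT x:U|lebesgue. \<eta> x *\<^sub>R (G x + H x))"
    using set_integral_add(2)[OF L2_scaleR_integrable[OF L(1) \<eta>L(2)] L2_scaleR_integrable[OF L(3) \<eta>L(2)]]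
      set_integral_add(2)[OF L2_scaleR_integrable[OF \<eta>L(1) L(2)] L2_scaleR_integrable[OF \<eta>L(1) L(4)]]
    by (simp add: scaleR_add_right scaleR_add_left)
qed

subsection \<open>Lipschitz images of measurable sets\<close>

text \<open>Countable subadditivity, phrased with the counting measure so that the bound can
  afterwards be summed up again by \<open>emeasure_UN_countable\<close> over sets with disjoint
  interiors.\<close>

lemma emeasure_UN_le_nn_integral_count:
  assumes "countable I" and "\<And>i. i \<in> I \<Longrightarrow> X i \<in> sets M"
  shows "emeasure M (\<Union>i\<in>I. X i) \<le> (\<integral>\<^sup>+i. emeasure M (X i) \<partial>count_space I)"
proof -
  have "emeasure M (\<Union>i\<in>I. X i) = (\<integral>\<^sup>+x. indicator (\<Union>i\<in>I. X i) x \<partial>M)"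
    using assms by (intro nn_integral_indicator[symmetric]) (auto intro: sets.countable_UN')
  also have "\<dots> \<le> (\<integral>\<^sup>+x. (\<integral>\<^sup>+i. indicator (X i) x \<partial>count_space I) \<partial>M)"
  proof (rule nn_integral_mono)
    fix x
    show "(indicator (\<Union>i\<in>I. X i) x :: ennreal) \<le> (\<integral>\<^sup>+i. indicator (X i) x \<partial>count_space I)"
    proof (cases "x \<in> (\<Union>i\<in>I. X i)")
      case True
      then obtain j where j: "j \<in> I" "x \<in> X j" by auto
      have "indicator (X j) x \<le> (\<integral>\<^sup>+i. indicator (X i) x \<partial>count_space I)"
        using nn_integral_ge_point[OF j(1), of "\<lambda>i. indicator (X i) x"] by simp
      with True j show ?thesis by (simp add: indicator_def)
    qed simp
  qed
  also have "\<dots> = (\<integral>\<^sup>+i. (\<integral>\<^sup>+x. indicator (X i) x \<partial>M) \<partial>count_space I)"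
    using assms by (intro nn_integral_count_space_nn_integral) auto
  also have "\<dots> = (\<integral>\<^sup>+i. emeasure M (X i) \<partial>count_space I)"
    using assms by (intro nn_integral_cong) auto
  finally show ?thesis .
qed

text \<open>Cover \<open>E\<close> by nonoverlapping cubes contained in \<open>U\<close> and in an
  open set hardly larger than \<open>E\<close>. A cube of side \<open>h\<close> has diameter at most
  \<open>DIM('b) * h\<close>, so its image fits into a cube of side
  \<open>2 * B * DIM('b) * h\<close>; this is the origin of the constant. The Lipschitz bound is
  asked only along segments inside \<open>U\<close> because a nozzle is not convex; each covering
  cube is.\<close>

lemma emeasure_lipschitz_image_le:
  fixes f :: "'b::euclidean_space \<Rightarrow> 'b"
  assumes U: "open U" "E \<subseteq> U" and E: "bounded E" "E \<in> sets lebesgue" "f ` E \<in> sets lebesgue"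
    and B: "0 \<le> B"
    and lip: "\<And>x y. closed_segment x y \<subseteq> U \<Longrightarrow> norm (f x - f y) \<le> B * norm (x - y)"
  shows "emeasure lebesgue (f ` E) \<le> ennreal ((2 * B * DIM('b)) ^ DIM('b)) * emeasure lebesgue E"
    (is "_ \<le> ennreal ?C * _")
proof (rule ennreal_le_epsilon)
  fix e :: real assume e: "0 < e"
  have C0: "0 \<le> ?C" using B by simp
  obtain c where c: "E \<subseteq> cbox (-c *\<^sub>R One) (c *\<^sub>R One)" "box (-c *\<^sub>R One:: 'b) (c *\<^sub>R One) \<noteq> {}"
  proof -
    obtain R where R: "0 < R" "\<And>x. x \<in> E \<Longrightarrow> norm x \<le> R" using E(1) by (auto simp: bounded_pos)
    have "\<bar>x \<bullet> i\<bar> \<le> R" if "x \<in> E" "i \<in> Basis" for x i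
      using R(2)[OF that(1)] Basis_le_norm[OF that(2), of x] by linarith
    then show ?thesis
      using R(1) by (intro that[of R]) (auto simp: mem_box box_eq_empty abs_le_iff minus_le_iff)
  qed
  \<comment> \<open>The excess is divided by \<open>?C + 1\<close> rather than \<open>?C\<close>,
    which may be 0.\<close>
  obtain W where W: "open W" "E \<subseteq> W" "W - E \<in> lmeasurable" "emeasure lebesgue (W - E) < ennreal (e / (?C + 1))"
    using sets_lebesgue_outer_open[OF E(2), of "e / (?C + 1)"] e C0 by (auto simp: add_nonneg_pos)
  have "\<exists>r>0. x \<in> E \<longrightarrow> ball x r \<subseteq> W \<inter> U" for x
    using U W openE[of "W \<inter> U" x] by (metis IntI gt_ex open_Int subsetD)
  then obtain r where r: "\<And>x. 0 < r x" "\<And>x. x \<in> E \<Longrightarrow> ball x (r x) \<subseteq> W \<inter> U" by metis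
  have gauge: "gauge (\<lambda>x. ball x (r x))" using r(1) by (simp add: gauge_def)
  obtain \<D> where "countable \<D>"
     and cbox: "\<And>K. K \<in> \<D> \<Longrightarrow> interior K \<noteq> {} \<and> (\<exists>c d. K = cbox c d)"
     and pw:   "pairwise (\<lambda>A B. interior A \<inter> interior B = {}) \<D>"
     and Ksub: "\<And>K. K \<in> \<D> \<Longrightarrow> \<exists>x \<in> E \<inter> K. K \<subseteq> ball x (r x)"
     and exN:  "\<And>u v. cbox u v \<in> \<D> \<Longrightarrow> \<exists>n. \<forall>i \<in> Basis. v \<bullet> i - u \<bullet> i = (2*c) / 2^n"
     and cov: "E \<subseteq> \<Union>\<D>"
    using covering_lemma [OF c gauge] by force
  have cube: "\<exists>Q\<in>sets lebesgue. f ` K \<subseteq> Q \<and> emeasure lebesgue Q \<le> ennreal ?C * emeasure lebesgue (interior K)"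
    if K: "K \<in> \<D>" for K
  proof -
    obtain u v where uv: "K = cbox u v" "box u v \<noteq> {}"
    proof -
      obtain u v where "K = cbox u v" "interior K \<noteq> {}" using cbox[OF K] by blast
      then show ?thesis by (intro that[of u v]) (auto simp: interior_cbox)
    qed
    have "\<exists>n. \<forall>i\<in>Basis. v \<bullet> i - u \<bullet> i = (2*c) / 2^n" using K by (intro exN) (simp add: uv(1))
    then obtain h where h: "\<And>i. i \<in> Basis \<Longrightarrow> v \<bullet> i - u \<bullet> i = h" by meson
    have lt: "\<forall>i\<in>Basis. u \<bullet> i < v \<bullet> i" using uv(2) by (simp add: box_ne_empty)
    have h0: "0 < h" using h[OF SOME_Basis] bspec[OF lt SOME_Basis] by linarith
    obtain z where z: "z \<in> E" "z \<in> K" "K \<subseteq> ball z (r z)" using Ksub[OF K] by auto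
    let ?R = "B * DIM('b) * h"
    let ?Q = "cbox (f z - ?R *\<^sub>R One) (f z + ?R *\<^sub>R One)"
    have R0: "0 \<le> ?R" using B h0 by simp
    have "f y \<in> ?Q" if y: "y \<in> K" for y
    proof -
      have "closed_segment y z \<subseteq> K"
        using y z uv by (simp add: closed_segment_subset)
      also have "K \<subseteq> U" using z r(2)[OF z(1)] by auto
      finally have l: "norm (f y - f z) \<le> B * norm (y - z)" by (rule lip)
      have "norm (y - z) \<le> (\<Sum>i\<in>Basis. \<bar>(y - z) \<bullet> i\<bar>)" by (rule norm_le_l1)
      also have "\<dots> \<le> real DIM('b) * h"
      proof (rule sum_bounded_above)
        fix j :: 'b assume j: "j \<in> Basis"
        show "\<bar>(y - z) \<bullet> j\<bar> \<le> h"
          using y z(2) j h[OF j] unfolding uv by (auto simp: mem_box inner_diff_left abs_le_iff dest!: bspec[OF _ j])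
      qed
      finally have "B * norm (y - z) \<le> B * (real DIM('b) * h)" using B by (rule mult_left_mono)
      with l have "norm (f y - f z) \<le> ?R" by (simp add: mult.assoc)
      then have "\<bar>f y \<bullet> i - f z \<bullet> i\<bar> \<le> ?R" if "i \<in> Basis" for i
        using Basis_le_norm[OF that, of "f y - f z"] by (simp add: inner_diff_left)
      then show ?thesis
        by (fastforce simp: mem_box inner_add inner_diff abs_le_iff)
    qed
    then have sub: "f ` K \<subseteq> ?Q" by auto
    have "emeasure lebesgue ?Q = ennreal (\<Prod>i\<in>(Basis::'b set). 2 * ?R)"
    proof -
      have *: "(f z - ?R *\<^sub>R One) \<bullet> i \<le> (f z + ?R *\<^sub>R One) \<bullet> i"
           "((f z + ?R *\<^sub>R One) - (f z - ?R *\<^sub>R One)) \<bullet> i = 2 * ?R" if "i \<in> Basis" for i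
        using R0 that by (simp_all add: inner_add_left inner_diff_left inner_sum_left inner_Basis if_distrib cong: if_cong)
      have "emeasure lborel ?Q = ennreal (\<Prod>i\<in>Basis. ((f z + ?R *\<^sub>R One) - (f z - ?R *\<^sub>R One)) \<bullet> i)"
        using *(1) by (rule emeasure_lborel_cbox)
      also have "\<dots> = ennreal (\<Prod>i\<in>(Basis::'b set). 2 * ?R)"
        by (intro arg_cong[where f=ennreal] prod.cong *(2)) auto
      finally show ?thesis by simp
    qed
    also have "(\<Prod>i\<in>(Basis::'b set). 2 * ?R) = ?C * h ^ DIM('b)"
      by (simp add: power_mult_distrib mult_ac)
    also have "ennreal \<dots> = ennreal ?C * emeasure lebesgue (interior K)"
    proof -
      have "emeasure lebesgue (interior K) = ennreal (\<Prod>i\<in>(Basis::'b set). h)"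
        using uv(2) h by (auto simp: uv(1) interior_cbox emeasure_lborel_box_eq box_ne_empty inner_diff_left less_imp_le intro!: arg_cong[where f=ennreal] prod.cong)
      then show ?thesis using C0 h0 by (simp add: ennreal_mult)
    qed
    finally show ?thesis using sub by (intro bexI[of _ ?Q]) auto
  qed
  then obtain Q where Q: "\<And>K. K \<in> \<D> \<Longrightarrow> Q K \<in> sets lebesgue" "\<And>K. K \<in> \<D> \<Longrightarrow> f ` K \<subseteq> Q K"
    "\<And>K. K \<in> \<D> \<Longrightarrow> emeasure lebesgue (Q K) \<le> ennreal ?C * emeasure lebesgue (interior K)"
    by metis
  have disj: "disjoint_family_on interior \<D>"
    using pw by (auto simp: disjoint_family_on_def pairwise_def)
  have "f ` E \<subseteq> (\<Union>K\<in>\<D>. Q K)" using cov Q(2) by blast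
  then have "emeasure lebesgue (f ` E) \<le> emeasure lebesgue (\<Union>K\<in>\<D>. Q K)"
    using Q(1) \<open>countable \<D>\<close> by (intro emeasure_mono sets.countable_UN') auto
  also have "\<dots> \<le> (\<integral>\<^sup>+K. emeasure lebesgue (Q K) \<partial>count_space \<D>)"
    by (rule emeasure_UN_le_nn_integral_count) (use Q(1) \<open>countable \<D>\<close> in auto)
  also have "\<dots> \<le> (\<integral>\<^sup>+K. ennreal ?C * emeasure lebesgue (interior K) \<partial>count_space \<D>)"
    by (rule nn_integral_mono) (use Q(3) in auto)
  also have "\<dots> = ennreal ?C * emeasure lebesgue (\<Union>K\<in>\<D>. interior K)"
    using \<open>countable \<D>\<close> disj by (subst emeasure_UN_countable) (auto simp: nn_integral_cmult)
  also have "\<dots> \<le> ennreal ?C * emeasure lebesgue W"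
  proof (intro mult_left_mono emeasure_mono)
    show "(\<Union>K\<in>\<D>. interior K) \<subseteq> W"
      using Ksub r(2) interior_subset by (metis (no_types, lifting) IntE UN_least subset_trans Int_lower1)
  qed (use W in auto)
  also have "emeasure lebesgue W \<le> emeasure lebesgue E + ennreal (e / (?C + 1))"
  proof -
    have "emeasure lebesgue W = emeasure lebesgue (E \<union> (W - E))"
      using W(2) by (simp add: Un_absorb1)
    also have "\<dots> \<le> emeasure lebesgue E + emeasure lebesgue (W - E)"
      using E W by (intro emeasure_subadditive) auto
    finally show ?thesis using W(4) by (meson add_left_mono less_imp_le order_trans)
  qed
  also have "ennreal ?C * (emeasure lebesgue E + ennreal (e / (?C + 1)))
      = ennreal ?C * emeasure lebesgue E + ennreal (?C * (e / (?C + 1)))"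
    unfolding distrib_left using C0 e by (subst ennreal_mult) (auto simp: add_nonneg_pos)
  also have "ennreal (?C * (e / (?C + 1))) \<le> ennreal e"
    using C0 e by (intro ennreal_leI) (simp add: field_simps add_nonneg_pos)
  finally show "emeasure lebesgue (f ` E) \<le> ennreal ?C * emeasure lebesgue E + ennreal e"
    by (simp add: mult_left_mono add_left_mono)
qed

lemma nn_integral_lipschitz_image_le:
  fixes f g :: "'b::euclidean_space \<Rightarrow> 'b"
  assumes U: "open U" "E \<subseteq> U" and E: "bounded E" "E \<in> sets borel"
    and fE: "f ` E \<in> sets borel" and g: "continuous_on (f ` E) g" "\<And>x. x \<in> E \<Longrightarrow> g (f x) = x"
    and B: "0 \<le> B"
    and lip: "\<And>x y. closed_segment x y \<subseteq> U \<Longrightarrow> norm (f x - f y) \<le> B * norm (x - y)"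
    and F: "F \<in> borel_measurable borel"
  shows "(\<integral>\<^sup>+y. F (g y) * indicator (f ` E) y \<partial>lborel)
    \<le> ennreal ((2 * B * DIM('b)) ^ DIM('b)) * (\<integral>\<^sup>+x. F x * indicator E x \<partial>lborel)"
    (is "_ \<le> ?C * _")
proof -
  let ?R = "restrict_space lborel (f ` E)"
  have gm: "g \<in> measurable ?R borel"
    using borel_measurable_continuous_on_restrict[OF g(1)]
    by (simp add: measurable_def space_restrict_space sets_restrict_space)
  let ?M = "distr ?R borel g" and ?N = "scale_measure ?C (density lborel (indicator E))"
  have "?M \<le> ?N"
  proof (subst le_measure)
    show "sets ?M = sets ?N" by simp
    show "\<forall>A\<in>sets ?M. emeasure ?M A \<le> emeasure ?N A"
    proof
      fix A assume "A \<in> sets ?M"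
      then have A: "A \<in> sets borel" by simp
      have eq: "g -` A \<inter> f ` E = f ` (A \<inter> E)" using g(2) by auto
      have "emeasure ?M A = emeasure ?R (g -` A \<inter> f ` E)"
        using A gm fE by (simp add: emeasure_distr space_restrict_space)
      also have "\<dots> = emeasure lborel (f ` (A \<inter> E))"
        unfolding eq using fE by (intro emeasure_restrict_space) auto
      also have "\<dots> = emeasure lebesgue (f ` (A \<inter> E))"
      proof -
        have "f ` (A \<inter> E) \<in> sets ?R"
          using measurable_sets[OF gm A] fE eq by (simp add: space_restrict_space)
        then have "f ` (A \<inter> E) \<in> sets borel"
          using fE by (auto simp: sets_restrict_space)
        then show ?thesis by (simp add: emeasure_completion)
      qed
      also have "\<dots> \<le> ?C * emeasure lebesgue (A \<inter> E)"
      proof (rule emeasure_lipschitz_image_le[OF U(1) _ _ _ _ B lip])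
        have "f ` (A \<inter> E) \<in> sets ?R"
          using measurable_sets[OF gm A] fE eq by (simp add: space_restrict_space)
        then show "f ` (A \<inter> E) \<in> sets lebesgue"
          using fE by (auto simp: sets_restrict_space)
      qed (use U E A in \<open>auto intro: bounded_subset\<close>)
      also have "\<dots> = emeasure ?N A"
        using A E by (simp add: emeasure_density emeasure_completion indicator_inter_arith[symmetric] Int_commute)
      finally show "emeasure ?M A \<le> emeasure ?N A" .
    qed
  qed
  have "(\<integral>\<^sup>+y. F (g y) * indicator (f ` E) y \<partial>lborel) = (\<integral>\<^sup>+y. F (g y) \<partial>?R)"
    using fE by (subst nn_integral_restrict_space) auto
  also have "\<dots> = (\<integral>\<^sup>+x. F x \<partial>?M)"
    using gm F by (subst nn_integral_distr) auto
  also have "\<dots> \<le> (\<integral>\<^sup>+x. F x \<partial>?N)"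
    by (rule nn_integral_mono_measure) (use \<open>?M \<le> ?N\<close> in auto)
  also have "\<dots> = ?C * (\<integral>\<^sup>+x. F x * indicator E x \<partial>lborel)"
    using F E by (simp add: nn_integral_scale_measure nn_integral_density mult.commute)
  finally show ?thesis .
qed

subsection \<open>Increments along segments\<close>

lemma power2_set_integral_le:
  fixes f :: "'b::euclidean_space \<Rightarrow> real"
  assumes f: "set_integrable lborel D f" and D: "D \<in> sets borel"
  shows "ennreal ((LINT x:D|lborel. f x)\<^sup>2) \<le> emeasure lborel D * (\<integral>\<^sup>+x\<in>D. ennreal ((f x)\<^sup>2) \<partial>lborel)"
proof -
  let ?g = "\<lambda>x. ennreal (norm (indicator D x *\<^sub>R f x))"
  have int: "integrable lborel (\<lambda>x. indicator D x *\<^sub>R f x)" using f by (simp add: set_integrable_def)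
  have "ennreal ((LINT x:D|lborel. f x)\<^sup>2) = ennreal (norm (LINT x:D|lborel. f x)) ^ 2"
    by (simp add: ennreal_power)
  also have "\<dots> \<le> (\<integral>\<^sup>+x. ?g x \<partial>lborel) ^ 2"
    unfolding set_lebesgue_integral_def
    by (intro power_mono integral_norm_bound_ennreal int) simp
  also have "(\<integral>\<^sup>+x. ?g x \<partial>lborel) = (\<integral>\<^sup>+x. ?g x * indicator D x \<partial>lborel)"
    by (intro nn_integral_cong) (auto simp: indicator_def)
  also have "\<dots> ^ 2 \<le> (\<integral>\<^sup>+x. (?g x) ^ 2 \<partial>lborel) * (\<integral>\<^sup>+x. (indicator D x) ^ 2 \<partial>lborel)"
    using int D by (intro Cauchy_Schwarz_nn_integral) auto
  also have "(\<integral>\<^sup>+x. (?g x) ^ 2 \<partial>lborel) = (\<integral>\<^sup>+x\<in>D. ennreal ((f x)\<^sup>2) \<partial>lborel)"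
    by (intro nn_integral_cong) (auto simp: indicator_def ennreal_power)
  also have "(\<integral>\<^sup>+x. (indicator D x) ^ 2 \<partial>lborel) = (\<integral>\<^sup>+x. indicator D x \<partial>lborel)"
    by (intro nn_integral_cong) (auto simp: indicator_def)
  also have "\<dots> = emeasure lborel D" using D by simp
  finally show ?thesis by (simp add: mult.commute)
qed

text \<open>The fundamental theorem of calculus followed by the Cauchy-Schwarz inequality. Passing
  to the continuous majorant \<open>h\<close> spares \<open>w'\<close> any measurability
  argument.\<close>

lemma power2_increment_le:
  fixes w w' h :: "real \<Rightarrow> real"
  assumes ab: "a \<le> b" and deriv: "\<And>s. s \<in> {a..b} \<Longrightarrow> (w has_real_derivative w' s) (at s within {a..b})"
    and le: "\<And>s. s \<in> {a..b} \<Longrightarrow> \<bar>w' s\<bar> \<le> h s" and h: "continuous_on {a..b} h"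
  shows "ennreal ((w b - w a)\<^sup>2) \<le> ennreal (b - a) * (\<integral>\<^sup>+s\<in>{a<..<b}. ennreal ((h s)\<^sup>2) \<partial>lborel)"
proof -
  have I: "(w' has_integral (w b - w a)) {a..b}"
    by (rule fundamental_theorem_of_calculus[OF ab])
       (use deriv in \<open>simp add: has_real_derivative_iff_has_vector_derivative\<close>)
  have hi: "set_integrable lborel {a..b} h"
    using borel_integrable_compact[OF _ h] by (simp add: set_integrable_def)
  have "\<bar>w b - w a\<bar> = norm (integral {a..b} w')" using I by (simp add: integral_unique)
  also have "\<dots> \<le> integral {a..b} h"
    by (rule integral_norm_bound_integral)
       (use I le set_borel_integral_eq_integral(1)[OF hi] in \<open>auto simp: has_integral_integrable\<close>)
  also have "\<dots> = (LINT s:{a..b}|lborel. h s)"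
    using set_borel_integral_eq_integral(2)[OF hi] by simp
  finally have "(w b - w a)\<^sup>2 \<le> (LINT s:{a..b}|lborel. h s)\<^sup>2"
    by (meson abs_ge_self abs_le_square_iff order_trans)
  then have "ennreal ((w b - w a)\<^sup>2) \<le> ennreal ((LINT s:{a..b}|lborel. h s)\<^sup>2)" by (rule ennreal_leI)
  also have "\<dots> \<le> emeasure lborel {a..b} * (\<integral>\<^sup>+s\<in>{a..b}. ennreal ((h s)\<^sup>2) \<partial>lborel)"
    by (rule power2_set_integral_le[OF hi]) simp
  also have "(\<integral>\<^sup>+s\<in>{a..b}. ennreal ((h s)\<^sup>2) \<partial>lborel) = (\<integral>\<^sup>+s\<in>{a<..<b}. ennreal ((h s)\<^sup>2) \<partial>lborel)"
  proof (rule nn_integral_cong_AE)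
    have "AE s in lborel. s \<noteq> a \<and> s \<noteq> b" using AE_lborel_singleton[of a] AE_lborel_singleton[of b] by eventually_elim auto
    then show "AE s in lborel. ennreal ((h s)\<^sup>2) * indicator {a..b} s = ennreal ((h s)\<^sup>2) * indicator {a<..<b} s"
      by eventually_elim (auto simp: indicator_def)
  qed
  finally show ?thesis using ab by simp
qed

text \<open>The substitution produces the factor \<open>s\<close> to the power
  \<open>- DIM('b)\<close>, which is at most \<open>2 ^ DIM('b)\<close> as long as \<open>s\<close>
  stays above one half.\<close>

lemma nn_integral_affine_le:
  fixes F :: "'b::euclidean_space \<Rightarrow> ennreal"
  assumes F: "F \<in> borel_measurable borel" and s: "1/2 \<le> s"
  shows "(\<integral>\<^sup>+q. F (t + s *\<^sub>R q) \<partial>lborel) \<le> 2 ^ DIM('b) * (\<integral>\<^sup>+q. F q \<partial>lborel)"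
proof -
  have "(\<integral>\<^sup>+q. F q \<partial>lborel) = (\<integral>\<^sup>+q. F q \<partial>density (distr lborel borel (\<lambda>x. t + s *\<^sub>R x)) (\<lambda>_. \<bar>s\<bar>^DIM('b)))"
    using s by (subst lborel_affine[of s t]) auto
  also have "\<dots> = ennreal (\<bar>s\<bar>^DIM('b)) * (\<integral>\<^sup>+q. F (t + s *\<^sub>R q) \<partial>lborel)"
    using F by (simp add: nn_integral_density nn_integral_distr nn_integral_cmult)
  finally have eq: "(\<integral>\<^sup>+q. F q \<partial>lborel) = ennreal (\<bar>s\<bar>^DIM('b)) * (\<integral>\<^sup>+q. F (t + s *\<^sub>R q) \<partial>lborel)" .
  have "1 \<le> (2 * s) ^ DIM('b)" using s by (intro one_le_power) auto
  then have "1 \<le> ennreal (2 ^ DIM('b) * \<bar>s\<bar> ^ DIM('b))"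
    using s by (simp add: power_mult_distrib)
  then have "1 * (\<integral>\<^sup>+q. F (t + s *\<^sub>R q) \<partial>lborel) \<le> ennreal (2 ^ DIM('b) * \<bar>s\<bar> ^ DIM('b)) * (\<integral>\<^sup>+q. F (t + s *\<^sub>R q) \<partial>lborel)"
    by (rule mult_right_mono) simp
  also have "\<dots> = 2 ^ DIM('b) * (\<integral>\<^sup>+q. F q \<partial>lborel)"
    unfolding eq by (simp add: ennreal_mult mult.assoc ennreal_power[symmetric])
  finally show ?thesis by simp
qed

text \<open>Going from \<open>p\<close> to \<open>q\<close> through the midpoint keeps the dilation factor in the change of
  variables \<open>q \<mapsto> (1 - s) p + s q\<close> away from zero.\<close>

lemma double_integral_increment_le:
  fixes W :: "'b::euclidean_space \<Rightarrow> real" and H :: "'b \<Rightarrow> ennreal"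
  assumes D: "D \<in> sets borel" "convex D" and W[measurable]: "W \<in> borel_measurable borel"
    and H[measurable]: "H \<in> borel_measurable borel"
    and seg: "\<And>p q. p \<in> D \<Longrightarrow> q \<in> D \<Longrightarrow>
      ennreal ((W q - W ((1/2) *\<^sub>R p + (1/2) *\<^sub>R q))\<^sup>2) \<le> c * (\<integral>\<^sup>+s\<in>{1/2<..<1}. H ((1 - s) *\<^sub>R p + s *\<^sub>R q) \<partial>lborel)"
  shows "(\<integral>\<^sup>+p\<in>D. (\<integral>\<^sup>+q\<in>D. ennreal ((W p - W q)\<^sup>2) \<partial>lborel) \<partial>lborel)
    \<le> 4 * (c * (2 ^ DIM('b) * emeasure lborel D * (\<integral>\<^sup>+y\<in>D. H y \<partial>lborel)))"
proof -
  note [measurable] = D(1)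
  \<comment> \<open>With \<open>H\<close> cut off outside \<open>D\<close>, the affine substitution
    can be carried out over the whole space; convexity keeps the segments inside \<open>D\<close>,
    where nothing changes.\<close>
  define HD where "HD y = H y * indicator D y" for y
  have HD[measurable]: "HD \<in> borel_measurable borel" unfolding HD_def by measurable
  define X where "X p q = ennreal ((W q - W ((1/2) *\<^sub>R p + (1/2) *\<^sub>R q))\<^sup>2)" for p q
  have X[measurable]: "case_prod X \<in> borel_measurable (borel \<Otimes>\<^sub>M borel)"
    unfolding X_def by measurable
  let ?I = "\<integral>\<^sup>+y\<in>D. H y \<partial>lborel"
  have half: "(\<integral>\<^sup>+p\<in>D. (\<integral>\<^sup>+q\<in>D. X p q \<partial>lborel) \<partial>lborel) \<le> c * (2 ^ DIM('b) * emeasure lborel D * ?I)"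
  proof -
    have inner: "(\<integral>\<^sup>+q\<in>D. X p q \<partial>lborel) \<le> c * (2 ^ DIM('b) * ?I)" if p: "p \<in> D" for p
    proof -
      have "(\<integral>\<^sup>+q\<in>D. X p q \<partial>lborel) \<le> (\<integral>\<^sup>+q. c * (\<integral>\<^sup>+s\<in>{1/2<..<1}. HD ((1 - s) *\<^sub>R p + s *\<^sub>R q) \<partial>lborel) \<partial>lborel)"
      proof (rule nn_integral_mono)
        fix q
        show "X p q * indicator D q \<le> c * (\<integral>\<^sup>+s\<in>{1/2<..<1}. HD ((1 - s) *\<^sub>R p + s *\<^sub>R q) \<partial>lborel)"
        proof (cases "q \<in> D")
          case True
          have "(1 - s) *\<^sub>R p + s *\<^sub>R q \<in> D" if "s \<in> {1/2<..<1}" for s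
            using convexD_alt[OF D(2) p True, of s] that by auto
          then have "(\<integral>\<^sup>+s\<in>{1/2<..<1}. H ((1 - s) *\<^sub>R p + s *\<^sub>R q) \<partial>lborel) = (\<integral>\<^sup>+s\<in>{1/2<..<1}. HD ((1 - s) *\<^sub>R p + s *\<^sub>R q) \<partial>lborel)"
            by (intro nn_integral_cong) (auto simp: HD_def indicator_def)
          then show ?thesis using seg[OF p True] True by (simp add: X_def)
        qed simp
      qed
      also have "\<dots> = c * (\<integral>\<^sup>+q. (\<integral>\<^sup>+s\<in>{1/2<..<1}. HD ((1 - s) *\<^sub>R p + s *\<^sub>R q) \<partial>lborel) \<partial>lborel)"
        by (rule nn_integral_cmult) measurable
      also have "(\<integral>\<^sup>+q. (\<integral>\<^sup>+s\<in>{1/2<..<1}. HD ((1 - s) *\<^sub>R p + s *\<^sub>R q) \<partial>lborel) \<partial>lborel)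
          = (\<integral>\<^sup>+s. (\<integral>\<^sup>+q. HD ((1 - s) *\<^sub>R p + s *\<^sub>R q) * indicator {1/2<..<1} s \<partial>lborel) \<partial>lborel)"
        by (rule lborel_pair.Fubini') measurable
      also have "\<dots> \<le> (\<integral>\<^sup>+s. (2 ^ DIM('b) * ?I) * indicator {1/2<..<1::real} s \<partial>lborel)"
      proof (rule nn_integral_mono)
        fix s :: real
        have "(\<integral>\<^sup>+q. HD ((1 - s) *\<^sub>R p + s *\<^sub>R q) \<partial>lborel) \<le> 2 ^ DIM('b) * (\<integral>\<^sup>+q. HD q \<partial>lborel)" if "1/2 < s"
          by (rule nn_integral_affine_le) (use that in auto)
        then show "(\<integral>\<^sup>+q. HD ((1 - s) *\<^sub>R p + s *\<^sub>R q) * indicator {1/2<..<1} s \<partial>lborel) \<le> (2 ^ DIM('b) * ?I) * indicator {1/2<..<1} s"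
          by (cases "s \<in> {1/2<..<1}") (auto simp: HD_def)
      qed
      also have "\<dots> = (2 ^ DIM('b) * ?I) * ennreal (1/2)"
        by (subst nn_integral_cmult_indicator) auto
      also have "\<dots> \<le> (2 ^ DIM('b) * ?I) * ennreal 1"
        by (intro mult_left_mono ennreal_leI) auto
      finally show ?thesis by (simp add: mult_left_mono)
    qed
    have "(\<integral>\<^sup>+p\<in>D. (\<integral>\<^sup>+q\<in>D. X p q \<partial>lborel) \<partial>lborel) \<le> (\<integral>\<^sup>+p. (c * (2 ^ DIM('b) * ?I)) * indicator D p \<partial>lborel)"
      by (intro nn_integral_mono) (use inner in \<open>auto simp: indicator_def\<close>)
    also have "\<dots> = (c * (2 ^ DIM('b) * ?I)) * emeasure lborel D"
      by (rule nn_integral_cmult_indicator) simp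
    finally show ?thesis by (simp add: mult_ac)
  qed
  \<comment> \<open>\<open>X p q\<close> measures the half of the segment next to \<open>q\<close>
    and \<open>X q p\<close> the half next to \<open>p\<close>. The midpoint is symmetric in both,
    so by Fubini the two halves contribute equally.\<close>
  have swap: "(\<integral>\<^sup>+p\<in>D. (\<integral>\<^sup>+q\<in>D. X q p \<partial>lborel) \<partial>lborel) = (\<integral>\<^sup>+p\<in>D. (\<integral>\<^sup>+q\<in>D. X p q \<partial>lborel) \<partial>lborel)"
  proof -
    have "(\<integral>\<^sup>+p\<in>D. (\<integral>\<^sup>+q\<in>D. X q p \<partial>lborel) \<partial>lborel) = (\<integral>\<^sup>+p. (\<integral>\<^sup>+q. X q p * indicator D q * indicator D p \<partial>lborel) \<partial>lborel)"
      by (intro nn_integral_cong nn_integral_multc[symmetric]) measurable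
    also have "\<dots> = (\<integral>\<^sup>+q. (\<integral>\<^sup>+p. X q p * indicator D q * indicator D p \<partial>lborel) \<partial>lborel)"
      by (rule lborel_pair.Fubini') measurable
    also have "\<dots> = (\<integral>\<^sup>+q. (\<integral>\<^sup>+p. X q p * indicator D p * indicator D q \<partial>lborel) \<partial>lborel)"
      by (simp add: mult_ac)
    also have "\<dots> = (\<integral>\<^sup>+q\<in>D. (\<integral>\<^sup>+p\<in>D. X q p \<partial>lborel) \<partial>lborel)"
      by (intro nn_integral_cong nn_integral_multc) measurable
    finally show ?thesis .
  qed
  have "(\<integral>\<^sup>+p\<in>D. (\<integral>\<^sup>+q\<in>D. ennreal ((W p - W q)\<^sup>2) \<partial>lborel) \<partial>lborel)
      \<le> (\<integral>\<^sup>+p\<in>D. (\<integral>\<^sup>+q\<in>D. 2 * X p q + 2 * X q p \<partial>lborel) \<partial>lborel)"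
  proof (intro nn_integral_mono mult_right_mono)
    fix p q
    let ?m = "W ((1/2) *\<^sub>R p + (1/2) *\<^sub>R q)"
    have "(W p - W q)\<^sup>2 \<le> 2 * (W q - ?m)\<^sup>2 + 2 * (W p - ?m)\<^sup>2"
      using sum_squares_ge_zero[of "(W q - ?m) + (W p - ?m)" 0] by (simp add: power2_eq_square algebra_simps)
    then have "ennreal ((W p - W q)\<^sup>2) \<le> ennreal (2 * (W q - ?m)\<^sup>2 + 2 * (W p - ?m)\<^sup>2)" by (rule ennreal_leI)
    also have "\<dots> = 2 * X p q + 2 * X q p"
      by (simp add: X_def ennreal_mult add.commute)
    finally show "ennreal ((W p - W q)\<^sup>2) \<le> 2 * X p q + 2 * X q p" .
  qed auto
  also have "\<dots> = 2 * (\<integral>\<^sup>+p\<in>D. (\<integral>\<^sup>+q\<in>D. X p q \<partial>lborel) \<partial>lborel) + 2 * (\<integral>\<^sup>+p\<in>D. (\<integral>\<^sup>+q\<in>D. X q p \<partial>lborel) \<partial>lborel)"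
  proof -
    have "(\<integral>\<^sup>+p\<in>D. (\<integral>\<^sup>+q\<in>D. 2 * X p q + 2 * X q p \<partial>lborel) \<partial>lborel)
       = (\<integral>\<^sup>+p. 2 * ((\<integral>\<^sup>+q\<in>D. X p q \<partial>lborel) * indicator D p) + 2 * ((\<integral>\<^sup>+q\<in>D. X q p \<partial>lborel) * indicator D p) \<partial>lborel)"
    proof (rule nn_integral_cong)
      fix p
      have "(\<integral>\<^sup>+q\<in>D. 2 * X p q + 2 * X q p \<partial>lborel) = (\<integral>\<^sup>+q. 2 * (X p q * indicator D q) + 2 * (X q p * indicator D q) \<partial>lborel)"
        by (intro nn_integral_cong) (simp add: distrib_right mult.assoc)
      also have "\<dots> = 2 * (\<integral>\<^sup>+q\<in>D. X p q \<partial>lborel) + 2 * (\<integral>\<^sup>+q\<in>D. X q p \<partial>lborel)"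
        by (subst nn_integral_add; (subst nn_integral_cmult)?; (subst nn_integral_cmult)?; measurable)
      finally show "(\<integral>\<^sup>+q\<in>D. 2 * X p q + 2 * X q p \<partial>lborel) * indicator D p =
          2 * ((\<integral>\<^sup>+q\<in>D. X p q \<partial>lborel) * indicator D p) + 2 * ((\<integral>\<^sup>+q\<in>D. X q p \<partial>lborel) * indicator D p)"
        by (simp add: distrib_right mult.assoc)
    qed
    also have "\<dots> = 2 * (\<integral>\<^sup>+p\<in>D. (\<integral>\<^sup>+q\<in>D. X p q \<partial>lborel) \<partial>lborel) + 2 * (\<integral>\<^sup>+p\<in>D. (\<integral>\<^sup>+q\<in>D. X q p \<partial>lborel) \<partial>lborel)"
      by (subst nn_integral_add; (subst nn_integral_cmult)?; (subst nn_integral_cmult)?; measurable)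
    finally show ?thesis .
  qed
  also have "\<dots> = 4 * (\<integral>\<^sup>+p\<in>D. (\<integral>\<^sup>+q\<in>D. X p q \<partial>lborel) \<partial>lborel)"
    unfolding swap by (simp flip: distrib_right)
  also have "\<dots> \<le> 4 * (c * (2 ^ DIM('b) * emeasure lborel D * ?I))"
    by (intro mult_left_mono half) simp
  finally show ?thesis .
qed

lemma nn_integral_lborel_Pair:
  fixes F :: "'a::euclidean_space \<times> 'b::euclidean_space \<Rightarrow> ennreal"
  assumes "F \<in> borel_measurable borel"
  shows "(\<integral>\<^sup>+y. F y \<partial>lborel) = (\<integral>\<^sup>+x. (\<integral>\<^sup>+t. F (x, t) \<partial>lborel) \<partial>lborel)"
  using assms by (simp add: lborel_prod[symmetric] lborel.nn_integral_fst borel_prod[symmetric])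

text \<open>The bridge between the extended nonnegative integrals, in which the inequalities are
  derived without integrability conditions, and the Lebesgue integrals, in which they are
  stated.\<close>

lemma nn_integral_power2_L2:
  fixes f :: "'b::euclidean_space \<Rightarrow> 'c::euclidean_space"
  assumes "f \<in> L2 D"
  shows "(\<integral>\<^sup>+x\<in>D. ennreal ((norm (f x))\<^sup>2) \<partial>lborel) = ennreal (LINT x:D|lebesgue. (norm (f x))\<^sup>2)"
proof -
  have "integrable lebesgue (\<lambda>x. indicator D x *\<^sub>R (norm (f x))\<^sup>2)"
    using assms by (simp add: L2_def set_integrable_def)
  then have "(\<integral>\<^sup>+x. ennreal (indicator D x *\<^sub>R (norm (f x))\<^sup>2) \<partial>lebesgue) = ennreal (LINT x:D|lebesgue. (norm (f x))\<^sup>2)"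
    unfolding set_lebesgue_integral_def by (rule nn_integral_eq_integral) simp
  moreover have "(\<integral>\<^sup>+x. ennreal (indicator D x *\<^sub>R (norm (f x))\<^sup>2) \<partial>lebesgue) = (\<integral>\<^sup>+x\<in>D. ennreal ((norm (f x))\<^sup>2) \<partial>lborel)"
    unfolding nn_integral_completion by (intro nn_integral_cong) (auto simp: indicator_def)
  ultimately show ?thesis by simp
qed

subsection \<open>The cylinder chart of a nozzle\<close>

lemma norm_fst_le_norm: "norm (fst x) \<le> norm x" for x :: "'a::real_normed_vector \<times> 'b::real_normed_vector"
  using norm_fst_le[of "fst x" "snd x"] by simp

text \<open>What the energy estimate draws from a nozzle: a bijection with the cylinder that
  preserves the axial coordinate and whose derivatives are bounded in both directions. The bound
  \<open>K\<close> is uniform along the axis, hence all constants below are independent of the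
  position of a slab.\<close>

locale nozzle_chart =
  fixes \<Omega> :: "('a::euclidean_space \<times> real) set" and T S :: "'a \<times> real \<Rightarrow> 'a \<times> real"
    and T1 S1 :: "'a \<times> real \<Rightarrow> ('a \<times> real) \<Rightarrow>\<^sub>L ('a \<times> real)" and K :: real
  assumes open_\<Omega>: "open \<Omega>" and K: "0 < K"
    and T_cyl: "\<And>x. x \<in> \<Omega> \<Longrightarrow> T x \<in> cylinder" and snd_T: "\<And>x. x \<in> \<Omega> \<Longrightarrow> snd (T x) = snd x"
    and S_\<Omega>: "\<And>y. y \<in> cylinder \<Longrightarrow> S y \<in> \<Omega>" and snd_S: "\<And>y. y \<in> cylinder \<Longrightarrow> snd (S y) = snd y"
    and S_T: "\<And>x. x \<in> \<Omega> \<Longrightarrow> S (T x) = x" and T_S: "\<And>y. y \<in> cylinder \<Longrightarrow> T (S y) = y"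
    and T_deriv: "\<And>x. x \<in> \<Omega> \<Longrightarrow> (T has_derivative blinfun_apply (T1 x)) (at x)"
    and S_deriv: "\<And>y. y \<in> cylinder \<Longrightarrow> (S has_derivative blinfun_apply (S1 y)) (at y)"
    and norm_T1: "\<And>x. x \<in> \<Omega> \<Longrightarrow> norm (T1 x) \<le> K" and norm_S1: "\<And>y. y \<in> cylinder \<Longrightarrow> norm (S1 y) \<le> K"
    and S1_cont: "continuous_on cylinder S1"
begin

definition cyl_slab :: "real \<Rightarrow> real \<Rightarrow> ('a \<times> real) set" where
  "cyl_slab a b = ball 0 1 \<times> {a<..<b}"

lemma mem_cylinder: "y \<in> cylinder \<longleftrightarrow> fst y \<in> ball 0 1" for y :: "'a \<times> real"
  by (cases y) (auto simp: cylinder_def)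

lemma open_cylinder: "open (cylinder :: ('a \<times> real) set)" and convex_cylinder: "convex (cylinder :: ('a \<times> real) set)"
  unfolding cylinder_def by (auto intro: open_Times convex_Times)

lemma cyl_slab_subset: "cyl_slab a b \<subseteq> cylinder"
  by (auto simp: cyl_slab_def cylinder_def)

lemma open_cyl_slab: "open (cyl_slab a b)" and convex_cyl_slab: "convex (cyl_slab a b)"
  and bounded_cyl_slab: "bounded (cyl_slab a b)"
  unfolding cyl_slab_def by (auto intro: open_Times convex_Times bounded_Times)

lemma slab_subset: "slab \<Omega> a b \<subseteq> \<Omega>"
  by (auto simp: slab_def)

lemma open_slab: "open (slab \<Omega> a b)"
proof -
  have "slab \<Omega> a b = \<Omega> \<inter> snd -` {a<..<b}" by (auto simp: slab_def)
  then show ?thesis using open_\<Omega> by (auto intro!: open_Int open_vimage continuous_intros)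
qed

lemma truncation_eq_slab: "truncation \<Omega> L = slab \<Omega> (-L) L"
  by (auto simp: truncation_def slab_def)

lemma T_slab: "T ` slab \<Omega> a b = cyl_slab a b"
proof (intro equalityI subsetI)
  fix y assume "y \<in> cyl_slab a b"
  then have "y \<in> cylinder" "a < snd y" "snd y < b" by (auto simp: cyl_slab_def cylinder_def)
  then have "S y \<in> slab \<Omega> a b" "y = T (S y)" using S_\<Omega> snd_S T_S by (auto simp: slab_def)
  then show "y \<in> T ` slab \<Omega> a b" by blast
next
  fix y assume "y \<in> T ` slab \<Omega> a b"
  then obtain x where x: "x \<in> \<Omega>" "a < snd x" "snd x < b" "y = T x" by (auto simp: slab_def)
  then have "fst y \<in> ball 0 1" "snd y \<in> {a<..<b}" using T_cyl[OF x(1)] snd_T[OF x(1)] by (auto simp: mem_cylinder)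
  then show "y \<in> cyl_slab a b" by (cases y) (auto simp: cyl_slab_def)
qed

lemma S_cyl_slab: "S ` cyl_slab a b = slab \<Omega> a b"
proof -
  have "S ` cyl_slab a b = (\<lambda>x. S (T x)) ` slab \<Omega> a b" by (simp add: T_slab[symmetric] image_image)
  also have "\<dots> = (\<lambda>x. x) ` slab \<Omega> a b" using S_T by (intro image_cong) (auto simp: slab_def)
  finally show ?thesis by simp
qed

lemma T_cont: "continuous_on \<Omega> T"
  by (intro continuous_at_imp_continuous_on ballI has_derivative_continuous[OF T_deriv])

lemma S_cont: "continuous_on cylinder S"
  by (intro continuous_at_imp_continuous_on ballI has_derivative_continuous[OF S_deriv])

lemma S_lipschitz:
  assumes "closed_segment x y \<subseteq> cylinder"
  shows "norm (S x - S y) \<le> K * norm (x - y)"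
  by (rule differentiable_bound[of "closed_segment x y" S "\<lambda>y. blinfun_apply (S1 y)"])
     (use assms norm_S1 in \<open>auto intro!: has_derivative_at_withinI S_deriv simp: norm_blinfun.rep_eq[symmetric]\<close>)

lemma T_lipschitz:
  assumes "closed_segment x y \<subseteq> \<Omega>"
  shows "norm (T x - T y) \<le> K * norm (x - y)"
  by (rule differentiable_bound[of "closed_segment x y" T "\<lambda>y. blinfun_apply (T1 y)"])
     (use assms norm_T1 in \<open>auto intro!: has_derivative_at_withinI T_deriv simp: norm_blinfun.rep_eq[symmetric]\<close>)

text \<open>\<open>S\<close> is Lipschitz between any two points of the convex cylinder, so the
  image of a bounded piece is bounded.\<close>

lemma bounded_slab: "bounded (slab \<Omega> a b)"
proof -
  obtain R where R: "\<And>x y. x \<in> cyl_slab a b \<Longrightarrow> y \<in> cyl_slab a b \<Longrightarrow> dist x y \<le> R"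
    using bounded_cyl_slab[of a b] by (meson bounded_two_points)
  have "norm (S x - S y) \<le> K * R" if "x \<in> cyl_slab a b" "y \<in> cyl_slab a b" for x y
  proof -
    have "closed_segment x y \<subseteq> cylinder"
      using that cyl_slab_subset convex_cylinder by (meson closed_segment_subset subsetD)
    then have "norm (S x - S y) \<le> K * norm (x - y)" by (rule S_lipschitz)
    also have "\<dots> \<le> K * R" using R[OF that] K by (intro mult_left_mono) (auto simp: dist_norm)
    finally show ?thesis .
  qed
  then have "\<forall>x\<in>S ` cyl_slab a b. \<forall>y\<in>S ` cyl_slab a b. dist x y \<le> K * R" by (simp add: dist_norm)
  then show ?thesis unfolding S_cyl_slab by (subst bounded_two_points) blast
qed

text \<open>\<open>C0\<close> and \<open>C1\<close> are the factors of
  \<open>nn_integral_lipschitz_image_le\<close> for maps with Lipschitz bound \<open>K\<close>, in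
  the full space and in a cross section respectively.\<close>

definition C0 :: real where "C0 = (2 * K * DIM('a \<times> real)) ^ DIM('a \<times> real)"
definition C1 :: real where "C1 = (2 * K * DIM('a)) ^ DIM('a)"

lemma C0_pos: "0 < C0" and C1_pos: "0 < C1"
  using K unfolding C0_def C1_def by (intro zero_less_power mult_pos_pos; simp)+

lemma nn_integral_cyl_slab_le:
  assumes F: "F \<in> borel_measurable borel"
  shows "(\<integral>\<^sup>+y\<in>cyl_slab a b. F (S y) \<partial>lborel) \<le> ennreal C0 * (\<integral>\<^sup>+x\<in>slab \<Omega> a b. F x \<partial>lborel)"
proof -
  have "(\<integral>\<^sup>+y\<in>T ` slab \<Omega> a b. F (S y) \<partial>lborel) \<le> ennreal C0 * (\<integral>\<^sup>+x\<in>slab \<Omega> a b. F x \<partial>lborel)"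
    unfolding C0_def
  proof (rule nn_integral_lipschitz_image_le[OF open_\<Omega>])
    show "continuous_on (T ` slab \<Omega> a b) S"
      unfolding T_slab by (rule continuous_on_subset[OF S_cont cyl_slab_subset])
    show "S (T x) = x" if "x \<in> slab \<Omega> a b" for x
      using that slab_subset by (intro S_T) blast
  qed (use F K bounded_slab open_slab open_cyl_slab slab_subset T_lipschitz in \<open>auto simp: T_slab\<close>)
  then show ?thesis by (simp add: T_slab)
qed

text \<open>\<open>S\<close> is controlled only on the cylinder; the indicator turns the composition
  into a globally Borel function, as the integral comparisons require.\<close>

lemma borel_measurable_S_indicator:
  fixes F :: "'a \<times> real \<Rightarrow> ennreal"
  assumes "F \<in> borel_measurable borel" "D \<in> sets borel" "D \<subseteq> cylinder"
  shows "(\<lambda>y. F (S y) * indicator D y) \<in> borel_measurable borel"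
proof -
  have "(\<lambda>y. indicator cylinder y *\<^sub>R S y) \<in> borel_measurable borel"
    using open_cylinder S_cont by (intro borel_measurable_continuous_on_indicator) auto
  then have "(\<lambda>y. F (indicator cylinder y *\<^sub>R S y) * indicator D y) \<in> borel_measurable borel"
    using assms by measurable
  moreover have "(\<lambda>y. F (indicator cylinder y *\<^sub>R S y) * indicator D y) = (\<lambda>y. F (S y) * indicator D y)"
    using assms(3) by (intro ext) (auto simp: indicator_def)
  ultimately show ?thesis by simp
qed

lemma nn_integral_slab_le:
  assumes F: "F \<in> borel_measurable borel"
  shows "(\<integral>\<^sup>+x\<in>slab \<Omega> a b. F x \<partial>lborel) \<le> ennreal C0 * (\<integral>\<^sup>+y\<in>cyl_slab a b. F (S y) \<partial>lborel)"
proof -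
  have "(\<integral>\<^sup>+x\<in>S ` cyl_slab a b. (\<lambda>y. F (S y) * indicator (cyl_slab a b) y) (T x) \<partial>lborel)
      \<le> ennreal C0 * (\<integral>\<^sup>+y\<in>cyl_slab a b. (\<lambda>y. F (S y) * indicator (cyl_slab a b) y) y \<partial>lborel)"
    unfolding C0_def
  proof (rule nn_integral_lipschitz_image_le[OF open_cylinder cyl_slab_subset bounded_cyl_slab])
    show "continuous_on (S ` cyl_slab a b) T"
      unfolding S_cyl_slab by (rule continuous_on_subset[OF T_cont]) (auto simp: slab_def)
    show "(\<lambda>y. F (S y) * indicator (cyl_slab a b) y) \<in> borel_measurable borel"
      using open_cyl_slab cyl_slab_subset by (intro borel_measurable_S_indicator F) auto
    show "T (S y) = y" if "y \<in> cyl_slab a b" for y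
      using that cyl_slab_subset by (intro T_S) blast
  qed (use K open_slab open_cyl_slab S_lipschitz in \<open>auto simp: S_cyl_slab\<close>)
  also have "(\<integral>\<^sup>+x\<in>S ` cyl_slab a b. (\<lambda>y. F (S y) * indicator (cyl_slab a b) y) (T x) \<partial>lborel) = (\<integral>\<^sup>+x\<in>slab \<Omega> a b. F x \<partial>lborel)"
    unfolding S_cyl_slab
  proof (rule nn_integral_cong)
    fix x
    show "F (S (T x)) * indicator (cyl_slab a b) (T x) * indicator (slab \<Omega> a b) x = F x * indicator (slab \<Omega> a b) x"
    proof (cases "x \<in> slab \<Omega> a b")
      case True
      then have "T x \<in> cyl_slab a b" "S (T x) = x" using T_slab[of a b] slab_subset S_T by blast+
      then show ?thesis using True by simp
    qed simp
  qed
  also have "(\<integral>\<^sup>+y\<in>cyl_slab a b. (\<lambda>y. F (S y) * indicator (cyl_slab a b) y) y \<partial>lborel) = (\<integral>\<^sup>+y\<in>cyl_slab a b. F (S y) \<partial>lborel)"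
    by (intro nn_integral_cong) (auto simp: indicator_def)
  finally show ?thesis .
qed

section \<open>The chart restricted to cross sections\<close>

definition T_slice :: "real \<Rightarrow> 'a \<Rightarrow> 'a" where "T_slice t x = fst (T (x, t))"
definition S_slice :: "real \<Rightarrow> 'a \<Rightarrow> 'a" where "S_slice t y = fst (S (y, t))"

lemma S_slice_Pair: "y \<in> ball 0 1 \<Longrightarrow> S (y, t) = (S_slice t y, t)"
  using snd_S[of "(y, t)"] by (auto simp: S_slice_def mem_cylinder prod_eq_iff)

lemma T_slice_Pair: "x \<in> cross_section \<Omega> t \<Longrightarrow> T (x, t) = (T_slice t x, t)"
  using snd_T[of "(x, t)"] by (auto simp: T_slice_def cross_section_def prod_eq_iff)

lemma S_slice_mem: "y \<in> ball 0 1 \<Longrightarrow> S_slice t y \<in> cross_section \<Omega> t"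
  using S_slice_Pair[of y t] S_\<Omega>[of "(y, t)"] by (simp add: cross_section_def mem_cylinder)

lemma T_slice_mem: "x \<in> cross_section \<Omega> t \<Longrightarrow> T_slice t x \<in> ball 0 1"
  using T_cyl[of "(x, t)"] by (simp add: T_slice_def cross_section_def mem_cylinder)

lemma S_T_slice: "x \<in> cross_section \<Omega> t \<Longrightarrow> S_slice t (T_slice t x) = x"
  using T_slice_Pair[of x t] S_T[of "(x, t)"] by (simp add: S_slice_def cross_section_def)

lemma T_S_slice: "y \<in> ball 0 1 \<Longrightarrow> T_slice t (S_slice t y) = y"
  using S_slice_Pair[of y t] T_S[of "(y, t)"] by (simp add: T_slice_def mem_cylinder)

lemma T_slice_image: "T_slice t ` cross_section \<Omega> t = ball 0 1"
  using T_slice_mem S_slice_mem T_S_slice by (metis (no_types, lifting) equalityI image_subsetI rev_image_eqI subsetI)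

lemma S_slice_image: "S_slice t ` ball 0 1 = cross_section \<Omega> t"
  using T_slice_mem S_slice_mem S_T_slice by (metis (no_types, lifting) equalityI image_subsetI rev_image_eqI subsetI)

lemma T_slice_cont: "continuous_on (cross_section \<Omega> t) (T_slice t)"
  unfolding T_slice_def
  by (intro continuous_on_fst continuous_on_compose2[OF T_cont]) (auto intro!: continuous_intros simp: cross_section_def)

lemma S_slice_cont: "continuous_on (ball 0 1) (S_slice t)"
  unfolding S_slice_def
  by (intro continuous_on_fst continuous_on_compose2[OF S_cont]) (auto intro!: continuous_intros simp: cylinder_def)

lemma open_cross_section: "open (cross_section \<Omega> t)"
proof -
  have "cross_section \<Omega> t = (\<lambda>x. (x, t)) -` \<Omega>" by (auto simp: cross_section_def)
  then show ?thesis using open_\<Omega> by (auto intro!: open_vimage continuous_intros)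
qed

lemma bounded_cross_section: "bounded (cross_section \<Omega> t)"
proof -
  have "cross_section \<Omega> t \<subseteq> fst ` slab \<Omega> (t - 1) (t + 1)"
    by (force simp: cross_section_def slab_def)
  then show ?thesis using bounded_slab bounded_fst bounded_subset by blast
qed

lemma closed_segment_Pair_const: "closed_segment (x, t) (y, t) = (\<lambda>z. (z, t::real)) ` closed_segment x (y::'a)"
proof -
  have "(1 - u) *\<^sub>R (x, t) + u *\<^sub>R (y, t) = ((1 - u) *\<^sub>R x + u *\<^sub>R y, t)" for u
    by (simp add: algebra_simps)
  then show ?thesis unfolding closed_segment_image_interval by (simp add: image_image)
qed

lemma T_slice_lipschitz:
  assumes "closed_segment x y \<subseteq> cross_section \<Omega> t"
  shows "norm (T_slice t x - T_slice t y) \<le> K * norm (x - y)"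
proof -
  have "closed_segment (x, t) (y, t) \<subseteq> \<Omega>"
    using assms by (auto simp: closed_segment_Pair_const cross_section_def)
  from T_lipschitz[OF this] norm_fst_le_norm[of "T (x, t) - T (y, t)"] show ?thesis
    by (simp add: T_slice_def norm_Pair)
qed

lemma S_slice_lipschitz:
  assumes "closed_segment x y \<subseteq> ball 0 1"
  shows "norm (S_slice t x - S_slice t y) \<le> K * norm (x - y)"
proof -
  have "closed_segment (x, t) (y, t) \<subseteq> cylinder"
    using assms by (auto simp: closed_segment_Pair_const cylinder_def)
  from S_lipschitz[OF this] norm_fst_le_norm[of "S (x, t) - S (y, t)"] show ?thesis
    by (simp add: S_slice_def norm_Pair)
qed

lemma nn_integral_ball_slice_le:
  assumes F: "F \<in> borel_measurable borel"
  shows "(\<integral>\<^sup>+y\<in>ball 0 1. F (S (y, t)) \<partial>lborel) \<le> ennreal C1 * (\<integral>\<^sup>+x\<in>cross_section \<Omega> t. F (x, t) \<partial>lborel)"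
proof -
  have "(\<integral>\<^sup>+y\<in>T_slice t ` cross_section \<Omega> t. (\<lambda>x. F (x, t)) (S_slice t y) \<partial>lborel)
      \<le> ennreal C1 * (\<integral>\<^sup>+x\<in>cross_section \<Omega> t. (\<lambda>x. F (x, t)) x \<partial>lborel)"
    unfolding C1_def
  proof (rule nn_integral_lipschitz_image_le[OF open_cross_section order_refl bounded_cross_section])
    show "(\<lambda>x. F (x, t)) \<in> borel_measurable borel"
      using F by measurable
  qed (use K open_cross_section S_slice_cont S_T_slice T_slice_lipschitz in \<open>auto simp: T_slice_image\<close>)
  also have "(\<integral>\<^sup>+y\<in>T_slice t ` cross_section \<Omega> t. (\<lambda>x. F (x, t)) (S_slice t y) \<partial>lborel) = (\<integral>\<^sup>+y\<in>ball 0 1. F (S (y, t)) \<partial>lborel)"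
    unfolding T_slice_image using S_slice_Pair by (intro nn_integral_cong) (auto simp: indicator_def)
  finally show ?thesis .
qed

lemma nn_integral_cross_section_le:
  assumes F: "F \<in> borel_measurable borel"
  shows "(\<integral>\<^sup>+x\<in>cross_section \<Omega> t. F (x, t) \<partial>lborel) \<le> ennreal C1 * (\<integral>\<^sup>+y\<in>ball 0 1. F (S (y, t)) \<partial>lborel)"
proof -
  let ?F = "\<lambda>y. F (S (y, t)) * indicator (ball 0 1) y"
  have "(\<lambda>y. (\<lambda>z. F (S z) * indicator cylinder z) (y, t)) \<in> borel_measurable borel"
  proof -
    have [measurable]: "(\<lambda>z. F (S z) * indicator cylinder z) \<in> borel_measurable borel"
      using open_cylinder by (intro borel_measurable_S_indicator F) auto
    show ?thesis by measurable
  qed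
  also have "(\<lambda>y. (\<lambda>z. F (S z) * indicator cylinder z) (y, t)) = ?F"
    by (auto simp: mem_cylinder indicator_def)
  finally have meas: "?F \<in> borel_measurable borel" .
  have "(\<integral>\<^sup>+x\<in>S_slice t ` ball 0 1. ?F (T_slice t x) \<partial>lborel) \<le> ennreal C1 * (\<integral>\<^sup>+y\<in>ball 0 1. ?F y \<partial>lborel)"
    unfolding C1_def
    by (rule nn_integral_lipschitz_image_le[OF open_ball order_refl bounded_ball _ _ _ _ _ _ meas])
       (use K open_cross_section T_slice_cont T_S_slice S_slice_lipschitz in \<open>auto simp: S_slice_image\<close>)
  also have "(\<integral>\<^sup>+x\<in>S_slice t ` ball 0 1. ?F (T_slice t x) \<partial>lborel) = (\<integral>\<^sup>+x\<in>cross_section \<Omega> t. F (x, t) \<partial>lborel)"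
    unfolding S_slice_image
  proof (rule nn_integral_cong)
    fix x
    show "?F (T_slice t x) * indicator (cross_section \<Omega> t) x = F (x, t) * indicator (cross_section \<Omega> t) x"
      using T_slice_mem[of x t] S_T_slice[of x t] S_slice_Pair[of "T_slice t x" t]
      by (cases "x \<in> cross_section \<Omega> t") auto
  qed
  also have "(\<integral>\<^sup>+y\<in>ball 0 1. ?F y \<partial>lborel) = (\<integral>\<^sup>+y\<in>ball 0 1. F (S (y, t)) \<partial>lborel)"
    by (intro nn_integral_cong) (auto simp: indicator_def)
  finally show ?thesis .
qed

section \<open>Lower bounds for volumes and areas\<close>

lemma emeasure_cyl_slab:
  assumes "a \<le> b"
  shows "emeasure lborel (cyl_slab a b) = emeasure lborel (ball (0::'a) 1) * ennreal (b - a)"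
proof -
  have "emeasure (lborel \<Otimes>\<^sub>M lborel) (ball (0::'a) 1 \<times> {a<..<b}) = emeasure lborel (ball (0::'a) 1) * emeasure lborel {a<..<b}"
    by (rule lborel.emeasure_pair_measure_Times) auto
  then show ?thesis using assms by (simp add: cyl_slab_def lborel_prod)
qed

definition ball_vol :: real where "ball_vol = measure lborel (ball (0::'a) 1)"

lemma emeasure_ball_vol: "emeasure lborel (ball (0::'a) 1) = ennreal ball_vol"
  unfolding ball_vol_def 
  using emeasure_lborel_ball_finite[of "0::'a" 1] by (intro emeasure_eq_ennreal_measure) (simp add: less_top)

lemma ball_vol_pos: "0 < ball_vol"
  unfolding ball_vol_def using content_ball_pos[of 1 "0::'a"] by simp

text \<open>Converts the final bound, which is linear in \<open>b - a\<close>, into a bound for the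
  average over the slab.\<close>

lemma measure_slab_ge:
  assumes "a \<le> b"
  shows "ball_vol * (b - a) \<le> C0 * measure lebesgue (slab \<Omega> a b)"
proof -
  have fin: "emeasure lborel (slab \<Omega> a b) = ennreal (measure lebesgue (slab \<Omega> a b))"
    using emeasure_bounded_finite[OF bounded_slab[of a b]] open_slab[of a b]
    by (simp add: emeasure_eq_ennreal_measure less_top measure_completion)
  have "ennreal (ball_vol * (b - a)) = (\<integral>\<^sup>+y\<in>cyl_slab a b. 1 \<partial>lborel)"
    using emeasure_cyl_slab[OF assms] open_cyl_slab[of a b] ball_vol_pos assms
    by (simp add: emeasure_ball_vol ennreal_mult)
  also have "\<dots> \<le> ennreal C0 * (\<integral>\<^sup>+x\<in>slab \<Omega> a b. 1 \<partial>lborel)"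
    by (rule nn_integral_cyl_slab_le) simp
  also have "\<dots> = ennreal (C0 * measure lebesgue (slab \<Omega> a b))"
    using open_slab[of a b] C0_pos by (simp add: fin ennreal_mult)
  finally show ?thesis using C0_pos by (subst (asm) ennreal_le_iff) auto
qed

text \<open>Keeps the flux density \<open>m / measure lebesgue (cross_section \<Omega> L)\<close>
  bounded uniformly in \<open>L\<close>.\<close>

lemma measure_cross_section_ge: "ball_vol \<le> C1 * measure lebesgue (cross_section \<Omega> t)"
proof -
  have fin: "emeasure lborel (cross_section \<Omega> t) = ennreal (measure lebesgue (cross_section \<Omega> t))"
    using emeasure_bounded_finite[OF bounded_cross_section[of t]] open_cross_section[of t]
    by (simp add: emeasure_eq_ennreal_measure less_top measure_completion)
  have "ennreal ball_vol = (\<integral>\<^sup>+y\<in>ball (0::'a) 1. 1 \<partial>lborel)"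
    by (simp add: emeasure_ball_vol)
  also have "\<dots> \<le> ennreal C1 * (\<integral>\<^sup>+x\<in>cross_section \<Omega> t. 1 \<partial>lborel)"
    by (rule nn_integral_ball_slice_le) simp
  also have "\<dots> = ennreal (C1 * measure lebesgue (cross_section \<Omega> t))"
    using open_cross_section[of t] C1_pos by (simp add: fin ennreal_mult)
  finally show ?thesis using C1_pos by (subst (asm) ennreal_le_iff) auto
qed

subsection \<open>Inequalities for continuously differentiable functions\<close>

text \<open>The chain rule for \<open>v\<close> composed with \<open>S\<close> on a straight line in
  the cylinder. The parameter interval is left free: the Poincare inequality takes the half from
  \<open>1/2\<close> to \<open>1\<close>, the axial estimates take an interval of heights.\<close>

lemma pullback_increment_le:
  assumes v: "C1_with_gradient v Dv" and ab: "\<alpha> \<le> \<beta>"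
    and line: "\<And>s. s \<in> {\<alpha>..\<beta>} \<Longrightarrow> (1 - s) *\<^sub>R p + s *\<^sub>R q \<in> cylinder"
  shows "ennreal ((v (S ((1 - \<beta>) *\<^sub>R p + \<beta> *\<^sub>R q)) - v (S ((1 - \<alpha>) *\<^sub>R p + \<alpha> *\<^sub>R q)))\<^sup>2)
    \<le> ennreal (\<beta> - \<alpha>) * (\<integral>\<^sup>+s\<in>{\<alpha><..<\<beta>}. ennreal ((K * norm (Dv (S ((1 - s) *\<^sub>R p + s *\<^sub>R q))) * norm (q - p))\<^sup>2) \<partial>lborel)"
proof -
  let ?l = "\<lambda>s. (1 - s) *\<^sub>R p + s *\<^sub>R q"
  show ?thesis
  proof (rule power2_increment_le[OF ab, where w = "\<lambda>s. v (S (?l s))"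
        and w' = "\<lambda>s. blinfun_apply (S1 (?l s)) (q - p) \<bullet> Dv (S (?l s))"])
    fix s assume s: "s \<in> {\<alpha>..\<beta>}"
    have l: "(?l has_derivative (\<lambda>h. h *\<^sub>R (q - p))) (at s within {\<alpha>..\<beta>})"
      by (auto intro!: derivative_eq_intros simp: algebra_simps)
    have "((\<lambda>s. S (?l s)) has_derivative (\<lambda>h. blinfun_apply (S1 (?l s)) (h *\<^sub>R (q - p)))) (at s within {\<alpha>..\<beta>})"
      by (rule has_derivative_compose[OF l S_deriv[OF line[OF s]]])
    from has_derivative_compose[OF this C1_with_gradientD(1)[OF v]]
    have "((\<lambda>s. v (S (?l s))) has_derivative (\<lambda>h. blinfun_apply (S1 (?l s)) (h *\<^sub>R (q - p)) \<bullet> Dv (S (?l s)))) (at s within {\<alpha>..\<beta>})" .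
    then show "((\<lambda>s. v (S (?l s))) has_real_derivative blinfun_apply (S1 (?l s)) (q - p) \<bullet> Dv (S (?l s))) (at s within {\<alpha>..\<beta>})"
      by (rule has_derivative_imp_has_field_derivative) (simp add: blinfun.scaleR_right)
    have "\<bar>blinfun_apply (S1 (?l s)) (q - p) \<bullet> Dv (S (?l s))\<bar> \<le> norm (blinfun_apply (S1 (?l s)) (q - p)) * norm (Dv (S (?l s)))"
      by (rule Cauchy_Schwarz_ineq2)
    also have "\<dots> \<le> (K * norm (q - p)) * norm (Dv (S (?l s)))"
      by (intro mult_right_mono order_trans[OF norm_blinfun] norm_S1[OF line[OF s]]) auto
    finally show "\<bar>blinfun_apply (S1 (?l s)) (q - p) \<bullet> Dv (S (?l s))\<bar> \<le> K * norm (Dv (S (?l s))) * norm (q - p)"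
      by (simp add: mult_ac)
  next
    have "continuous_on {\<alpha>..\<beta>} (\<lambda>s. S (?l s))"
      using line by (intro continuous_on_compose2[OF S_cont] continuous_intros) auto
    then have "continuous_on {\<alpha>..\<beta>} (\<lambda>s. Dv (S (?l s)))"
      by (intro continuous_on_compose2[OF C1_with_gradientD(3)[OF v]]) auto
    then show "continuous_on {\<alpha>..\<beta>} (\<lambda>s. K * norm (Dv (S (?l s))) * norm (q - p))"
      by (intro continuous_intros)
  qed
qed

lemma pullback_axial_increment_le:
  assumes v: "C1_with_gradient v Dv" and st: "s \<le> t" and y: "y \<in> ball 0 1"
  shows "ennreal ((v (S (y, t)) - v (S (y, s)))\<^sup>2)
    \<le> ennreal (t - s) * (\<integral>\<^sup>+r\<in>{s<..<t}. ennreal ((K * norm (Dv (S (y, r))))\<^sup>2) \<partial>lborel)"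
proof -
  \<comment> \<open>With these two points the line is parametrised by height and their distance is
    1; heights outside the unit interval are harmless since the whole line lies in the
    cylinder.\<close>
  have l: "(1 - r) *\<^sub>R (y, 0) + r *\<^sub>R (y, 1) = (y, r)" for r :: real
    by (simp add: algebra_simps)
  show ?thesis
    using pullback_increment_le[OF v st, of "(y, 0)" "(y, 1)"] y
    unfolding l by (simp add: norm_Pair mem_cylinder)
qed

definition grad2 :: "('a \<times> real \<Rightarrow> 'a \<times> real) \<Rightarrow> 'a \<times> real \<Rightarrow> ennreal" where
  "grad2 Dv x = ennreal ((norm (Dv x))\<^sup>2)"

lemma grad2_measurable:
  assumes "C1_with_gradient v Dv"
  shows "grad2 Dv \<in> borel_measurable borel"
proof -
  have [measurable]: "Dv \<in> borel_measurable borel"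
    by (rule borel_measurable_continuous_onI[OF C1_with_gradientD(3)[OF assms]])
  show ?thesis unfolding grad2_def by measurable
qed

lemma nn_integral_grad2_le:
  assumes "C1_with_gradient v Dv"
  shows "(\<integral>\<^sup>+y\<in>cyl_slab a b. ennreal ((K * norm (Dv (S y)))\<^sup>2) \<partial>lborel)
    \<le> ennreal (K\<^sup>2 * C0) * (\<integral>\<^sup>+x\<in>slab \<Omega> a b. ennreal ((norm (Dv x))\<^sup>2) \<partial>lborel)"
proof -
  have "(\<integral>\<^sup>+y\<in>cyl_slab a b. ennreal ((K * norm (Dv (S y)))\<^sup>2) \<partial>lborel)
      = (\<integral>\<^sup>+y. ennreal (K\<^sup>2) * (grad2 Dv (S y) * indicator (cyl_slab a b) y) \<partial>lborel)"
    by (intro nn_integral_cong) (simp add: grad2_def power_mult_distrib ennreal_mult mult.assoc)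
  also have "\<dots> = ennreal (K\<^sup>2) * (\<integral>\<^sup>+y\<in>cyl_slab a b. grad2 Dv (S y) \<partial>lborel)"
    using borel_measurable_S_indicator[OF grad2_measurable[OF assms] _ cyl_slab_subset] open_cyl_slab[of a b]
    by (intro nn_integral_cmult) auto
  also have "\<dots> \<le> ennreal (K\<^sup>2) * (ennreal C0 * (\<integral>\<^sup>+x\<in>slab \<Omega> a b. grad2 Dv x \<partial>lborel))"
    by (intro mult_left_mono nn_integral_cyl_slab_le grad2_measurable[OF assms]) auto
  also have "\<dots> = ennreal (K\<^sup>2 * C0) * (\<integral>\<^sup>+x\<in>slab \<Omega> a b. ennreal ((norm (Dv x))\<^sup>2) \<partial>lborel)"
    using C0_pos by (simp add: grad2_def ennreal_mult mult.assoc)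
  finally show ?thesis .
qed

lemma L2_slab_continuous:
  fixes f :: "'a \<times> real \<Rightarrow> 'c::euclidean_space"
  assumes "continuous_on UNIV f"
  shows "f \<in> L2 (slab \<Omega> a b)"
  using assms open_slab[of a b] bounded_slab by (intro L2_continuous) auto

lemma set_integrable_pullback:
  assumes v: "C1_with_gradient v Dv"
  shows "set_integrable lborel (cyl_slab a b) (\<lambda>y. v (S y))"
proof -
  obtain B where B: "\<And>x. x \<in> slab \<Omega> a b \<Longrightarrow> norm (v x) \<le> B"
    using continuous_bounded_on_bounded[OF C1_with_gradientD(2)[OF v] bounded_slab] by metis
  have cont: "continuous_on (cyl_slab a b) (\<lambda>y. v (S y))"
    by (rule continuous_on_compose2[OF C1_with_gradientD(2)[OF v] continuous_on_subset[OF S_cont cyl_slab_subset]]) auto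
  have meas: "(\<lambda>y. indicator (cyl_slab a b) y *\<^sub>R v (S y)) \<in> borel_measurable lborel"
    using borel_measurable_continuous_on_indicator[OF _ cont] open_cyl_slab by simp
  have int: "integrable lborel (\<lambda>y. indicator (cyl_slab a b) y *\<^sub>R B)"
    using emeasure_bounded_finite[OF bounded_cyl_slab[of a b]] open_cyl_slab[of a b] by (intro integrable_scaleR_left integrable_real_indicator) auto
  show ?thesis
    unfolding set_integrable_def
  proof (rule Bochner_Integration.integrable_bound[OF int meas AE_I2])
    fix y
    show "norm (indicator (cyl_slab a b) y *\<^sub>R v (S y)) \<le> norm (indicator (cyl_slab a b) y *\<^sub>R B)"
    proof (cases "y \<in> cyl_slab a b")
      case True
      then have "norm (v (S y)) \<le> B" using S_cyl_slab[of a b] by (intro B) blast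
      then show ?thesis using True by simp
    qed simp
  qed
qed

text \<open>The mean value over a unit slab is taken in the coordinates of the cylinder, so that the
  means over two slabs are compared along axial segments.\<close>

definition mean :: "real \<Rightarrow> ('a \<times> real \<Rightarrow> real) \<Rightarrow> real" where
  "mean a v = (LINT y:cyl_slab a (a + 1)|lborel. v (S y)) / ball_vol"

lemma emeasure_unit_cyl_slab: "emeasure lborel (cyl_slab a (a + 1)) = ennreal ball_vol"
  by (simp add: emeasure_cyl_slab emeasure_ball_vol)

lemma measure_unit_cyl_slab: "measure lborel (cyl_slab a (a + 1)) = ball_vol"
  using ball_vol_pos by (simp add: measure_def emeasure_unit_cyl_slab)

text \<open>Cauchy-Schwarz in the form of Jensen's inequality: \<open>k - mean a v\<close> is the
  average of \<open>k - v (S q)\<close> over the unit piece of the cylinder.\<close>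

lemma mean_le:
  assumes v: "C1_with_gradient v Dv"
  shows "ennreal ((k - mean a v)\<^sup>2) \<le> ennreal (1 / ball_vol) * (\<integral>\<^sup>+q\<in>cyl_slab a (a + 1). ennreal ((k - v (S q))\<^sup>2) \<partial>lborel)"
proof -
  let ?D = "cyl_slab a (a + 1)"
  have k: "set_integrable lborel ?D (\<lambda>_. k)"
    unfolding set_integrable_def using open_cyl_slab[of a "a + 1"]
    by (intro integrable_scaleR_left integrable_real_indicator) (auto simp: emeasure_unit_cyl_slab)
  note int = set_integral_diff[OF k set_integrable_pullback[OF v, of a "a + 1"]]
  have eq: "(LINT y:?D|lborel. k - v (S y)) = ball_vol * (k - mean a v)"
    using ball_vol_pos open_cyl_slab[of a "a + 1"]
    by (simp add: int(2) mean_def right_diff_distrib measure_unit_cyl_slab set_lebesgue_integral_def[of _ _ "\<lambda>_. k"])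
  have "ennreal (ball_vol\<^sup>2 * (k - mean a v)\<^sup>2) \<le> ennreal ball_vol * (\<integral>\<^sup>+q\<in>?D. ennreal ((k - v (S q))\<^sup>2) \<partial>lborel)"
    using power2_set_integral_le[OF int(1)] open_cyl_slab[of a "a + 1"]
    by (simp add: eq emeasure_unit_cyl_slab power_mult_distrib)
  then have "ennreal (1 / ball_vol\<^sup>2) * ennreal (ball_vol\<^sup>2 * (k - mean a v)\<^sup>2) \<le>
      ennreal (1 / ball_vol\<^sup>2) * (ennreal ball_vol * (\<integral>\<^sup>+q\<in>?D. ennreal ((k - v (S q))\<^sup>2) \<partial>lborel))"
    by (rule mult_left_mono) simp
  moreover have "ennreal (1 / ball_vol\<^sup>2) * ennreal (ball_vol\<^sup>2 * (k - mean a v)\<^sup>2) = ennreal ((k - mean a v)\<^sup>2)"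
    using ball_vol_pos by (simp flip: ennreal_mult')
  moreover have "ennreal (1 / ball_vol\<^sup>2) * ennreal ball_vol = ennreal (1 / ball_vol)"
    using ball_vol_pos by (simp flip: ennreal_mult' add: power2_eq_square)
  ultimately show ?thesis by (simp flip: mult.assoc)
qed

text \<open>The outer \<open>C0\<close> is the cost of moving the squared deviation into the
  cylinder, \<open>K\<^sup>2 * C0\<close> that of moving the gradient back. The middle factor comes
  from \<open>double_integral_increment_le\<close>, with 9 bounding the squared distance of two
  points. The volume from the double integral cancels the one in the mean.\<close>

definition CP :: real where "CP = C0 * (4 * (9 * 2 ^ DIM('a \<times> real))) * (K\<^sup>2 * C0)"

text \<open>In cylinder coordinates the deviation from the mean is an average of increments between
  two points of a convex set, and these are integrals of the gradient along segments. The nozzle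
  slab itself need not contain such segments.\<close>

lemma poincare_C1:
  assumes v: "C1_with_gradient v Dv"
  shows "(LINT x:slab \<Omega> a (a + 1)|lebesgue. (norm (v x - mean a v))\<^sup>2) \<le> CP * (LINT x:slab \<Omega> a (a + 1)|lebesgue. (norm (Dv x))\<^sup>2)"
proof -
  let ?D = "cyl_slab a (a + 1)" and ?U = "slab \<Omega> a (a + 1)"
  \<comment> \<open>\<open>?W\<close> and \<open>?H\<close> are cut off outside the cylinder only to
    be globally measurable; on \<open>?D\<close> they agree with the pulled-back function and
    gradient bound.\<close>
  let ?W = "\<lambda>y. indicator cylinder y *\<^sub>R v (S y)"
  let ?H = "\<lambda>y. ennreal (indicator cylinder y *\<^sub>R (K * norm (Dv (S y)))\<^sup>2)"
  let ?n = "DIM('a \<times> real)"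
  have [measurable]: "v \<in> borel_measurable borel"
    by (rule borel_measurable_continuous_onI[OF C1_with_gradientD(2)[OF v]])
  have D: "?D \<in> sets borel" using open_cyl_slab by auto
  have "(\<integral>\<^sup>+x\<in>?U. ennreal ((v x - mean a v)\<^sup>2) \<partial>lborel)
      \<le> ennreal C0 * (\<integral>\<^sup>+y\<in>?D. ennreal ((v (S y) - mean a v)\<^sup>2) \<partial>lborel)"
    by (rule nn_integral_slab_le) measurable
  also have "(\<integral>\<^sup>+y\<in>?D. ennreal ((v (S y) - mean a v)\<^sup>2) \<partial>lborel)
      \<le> ennreal (1 / ball_vol) * (\<integral>\<^sup>+p\<in>?D. (\<integral>\<^sup>+q\<in>?D. ennreal ((?W p - ?W q)\<^sup>2) \<partial>lborel) \<partial>lborel)"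
  proof -
    have W: "?W \<in> borel_measurable borel"
      using open_cylinder by (intro borel_measurable_continuous_on_indicator
        continuous_on_compose2[OF C1_with_gradientD(2)[OF v] S_cont]) auto
    have "(\<integral>\<^sup>+y\<in>?D. ennreal ((v (S y) - mean a v)\<^sup>2) \<partial>lborel) \<le>
      (\<integral>\<^sup>+p. ennreal (1 / ball_vol) * ((\<integral>\<^sup>+q\<in>?D. ennreal ((?W p - ?W q)\<^sup>2) \<partial>lborel) * indicator ?D p) \<partial>lborel)"
    proof (rule nn_integral_mono)
      fix p
      have "(\<integral>\<^sup>+q\<in>?D. ennreal ((v (S p) - v (S q))\<^sup>2) \<partial>lborel) = (\<integral>\<^sup>+q\<in>?D. ennreal ((?W p - ?W q)\<^sup>2) \<partial>lborel)" if "p \<in> ?D"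
        using that cyl_slab_subset by (intro nn_integral_cong) (auto simp: indicator_def)
      then show "ennreal ((v (S p) - mean a v)\<^sup>2) * indicator ?D p \<le>
          ennreal (1 / ball_vol) * ((\<integral>\<^sup>+q\<in>?D. ennreal ((?W p - ?W q)\<^sup>2) \<partial>lborel) * indicator ?D p)"
        using mean_le[OF v, of "v (S p)" a] by (cases "p \<in> ?D") auto
    qed
    also have "\<dots> = ennreal (1 / ball_vol) * (\<integral>\<^sup>+p\<in>?D. (\<integral>\<^sup>+q\<in>?D. ennreal ((?W p - ?W q)\<^sup>2) \<partial>lborel) \<partial>lborel)"
    proof (rule nn_integral_cmult)
      note [measurable] = D
      have "(\<lambda>p. (\<integral>\<^sup>+q\<in>?D. ennreal ((f p - f q)\<^sup>2) \<partial>lborel) * indicator ?D p) \<in> borel_measurable lborel"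
        if [measurable]: "f \<in> borel_measurable borel" for f :: "'a \<times> real \<Rightarrow> real"
        by measurable
      from this[OF W] show "(\<lambda>p. (\<integral>\<^sup>+q\<in>?D. ennreal ((?W p - ?W q)\<^sup>2) \<partial>lborel) * indicator ?D p) \<in> borel_measurable lborel" .
    qed
    finally show ?thesis .
  qed
  also have "(\<integral>\<^sup>+p\<in>?D. (\<integral>\<^sup>+q\<in>?D. ennreal ((?W p - ?W q)\<^sup>2) \<partial>lborel) \<partial>lborel)
    \<le> 4 * (9 * (2 ^ ?n * emeasure lborel ?D * (\<integral>\<^sup>+y\<in>?D. ?H y \<partial>lborel)))"
  proof (rule double_integral_increment_le[OF D convex_cyl_slab])
    show "?W \<in> borel_measurable borel"
      using open_cylinder by (intro borel_measurable_continuous_on_indicator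
        continuous_on_compose2[OF C1_with_gradientD(2)[OF v] S_cont]) auto
    have "(\<lambda>y. indicator cylinder y *\<^sub>R (K * norm (Dv (S y)))\<^sup>2) \<in> borel_measurable borel"
      using open_cylinder by (intro borel_measurable_continuous_on_indicator continuous_intros
        continuous_on_compose2[OF C1_with_gradientD(3)[OF v] S_cont]) auto
    then show "?H \<in> borel_measurable borel" by measurable
    fix p q assume pq: "p \<in> ?D" "q \<in> ?D"
    have line: "(1 - s) *\<^sub>R p + s *\<^sub>R q \<in> cylinder" if "s \<in> {0..1}" for s
      using convexD_alt[OF convex_cyl_slab pq, of s] that cyl_slab_subset by auto
    \<comment> \<open>Two points of the unit ball are at most 2 apart and the two heights differ by
      at most 1, hence the squared bound 9.\<close>
    have "norm (q - p) \<le> norm (fst (q - p)) + norm (snd (q - p))" by (metis norm_Pair_le prod.collapse)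
    also have "\<dots> \<le> 2 + 1"
    proof (rule add_mono)
      have "norm (fst (q - p)) \<le> norm (fst q) + norm (fst p)" by (simp add: norm_triangle_ineq4)
      then show "norm (fst (q - p)) \<le> 2" using pq by (auto simp: cyl_slab_def)
      show "norm (snd (q - p)) \<le> 1" using pq by (auto simp: cyl_slab_def)
    qed
    finally have d: "(norm (q - p))\<^sup>2 \<le> 9" using power_mono[of "norm (q - p)" 3 2] by simp
    have "ennreal ((?W q - ?W ((1/2) *\<^sub>R p + (1/2) *\<^sub>R q))\<^sup>2)
       = ennreal ((v (S ((1 - 1) *\<^sub>R p + 1 *\<^sub>R q)) - v (S ((1 - 1/2) *\<^sub>R p + (1/2) *\<^sub>R q)))\<^sup>2)"
      using line[of 1] line[of "1/2"] by simp
    also have "\<dots> \<le> ennreal (1 - 1/2) * (\<integral>\<^sup>+s\<in>{1/2<..<1}. ennreal ((K * norm (Dv (S ((1 - s) *\<^sub>R p + s *\<^sub>R q))) * norm (q - p))\<^sup>2) \<partial>lborel)"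
      using line by (intro pullback_increment_le[OF v]) auto
    also have "\<dots> \<le> ennreal 1 * (\<integral>\<^sup>+s. 9 * (?H ((1 - s) *\<^sub>R p + s *\<^sub>R q) * indicator {1/2<..<1} s) \<partial>lborel)"
    proof (rule mult_mono[OF ennreal_leI nn_integral_mono])
      fix s :: real
      show "ennreal ((K * norm (Dv (S ((1 - s) *\<^sub>R p + s *\<^sub>R q))) * norm (q - p))\<^sup>2) * indicator {1/2<..<1} s
        \<le> 9 * (?H ((1 - s) *\<^sub>R p + s *\<^sub>R q) * indicator {1/2<..<1} s)"
      proof (cases "s \<in> {1/2<..<1}")
        case True
        have "(K * norm (Dv (S ((1 - s) *\<^sub>R p + s *\<^sub>R q))) * norm (q - p))\<^sup>2 \<le> 9 * (K * norm (Dv (S ((1 - s) *\<^sub>R p + s *\<^sub>R q))))\<^sup>2"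
          unfolding power_mult_distrib[of _ "norm (q - p)"] using d by (metis mult.commute mult_left_mono zero_le_power2)
        then have "ennreal ((K * norm (Dv (S ((1 - s) *\<^sub>R p + s *\<^sub>R q))) * norm (q - p))\<^sup>2) \<le> ennreal (9 * (K * norm (Dv (S ((1 - s) *\<^sub>R p + s *\<^sub>R q))))\<^sup>2)"
          by (rule ennreal_leI)
        then show ?thesis using True line[of s] by (simp add: ennreal_mult)
      qed simp
    qed auto
    also have "\<dots> = 9 * (\<integral>\<^sup>+s\<in>{1/2<..<1}. ?H ((1 - s) *\<^sub>R p + s *\<^sub>R q) \<partial>lborel)"
    proof -
      have "(\<lambda>s. f ((1 - s) *\<^sub>R p + s *\<^sub>R q) * indicator {1/2<..<1} s) \<in> borel_measurable lborel"
        if [measurable]: "f \<in> borel_measurable borel" for f :: "'a \<times> real \<Rightarrow> ennreal"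
        by measurable
      from nn_integral_cmult[OF this[OF \<open>?H \<in> borel_measurable borel\<close>]] show ?thesis by (simp only: ennreal_1 mult_1_left)
    qed
    finally show "ennreal ((?W q - ?W ((1/2) *\<^sub>R p + (1/2) *\<^sub>R q))\<^sup>2) \<le> 9 * (\<integral>\<^sup>+s\<in>{1/2<..<1}. ?H ((1 - s) *\<^sub>R p + s *\<^sub>R q) \<partial>lborel)" .
  qed
  also have "(\<integral>\<^sup>+y\<in>?D. ?H y \<partial>lborel) = (\<integral>\<^sup>+y\<in>?D. ennreal ((K * norm (Dv (S y)))\<^sup>2) \<partial>lborel)"
    using cyl_slab_subset by (intro nn_integral_cong) (auto simp: indicator_def)
  also have "\<dots> \<le> ennreal (K\<^sup>2 * C0) * (\<integral>\<^sup>+x\<in>?U. ennreal ((norm (Dv x))\<^sup>2) \<partial>lborel)"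
    by (rule nn_integral_grad2_le[OF v])
  also have "(\<integral>\<^sup>+x\<in>?U. ennreal ((norm (Dv x))\<^sup>2) \<partial>lborel) = ennreal (LINT x:?U|lebesgue. (norm (Dv x))\<^sup>2)"
    by (rule nn_integral_power2_L2[OF L2_slab_continuous[OF C1_with_gradientD(3)[OF v]]])
  also have "(\<integral>\<^sup>+x\<in>?U. ennreal ((v x - mean a v)\<^sup>2) \<partial>lborel) = ennreal (LINT x:?U|lebesgue. (norm (v x - mean a v))\<^sup>2)"
    using nn_integral_power2_L2[OF L2_slab_continuous, of "\<lambda>x. v x - mean a v"]
    by (simp add: C1_with_gradientD(2)[OF v] continuous_on_diff)
  finally have "ennreal (LINT x:?U|lebesgue. (norm (v x - mean a v))\<^sup>2) \<le>
     ennreal C0 * (ennreal (1 / ball_vol) * (4 * (9 * (2 ^ ?n * ennreal ball_vol *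
        (ennreal (K\<^sup>2 * C0) * ennreal (LINT x:?U|lebesgue. (norm (Dv x))\<^sup>2))))))"
    by (simp add: emeasure_unit_cyl_slab mult_left_mono)
  also have "\<dots> = ennreal (C0 * ((1 / ball_vol) * (4 * (9 * (2 ^ ?n * ball_vol *
        ((K\<^sup>2 * C0) * (LINT x:?U|lebesgue. (norm (Dv x))\<^sup>2)))))))"
  proof -
    have step: "ennreal c0 * (ennreal c1 * (4 * (9 * (2 ^ ?n * ennreal c2 * (ennreal c3 * ennreal c4))))) =
        ennreal (c0 * (c1 * (4 * (9 * (2 ^ ?n * c2 * (c3 * c4))))))"
      if "0 \<le> c0" "0 \<le> c1" "0 \<le> c2" "0 \<le> c3" "0 \<le> c4" for c0 c1 c2 c3 c4
      using that by (simp add: ennreal_mult ennreal_power[symmetric] mult.assoc)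
    show ?thesis
      by (rule step) (use C0_pos ball_vol_pos in \<open>auto intro: set_integral_nonneg_lebesgue\<close>)
  qed
  also have "C0 * ((1 / ball_vol) * (4 * (9 * (2 ^ ?n * ball_vol *
        ((K\<^sup>2 * C0) * (LINT x:?U|lebesgue. (norm (Dv x))\<^sup>2)))))) = CP * (LINT x:?U|lebesgue. (norm (Dv x))\<^sup>2)"
    using ball_vol_pos by (simp add: CP_def)
  finally show ?thesis
    using C0_pos set_integral_nonneg_lebesgue[of "\<lambda>x. (norm (Dv x))\<^sup>2" ?U]
    by (subst (asm) ennreal_le_iff) (auto simp: CP_def)
qed

definition CD :: real where "CD = K\<^sup>2 * C0 / ball_vol"

text \<open>The second slab is an axial translate of the first in cylinder coordinates, so the
  difference of the means is an average of increments along axial segments of length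
  \<open>b - a\<close>. By Cauchy-Schwarz its square grows only linearly in \<open>b - a\<close>,
  which the iteration can afford.\<close>

lemma mean_increment_C1:
  assumes v: "C1_with_gradient v Dv" and ab: "a \<le> b"
  shows "(mean b v - mean a v)\<^sup>2 \<le> CD * (b - a) * (LINT x:slab \<Omega> a (b + 1)|lebesgue. (norm (Dv x))\<^sup>2)"
proof -
  let ?D = "cyl_slab a (a + 1)" and ?U = "slab \<Omega> a (b + 1)" and ?l = "b - a"
  have [measurable]: "v \<in> borel_measurable borel" "Dv \<in> borel_measurable borel"
    by (auto intro!: borel_measurable_continuous_onI C1_with_gradientD[OF v])
  \<comment> \<open>Translation by \<open>b - a\<close> along the axis maps one unit piece of the
    cylinder onto the other and preserves Lebesgue measure, so both means become integrals over the
    same set.\<close>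
  let ?sh = "\<lambda>y. y + (0::'a, ?l)"
  have shD: "?sh y \<in> cyl_slab b (b + 1) \<longleftrightarrow> y \<in> ?D" for y
    by (cases y) (auto simp: cyl_slab_def)
  have sh: "set_integrable lborel ?D (\<lambda>y. v (S (?sh y)))"
      "(LINT y:?D|lborel. v (S (?sh y))) = (LINT y:cyl_slab b (b + 1)|lborel. v (S y))"
  proof -
    have fun_eq: "?sh = (+) (0, ?l)" by (rule ext) (rule add.commute)
    have d: "distr lborel borel ?sh = lborel" unfolding fun_eq by (rule lborel_distr_plus)
    let ?f = "\<lambda>y. indicator (cyl_slab b (b + 1)) y *\<^sub>R v (S y)"
    have int: "integrable lborel ?f"
      using set_integrable_pullback[OF v] by (simp add: set_integrable_def)
    have comp: "?f (?sh y) = indicator ?D y *\<^sub>R v (S (?sh y))" for y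
      using shD[of y] by (simp add: indicator_def)
    have "integrable lborel (\<lambda>y. ?f (?sh y))"
      using int by (subst (asm) d[symmetric], subst (asm) integrable_distr_eq) auto
    then show "set_integrable lborel ?D (\<lambda>y. v (S (?sh y)))"
      unfolding comp set_integrable_def .
    have "(\<integral>y. ?f (?sh y) \<partial>lborel) = (\<integral>y. ?f y \<partial>lborel)"
      using int by (subst (2) d[symmetric], subst integral_distr) auto
    then show "(LINT y:?D|lborel. v (S (?sh y))) = (LINT y:cyl_slab b (b + 1)|lborel. v (S y))"
      unfolding comp set_lebesgue_integral_def .
  qed
  note int = set_integral_diff[OF sh(1) set_integrable_pullback[OF v]]
  have eq: "(LINT y:?D|lborel. v (S (?sh y)) - v (S y)) = ball_vol * (mean b v - mean a v)"
    using ball_vol_pos by (simp add: int(2) sh(2) mean_def right_diff_distrib)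
  have "ennreal ((ball_vol * (mean b v - mean a v))\<^sup>2) \<le> ennreal ball_vol * (\<integral>\<^sup>+y\<in>?D. ennreal ((v (S (?sh y)) - v (S y))\<^sup>2) \<partial>lborel)"
    using power2_set_integral_le[OF int(1)] open_cyl_slab[of a "a + 1"] unfolding eq
    by (simp add: emeasure_unit_cyl_slab)
  also have "(\<integral>\<^sup>+y\<in>?D. ennreal ((v (S (?sh y)) - v (S y))\<^sup>2) \<partial>lborel)
      \<le> ennreal ?l * (\<integral>\<^sup>+y\<in>cyl_slab a (b + 1). ennreal ((K * norm (Dv (S y)))\<^sup>2) \<partial>lborel)"
  proof -
    let ?h = "\<lambda>y. ennreal ((K * norm (Dv (S y)))\<^sup>2) * indicator (cyl_slab a (b + 1)) y"
    have h: "?h \<in> borel_measurable borel"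
    proof -
      have "(\<lambda>x. ennreal ((K * norm (Dv x))\<^sup>2)) \<in> borel_measurable borel" by measurable
      from borel_measurable_S_indicator[OF this _ cyl_slab_subset] show ?thesis using open_cyl_slab by auto
    qed
    \<comment> \<open>The gradient bound integrated over the whole axial line through
      \<open>y'\<close> between heights \<open>a\<close> and \<open>b + 1\<close>. It dominates the
      segment from any starting height \<open>t\<close>, and integrating over \<open>t\<close> then
      costs only the length 1.\<close>
    define J where "J y' = (\<integral>\<^sup>+r. ?h (y', r) \<partial>lborel)" for y'
    have J: "J \<in> borel_measurable borel"
      unfolding J_def using h by measurable
    have pt: "ennreal ((v (S (?sh (y', t))) - v (S (y', t)))\<^sup>2) * indicator ?D (y', t)
        \<le> ennreal ?l * J y' * indicator {a<..<a+1} t" for y' t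
    proof (cases "(y', t) \<in> ?D")
      case True
      then have y': "y' \<in> ball 0 1" and t: "a < t" "t < a + 1" by (auto simp: cyl_slab_def)
      have "ennreal ((v (S (y', t + ?l)) - v (S (y', t)))\<^sup>2)
         \<le> ennreal (t + ?l - t) * (\<integral>\<^sup>+r\<in>{t<..<t + ?l}. ennreal ((K * norm (Dv (S (y', r))))\<^sup>2) \<partial>lborel)"
        by (rule pullback_axial_increment_le[OF v _ y']) (use ab in auto)
      also have "\<dots> \<le> ennreal (t + ?l - t) * J y'"
        unfolding J_def
        by (intro mult_left_mono nn_integral_mono) (use y' t ab in \<open>auto simp: indicator_def cyl_slab_def\<close>)
      finally show ?thesis using True t by simp
    qed simp
    have "(\<integral>\<^sup>+y\<in>?D. ennreal ((v (S (?sh y)) - v (S y))\<^sup>2) \<partial>lborel)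
        = (\<integral>\<^sup>+y'. (\<integral>\<^sup>+t. ennreal ((v (S (?sh (y', t))) - v (S (y', t)))\<^sup>2) * indicator ?D (y', t) \<partial>lborel) \<partial>lborel)"
    proof (rule nn_integral_lborel_Pair)
      have "(\<lambda>y. ennreal ((indicator ?D y *\<^sub>R v (S (?sh y)) - indicator ?D y *\<^sub>R v (S y))\<^sup>2)) \<in> borel_measurable borel"
        using borel_measurable_integrable[OF sh(1)[unfolded set_integrable_def]]
          borel_measurable_integrable[OF set_integrable_pullback[OF v, unfolded set_integrable_def], of a "a + 1"]
        by measurable
      also have "(\<lambda>y. ennreal ((indicator ?D y *\<^sub>R v (S (?sh y)) - indicator ?D y *\<^sub>R v (S y))\<^sup>2))
          = (\<lambda>y. ennreal ((v (S (?sh y)) - v (S y))\<^sup>2) * indicator ?D y)"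
        by (rule ext) (simp add: indicator_def)
      finally show "(\<lambda>y. ennreal ((v (S (?sh y)) - v (S y))\<^sup>2) * indicator ?D y) \<in> borel_measurable borel" .
    qed
    also have "\<dots> \<le> (\<integral>\<^sup>+y'. (\<integral>\<^sup>+t. ennreal ?l * J y' * indicator {a<..<a+1} t \<partial>lborel) \<partial>lborel)"
      by (intro nn_integral_mono pt)
    also have "\<dots> = (\<integral>\<^sup>+y'. ennreal ?l * J y' \<partial>lborel)"
      by (simp add: nn_integral_cmult_indicator)
    also have "\<dots> = ennreal ?l * (\<integral>\<^sup>+y'. J y' \<partial>lborel)"
      using J by (intro nn_integral_cmult) simp
    also have "(\<integral>\<^sup>+y'. J y' \<partial>lborel) = (\<integral>\<^sup>+y. ?h y \<partial>lborel)"
      unfolding J_def by (rule nn_integral_lborel_Pair[OF h, symmetric])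
    finally show ?thesis .
  qed
  also have "(\<integral>\<^sup>+y\<in>cyl_slab a (b + 1). ennreal ((K * norm (Dv (S y)))\<^sup>2) \<partial>lborel)
      \<le> ennreal (K\<^sup>2 * C0) * (\<integral>\<^sup>+x\<in>?U. ennreal ((norm (Dv x))\<^sup>2) \<partial>lborel)"
    by (rule nn_integral_grad2_le[OF v])
  also have "(\<integral>\<^sup>+x\<in>?U. ennreal ((norm (Dv x))\<^sup>2) \<partial>lborel) = ennreal (LINT x:?U|lebesgue. (norm (Dv x))\<^sup>2)"
    by (rule nn_integral_power2_L2[OF L2_slab_continuous[OF C1_with_gradientD(3)[OF v]]])
  finally have "ennreal ((ball_vol * (mean b v - mean a v))\<^sup>2) \<le>
      ennreal ball_vol * (ennreal ?l * (ennreal (K\<^sup>2 * C0) * ennreal (LINT x:?U|lebesgue. (norm (Dv x))\<^sup>2)))"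
    by (simp add: mult_left_mono)
  also have "\<dots> = ennreal (ball_vol * (?l * ((K\<^sup>2 * C0) * (LINT x:?U|lebesgue. (norm (Dv x))\<^sup>2))))"
    using C0_pos ball_vol_pos ab set_integral_nonneg_lebesgue[of "\<lambda>x. (norm (Dv x))\<^sup>2" ?U]
    by (simp add: ennreal_mult)
  finally have "(ball_vol * (mean b v - mean a v))\<^sup>2 \<le> ball_vol * (?l * ((K\<^sup>2 * C0) * (LINT x:?U|lebesgue. (norm (Dv x))\<^sup>2)))"
    using C0_pos ball_vol_pos ab set_integral_nonneg_lebesgue[of "\<lambda>x. (norm (Dv x))\<^sup>2" ?U]
    by (subst (asm) ennreal_le_iff) auto
  then have "ball_vol * (ball_vol * (mean b v - mean a v)\<^sup>2) \<le> ball_vol * (?l * ((K\<^sup>2 * C0) * (LINT x:?U|lebesgue. (norm (Dv x))\<^sup>2)))"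
    by (simp add: power_mult_distrib power2_eq_square[of ball_vol] mult.assoc)
  then have "ball_vol * (mean b v - mean a v)\<^sup>2 \<le> ?l * ((K\<^sup>2 * C0) * (LINT x:?U|lebesgue. (norm (Dv x))\<^sup>2))"
    using ball_vol_pos by (simp only: mult_le_cancel_left_pos)
  then have "(mean b v - mean a v)\<^sup>2 \<le> ?l * ((K\<^sup>2 * C0) * (LINT x:?U|lebesgue. (norm (Dv x))\<^sup>2)) / ball_vol"
    using ball_vol_pos by (simp only: pos_le_divide_eq mult.commute)
  then show ?thesis by (simp add: CD_def mult_ac)
qed

text \<open>The sum of the separate factors of the bottom trace and of the gradient in the
  computation below, so that a single constant serves both.\<close>

definition CT :: real where "CT = C1 * (2 * C1) + C1 * (4 * (K\<^sup>2 * C0))"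

text \<open>An axial segment of length \<open>2 * L\<close> in cylinder coordinates joins each point
  of the top face to the bottom face. Squaring the increment along it and integrating over the ball
  gives the factor \<open>L\<close> in front of the energy.\<close>

lemma trace_C1:
  assumes v: "C1_with_gradient v Dv" and L: "0 < L"
  shows "(LINT x:cross_section \<Omega> L|lebesgue. (norm (v (x, L)))\<^sup>2) \<le>
    CT * ((LINT x:cross_section \<Omega> (-L)|lebesgue. (norm (v (x, -L)))\<^sup>2) + L * (LINT x:truncation \<Omega> L|lebesgue. (norm (Dv x))\<^sup>2))"
proof -
  let ?U = "slab \<Omega> (-L) L"
  have [measurable]: "v \<in> borel_measurable borel" "Dv \<in> borel_measurable borel"
    by (auto intro!: borel_measurable_continuous_onI C1_with_gradientD[OF v])
  have L2: "(\<lambda>x. v (x, t)) \<in> L2 (cross_section \<Omega> t)" for t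
    using open_cross_section[of t] bounded_cross_section
    by (intro L2_continuous continuous_on_compose2[OF C1_with_gradientD(2)[OF v]] continuous_intros) auto
  let ?h = "\<lambda>y. ennreal ((K * norm (Dv (S y)))\<^sup>2) * indicator (cyl_slab (-L) L) y"
  have h: "?h \<in> borel_measurable borel"
  proof -
    have "(\<lambda>x. ennreal ((K * norm (Dv x))\<^sup>2)) \<in> borel_measurable borel" by measurable
    from borel_measurable_S_indicator[OF this _ cyl_slab_subset] show ?thesis using open_cyl_slab by auto
  qed
  define J where "J y' = (\<integral>\<^sup>+r. ?h (y', r) \<partial>lborel)" for y'
  have J: "J \<in> borel_measurable borel"
    unfolding J_def using h by measurable
  let ?b = "\<lambda>y. ennreal ((v (S (y, -L)))\<^sup>2) * indicator (ball 0 1) y"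
  have b: "?b \<in> borel_measurable borel"
  proof -
    have "(\<lambda>x. ennreal ((v x)\<^sup>2)) \<in> borel_measurable borel" by measurable
    from borel_measurable_S_indicator[OF this _ order_refl] open_cylinder
    have [measurable]: "(\<lambda>y. ennreal ((v (S y))\<^sup>2) * indicator cylinder y) \<in> borel_measurable borel" by auto
    have "(\<lambda>y. (\<lambda>y. ennreal ((v (S y))\<^sup>2) * indicator cylinder y) (y, -L)) \<in> borel_measurable borel" by measurable
    also have "(\<lambda>y. (\<lambda>y. ennreal ((v (S y))\<^sup>2) * indicator cylinder y) (y, -L)) = ?b"
      by (auto simp: mem_cylinder indicator_def)
    finally show ?thesis .
  qed
  have "(\<integral>\<^sup>+x\<in>cross_section \<Omega> L. ennreal ((v (x, L))\<^sup>2) \<partial>lborel) \<le> ennreal C1 * (\<integral>\<^sup>+y\<in>ball 0 1. ennreal ((v (S (y, L)))\<^sup>2) \<partial>lborel)"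
    by (rule nn_integral_cross_section_le) measurable
  also have "(\<integral>\<^sup>+y\<in>ball 0 1. ennreal ((v (S (y, L)))\<^sup>2) \<partial>lborel) \<le> (\<integral>\<^sup>+y. ennreal 2 * ?b y + ennreal (4 * L) * J y \<partial>lborel)"
  proof (rule nn_integral_mono)
    fix y
    show "ennreal ((v (S (y, L)))\<^sup>2) * indicator (ball 0 1) y \<le> ennreal 2 * ?b y + ennreal (4 * L) * J y"
    proof (cases "y \<in> ball 0 1")
      case True
      have "(v (S (y, L)))\<^sup>2 \<le> 2 * (v (S (y, -L)))\<^sup>2 + 2 * (v (S (y, L)) - v (S (y, -L)))\<^sup>2"
        using norm_add_power2_le[of "v (S (y, -L))" "v (S (y, L)) - v (S (y, -L))"] by simp
      then have "ennreal ((v (S (y, L)))\<^sup>2) \<le> ennreal (2 * (v (S (y, -L)))\<^sup>2 + 2 * (v (S (y, L)) - v (S (y, -L)))\<^sup>2)"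
        by (rule ennreal_leI)
      also have "\<dots> = ennreal 2 * ennreal ((v (S (y, -L)))\<^sup>2) + ennreal 2 * ennreal ((v (S (y, L)) - v (S (y, -L)))\<^sup>2)"
        by (simp add: ennreal_mult)
      also have "ennreal ((v (S (y, L)) - v (S (y, -L)))\<^sup>2) \<le>
          ennreal (L - (- L)) * (\<integral>\<^sup>+r\<in>{-L<..<L}. ennreal ((K * norm (Dv (S (y, r))))\<^sup>2) \<partial>lborel)"
        by (rule pullback_axial_increment_le[OF v _ True]) (use L in auto)
      also have "\<dots> = ennreal (2 * L) * J y"
        unfolding J_def using True
        by (intro arg_cong2[where f="(*)"] nn_integral_cong) (auto simp: indicator_def cyl_slab_def)
      finally show ?thesis
        using True L by (simp add: mult_left_mono add_left_mono mult.assoc[symmetric] ennreal_mult[symmetric] ennreal_numeral[symmetric] del: ennreal_numeral)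
    qed simp
  qed
  also have "\<dots> = ennreal 2 * (\<integral>\<^sup>+y. ?b y \<partial>lborel) + ennreal (4 * L) * (\<integral>\<^sup>+y. J y \<partial>lborel)"
    using b J by (subst nn_integral_add; (subst nn_integral_cmult)?; (subst nn_integral_cmult)?; simp)
  also have "(\<integral>\<^sup>+y. J y \<partial>lborel) = (\<integral>\<^sup>+y. ?h y \<partial>lborel)"
    unfolding J_def by (rule nn_integral_lborel_Pair[OF h, symmetric])
  also have "\<dots> \<le> ennreal (K\<^sup>2 * C0) * (\<integral>\<^sup>+x\<in>?U. ennreal ((norm (Dv x))\<^sup>2) \<partial>lborel)"
    by (rule nn_integral_grad2_le[OF v])
  also have "(\<integral>\<^sup>+y. ?b y \<partial>lborel) \<le> ennreal C1 * (\<integral>\<^sup>+x\<in>cross_section \<Omega> (-L). ennreal ((v (x, -L))\<^sup>2) \<partial>lborel)"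
    by (rule nn_integral_ball_slice_le) measurable
  also have "(\<integral>\<^sup>+x\<in>cross_section \<Omega> (-L). ennreal ((v (x, -L))\<^sup>2) \<partial>lborel) = ennreal (LINT x:cross_section \<Omega> (-L)|lebesgue. (norm (v (x, -L)))\<^sup>2)"
    using nn_integral_power2_L2[OF L2[of "-L"]] by simp
  also have "(\<integral>\<^sup>+x\<in>cross_section \<Omega> L. ennreal ((v (x, L))\<^sup>2) \<partial>lborel) = ennreal (LINT x:cross_section \<Omega> L|lebesgue. (norm (v (x, L)))\<^sup>2)"
    using nn_integral_power2_L2[OF L2[of L]] by simp
  also have "(\<integral>\<^sup>+x\<in>?U. ennreal ((norm (Dv x))\<^sup>2) \<partial>lborel) = ennreal (LINT x:?U|lebesgue. (norm (Dv x))\<^sup>2)"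
    by (rule nn_integral_power2_L2[OF L2_slab_continuous[OF C1_with_gradientD(3)[OF v]]])
  finally have le: "ennreal (LINT x:cross_section \<Omega> L|lebesgue. (norm (v (x, L)))\<^sup>2) \<le>
    ennreal C1 * (ennreal 2 * (ennreal C1 * ennreal (LINT x:cross_section \<Omega> (-L)|lebesgue. (norm (v (x, -L)))\<^sup>2))
      + ennreal (4 * L) * (ennreal (K\<^sup>2 * C0) * ennreal (LINT x:?U|lebesgue. (norm (Dv x))\<^sup>2)))"
    by (simp add: mult_left_mono add_mono)
  define P Q where "P = (LINT x:cross_section \<Omega> (-L)|lebesgue. (norm (v (x, -L)))\<^sup>2)"
    and "Q = (LINT x:?U|lebesgue. (norm (Dv x))\<^sup>2)"
  have PQ: "0 \<le> P" "0 \<le> Q" unfolding P_def Q_def by (auto intro: set_integral_nonneg_lebesgue)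
  have "ennreal C1 * (ennreal 2 * (ennreal C1 * ennreal P) + ennreal (4 * L) * (ennreal (K\<^sup>2 * C0) * ennreal Q))
    = ennreal (C1 * (2 * (C1 * P) + (4 * L) * ((K\<^sup>2 * C0) * Q)))"
    using PQ C0_pos C1_pos L by (simp add: ennreal_mult del: ennreal_numeral)
  with le have "ennreal (LINT x:cross_section \<Omega> L|lebesgue. (norm (v (x, L)))\<^sup>2) \<le>
      ennreal (C1 * (2 * (C1 * P) + (4 * L) * ((K\<^sup>2 * C0) * Q)))"
    by (simp only: P_def Q_def)
  then have "(LINT x:cross_section \<Omega> L|lebesgue. (norm (v (x, L)))\<^sup>2) \<le> C1 * (2 * (C1 * P) + (4 * L) * ((K\<^sup>2 * C0) * Q))"
    using PQ C0_pos C1_pos L by (subst (asm) ennreal_le_iff) auto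
  also have "\<dots> \<le> CT * (P + L * Q)"
  proof -
    have "CT * (P + L * Q) = C1 * (2 * (C1 * P) + (4 * L) * ((K\<^sup>2 * C0) * Q)) + C1 * (4 * (K\<^sup>2 * C0)) * P + C1 * (2 * C1) * (L * Q)"
      by (simp add: CT_def algebra_simps)
    moreover have "0 \<le> C1 * (4 * (K\<^sup>2 * C0)) * P" "0 \<le> C1 * (2 * C1) * (L * Q)"
      using PQ C0_pos C1_pos L by auto
    ultimately show ?thesis by linarith
  qed
  finally show ?thesis unfolding P_def Q_def truncation_eq_slab .
qed

end

subsection \<open>Cut-off functions\<close>

lemma has_real_derivative_max_power2: "((\<lambda>t. (max 0 t)\<^sup>2) has_real_derivative 2 * max 0 t) (at t)"
proof -
  consider "t < 0" | "t = 0" | "0 < t" by linarith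
  then show ?thesis
  proof cases
    case 1
    have "((\<lambda>_. 0) has_real_derivative 0) (at t)" by simp
    then have "((\<lambda>t. (max 0 t)\<^sup>2) has_real_derivative 0) (at t)"
      by (rule has_field_derivative_transform_within_open[where S = "{..<0}"]) (use 1 in auto)
    then show ?thesis using 1 by simp
  next
    case 2
    have "((\<lambda>h::real. max 0 h) \<longlongrightarrow> max 0 0) (at 0)" by (intro tendsto_intros)
    then have lim: "((\<lambda>h::real. max 0 h) \<longlongrightarrow> 0) (at 0)" by simp
    have "((\<lambda>h. max 0 h * (max 0 h / h)) \<longlongrightarrow> 0) (at (0::real))"
      by (rule Lim_null_comparison[OF _ lim]) (auto simp: max_def)
    then show ?thesis using 2 by (simp add: has_field_derivative_iff power2_eq_square)
  next
    case 3
    have "((\<lambda>t. t\<^sup>2) has_real_derivative 2 * t) (at t)" by (auto intro!: derivative_eq_intros)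
    then have "((\<lambda>t. (max 0 t)\<^sup>2) has_real_derivative 2 * t) (at t)"
      by (rule has_field_derivative_transform_within_open[where S = "{0<..}"]) (use 3 in auto)
    then show ?thesis using 3 by simp
  qed
qed

text \<open>The quadratic spline that rises from 0 to 1 on \<open>[0, 1]\<close>.\<close>

definition ramp :: "real \<Rightarrow> real" where
  "ramp t = 2 * ((max 0 t)\<^sup>2 - 2 * (max 0 (t - 1/2))\<^sup>2 + (max 0 (t - 1))\<^sup>2)"

definition ramp' :: "real \<Rightarrow> real" where
  "ramp' t = 4 * (max 0 t - 2 * max 0 (t - 1/2) + max 0 (t - 1))"

lemma ramp_deriv: "(ramp has_real_derivative ramp' t) (at t)"
proof -
  have *: "((\<lambda>t. (max 0 (t - c))\<^sup>2) has_real_derivative 2 * max 0 (t - c)) (at t)" for c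
  proof -
    have "((\<lambda>t. t - c) has_real_derivative 1) (at t)" by (auto intro!: derivative_eq_intros)
    from DERIV_chain2[OF has_real_derivative_max_power2[of "t - c"] this] show ?thesis by simp
  qed
  show ?thesis
    unfolding ramp_def[abs_def] ramp'_def
    using DERIV_cmult[OF DERIV_add[OF DERIV_diff[OF *[of 0] DERIV_cmult[OF *[of "1/2"], of 2]] *[of 1]], of 2]
    by (simp add: algebra_simps)
qed

lemma ramp_le_0: "t \<le> 0 \<Longrightarrow> ramp t = 0" and ramp'_le_0: "t \<le> 0 \<Longrightarrow> ramp' t = 0"
  by (simp_all add: ramp_def ramp'_def)

lemma ramp_ge_1: "1 \<le> t \<Longrightarrow> ramp t = 1" and ramp'_ge_1: "1 \<le> t \<Longrightarrow> ramp' t = 0"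
  by (simp_all add: ramp_def ramp'_def power2_eq_square algebra_simps)

lemma ramp'_bounds: "0 \<le> ramp' t" "ramp' t \<le> 2"
  by (auto simp: ramp'_def max_def)

lemma ramp_bounds: "0 \<le> ramp t" "ramp t \<le> 1"
proof -
  have mono: "ramp s \<le> ramp t" if "s \<le> t" for s t
    by (rule DERIV_nonneg_imp_nondecreasing[OF that]) (use ramp_deriv ramp'_bounds in blast)
  show "0 \<le> ramp t" using mono[of "min 0 t" t] ramp_le_0[of "min 0 t"] by simp
  show "ramp t \<le> 1" using mono[of t "max 1 t"] ramp_ge_1[of "max 1 t"] by simp
qed

lemma C1_with_gradient_axial:
  fixes f f' :: "real \<Rightarrow> real"
  assumes f: "\<And>t. (f has_real_derivative f' t) (at t)" and f': "continuous_on UNIV f'"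
  shows "C1_with_gradient (\<lambda>x::'a::euclidean_space \<times> real. f (snd x)) (\<lambda>x. (0, f' (snd x)))"
  unfolding C1_with_gradient_def gderiv_def
proof
  show "\<forall>x::'a \<times> real. ((\<lambda>x. f (snd x)) has_derivative (\<lambda>h. h \<bullet> (0, f' (snd x)))) (at x)"
  proof
    fix x :: "'a \<times> real"
    have "((\<lambda>x. f (snd x)) has_derivative (\<lambda>h. f' (snd x) * snd h)) (at x)"
      by (rule has_derivative_compose[OF has_derivative_snd[OF has_derivative_ident] f[unfolded has_field_derivative_def]])
    then show "((\<lambda>x. f (snd x)) has_derivative (\<lambda>h. h \<bullet> (0, f' (snd x)))) (at x)"
      by (simp add: inner_prod_def mult.commute)
  qed
  show "continuous_on UNIV (\<lambda>x::'a \<times> real. (0::'a, f' (snd x)))"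
    by (intro continuous_intros continuous_on_compose2[OF f']) auto
qed

lemma ramp'_cont: "continuous_on UNIV (\<lambda>t. c1 * ramp' (t - s1) + c2 * ramp' (t - s2))"
  unfolding ramp'_def by (intro continuous_intros)

lemma ramp_comb_deriv: "((\<lambda>t. c1 * ramp (t - s1) + c2 * ramp (t - s2)) has_real_derivative c1 * ramp' (t - s1) + c2 * ramp' (t - s2)) (at t)"
proof -
  have "((\<lambda>t. ramp (t - s)) has_real_derivative ramp' (t - s)) (at t)" for s
  proof -
    have "((\<lambda>t. t - s) has_real_derivative 1) (at t)" by (auto intro!: derivative_eq_intros)
    from DERIV_chain2[OF ramp_deriv[of "t - s"] this] show ?thesis by simp
  qed
  then show ?thesis by (auto intro!: derivative_eq_intros)
qed

subsection \<open>Approximation by continuously differentiable functions\<close>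

text \<open>The part of \<open>has_trace\<close> that does not mention a boundary piece: one
  approximating sequence can then serve both faces as well as the interior estimates.\<close>

definition C1_approximation ::
  "'b::euclidean_space set \<Rightarrow> ('b \<Rightarrow> real) \<Rightarrow> ('b \<Rightarrow> 'b) \<Rightarrow> (nat \<Rightarrow> 'b \<Rightarrow> real) \<Rightarrow> (nat \<Rightarrow> 'b \<Rightarrow> 'b) \<Rightarrow> bool" where
  "C1_approximation U u G v Dv \<longleftrightarrow> has_weak_gradient U u G \<and> (\<forall>k. C1_with_gradient (v k) (Dv k)) \<and>
     L2_tendsto U v u \<and> L2_tendsto U Dv G"

lemma has_traceI:
  assumes "C1_approximation U u G v Dv" "L2_tendsto A (\<lambda>k x'. v k (x', t)) g"
  shows "has_trace U A t u g"
  using assms unfolding has_trace_def C1_approximation_def by blast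

lemma C1_with_gradient_cmult:
  assumes "C1_with_gradient f Df"
  shows "C1_with_gradient (\<lambda>x. c * f x) (\<lambda>x. c *\<^sub>R Df x)"
proof -
  have "C1_with_gradient (\<lambda>x. c) (\<lambda>x. 0)" by (simp add: C1_with_gradient_def GDERIV_const)
  from C1_with_gradient_mult[OF this assms] show ?thesis by simp
qed

lemma C1_with_gradient_diff:
  assumes "C1_with_gradient f Df" "C1_with_gradient g Dg"
  shows "C1_with_gradient (\<lambda>x. f x - g x) (\<lambda>x. Df x - Dg x)"
  using C1_with_gradient_add[OF assms(1) C1_with_gradient_cmult[OF assms(2), of "-1"]] by simp

lemma L2_tendsto_pair_le:
  fixes F :: "nat \<Rightarrow> 'b::euclidean_space \<Rightarrow> 'c::euclidean_space"
  assumes "L2_tendsto U F f"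
  shows "(LINT x:U|lebesgue. (norm (F j x - F k x))\<^sup>2) \<le>
     2 * (LINT x:U|lebesgue. (norm (F j x - f x))\<^sup>2) + 2 * (LINT x:U|lebesgue. (norm (F k x - f x))\<^sup>2)"
  using L2_diff(2)[of "\<lambda>x. F j x - f x" U "\<lambda>x. F k x - f x"] assms by (simp add: L2_tendsto_def)

text \<open>Test functions are built from the solution by a cut-off factor \<psi> and a correction
  \<rho>; the same operations applied to the approximating sequence approximate the result.\<close>

lemma C1_approximation_mult_add:
  assumes U: "U \<in> sets lebesgue" "bounded U" and u: "C1_approximation U u G v Dv"
    and \<psi>: "C1_with_gradient \<psi> D\<psi>" and \<rho>: "C1_with_gradient \<rho> D\<rho>"
  shows "C1_approximation U (\<lambda>x. \<psi> x * u x + \<rho> x) (\<lambda>x. (\<psi> x *\<^sub>R G x + u x *\<^sub>R D\<psi> x) + D\<rho> x)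
    (\<lambda>k x. \<psi> x * v k x + \<rho> x) (\<lambda>k x. (\<psi> x *\<^sub>R Dv k x + v k x *\<^sub>R D\<psi> x) + D\<rho> x)"
proof -
  have u': "has_weak_gradient U u G" "\<And>k. C1_with_gradient (v k) (Dv k)" "L2_tendsto U v u" "L2_tendsto U Dv G"
    using u by (auto simp: C1_approximation_def)
  note \<psi>c = C1_with_gradientD(2,3)[OF \<psi>] and \<rho>c = C1_with_gradientD(2,3)[OF \<rho>]
  obtain B1 where B1: "0 \<le> B1" "\<And>x. x \<in> U \<Longrightarrow> norm (\<psi> x) \<le> B1"
    using continuous_bounded_on_bounded \<psi>c(1) U(2) by metis
  obtain B2 where B2: "0 \<le> B2" "\<And>x. x \<in> U \<Longrightarrow> norm (D\<psi> x) \<le> B2"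
    using continuous_bounded_on_bounded \<psi>c(2) U(2) by metis
  have m: "set_borel_measurable lebesgue U (\<lambda>x. v k x - u x)" "set_borel_measurable lebesgue U (\<lambda>x. Dv k x - G x)" for k
    using u'(3,4) by (auto simp: L2_tendsto_def L2_def)
  have t1: "L2_tendsto U (\<lambda>k x. \<psi> x * v k x + \<rho> x) (\<lambda>x. \<psi> x * u x + \<rho> x)"
  proof (rule L2_tendstoI[OF u'(3) u'(3), where B = "B1\<^sup>2"])
    fix k
    have "set_borel_measurable lebesgue U (\<lambda>x. \<psi> x *\<^sub>R (v k x - u x))"
      by (intro set_borel_measurable_scaleR_lebesgue set_borel_measurable_continuous \<psi>c U m)
    then show "set_borel_measurable lebesgue U (\<lambda>x. \<psi> x * v k x + \<rho> x - (\<psi> x * u x + \<rho> x))"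
      by (simp add: right_diff_distrib)
    fix x assume x: "x \<in> U"
    have "(norm (\<psi> x * v k x + \<rho> x - (\<psi> x * u x + \<rho> x)))\<^sup>2 = (norm (\<psi> x))\<^sup>2 * (norm (v k x - u x))\<^sup>2"
      by (simp add: power_mult_distrib[symmetric] right_diff_distrib)
    also have "\<dots> \<le> B1\<^sup>2 * (norm (v k x - u x))\<^sup>2"
      by (intro mult_right_mono power_mono B1 x) auto
    also have "\<dots> \<le> B1\<^sup>2 * (norm (v k x - u x))\<^sup>2 + B1\<^sup>2 * (norm (v k x - u x))\<^sup>2"
      by simp
    finally show "(norm (\<psi> x * v k x + \<rho> x - (\<psi> x * u x + \<rho> x)))\<^sup>2 \<le> B1\<^sup>2 * (norm (v k x - u x))\<^sup>2 + B1\<^sup>2 * (norm (v k x - u x))\<^sup>2" .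
  qed
  have t2: "L2_tendsto U (\<lambda>k x. (\<psi> x *\<^sub>R Dv k x + v k x *\<^sub>R D\<psi> x) + D\<rho> x) (\<lambda>x. (\<psi> x *\<^sub>R G x + u x *\<^sub>R D\<psi> x) + D\<rho> x)"
  \<comment> \<open>The two errors are split by \<open>norm_add_power2_le\<close>; the sum of both
    squared bounds is a common constant for them.\<close>
  proof (rule L2_tendstoI[OF u'(4) u'(3), where B = "2 * (B1\<^sup>2 + B2\<^sup>2)"])
    fix k
    have eq: "(\<psi> x *\<^sub>R Dv k x + v k x *\<^sub>R D\<psi> x) + D\<rho> x - ((\<psi> x *\<^sub>R G x + u x *\<^sub>R D\<psi> x) + D\<rho> x)
        = \<psi> x *\<^sub>R (Dv k x - G x) + (v k x - u x) *\<^sub>R D\<psi> x" for x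
      by (simp add: algebra_simps)
    show "set_borel_measurable lebesgue U (\<lambda>x. (\<psi> x *\<^sub>R Dv k x + v k x *\<^sub>R D\<psi> x) + D\<rho> x - ((\<psi> x *\<^sub>R G x + u x *\<^sub>R D\<psi> x) + D\<rho> x))"
      unfolding eq
      by (intro set_borel_measurable_add_lebesgue set_borel_measurable_scaleR_lebesgue set_borel_measurable_continuous \<psi>c U m)
    fix x assume x: "x \<in> U"
    have "(norm (\<psi> x *\<^sub>R (Dv k x - G x) + (v k x - u x) *\<^sub>R D\<psi> x))\<^sup>2
        \<le> 2 * (norm (\<psi> x *\<^sub>R (Dv k x - G x)))\<^sup>2 + 2 * (norm ((v k x - u x) *\<^sub>R D\<psi> x))\<^sup>2"
      by (rule norm_add_power2_le)
    also have "\<dots> = 2 * (norm (\<psi> x))\<^sup>2 * (norm (Dv k x - G x))\<^sup>2 + 2 * (norm (D\<psi> x))\<^sup>2 * (norm (v k x - u x))\<^sup>2"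
      by (simp add: power_mult_distrib mult_ac)
    also have "\<dots> \<le> (2 * (B1\<^sup>2 + B2\<^sup>2)) * (norm (Dv k x - G x))\<^sup>2 + (2 * (B1\<^sup>2 + B2\<^sup>2)) * (norm (v k x - u x))\<^sup>2"
    proof (intro add_mono mult_right_mono)
      show "2 * (norm (\<psi> x))\<^sup>2 \<le> 2 * (B1\<^sup>2 + B2\<^sup>2)"
        using add_mono[OF power_mono[OF B1(2)[OF x] norm_ge_zero, of 2] zero_le_power2[of B2]]
        by (simp only: add_0_right mult_le_cancel_left_pos zero_less_numeral)
      show "2 * (norm (D\<psi> x))\<^sup>2 \<le> 2 * (B1\<^sup>2 + B2\<^sup>2)"
        using add_mono[OF zero_le_power2[of B1] power_mono[OF B2(2)[OF x] norm_ge_zero, of 2]]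
        by (simp only: add_0_left mult_le_cancel_left_pos zero_less_numeral)
    qed auto
    finally show "(norm ((\<psi> x *\<^sub>R Dv k x + v k x *\<^sub>R D\<psi> x) + D\<rho> x - ((\<psi> x *\<^sub>R G x + u x *\<^sub>R D\<psi> x) + D\<rho> x)))\<^sup>2
      \<le> (2 * (B1\<^sup>2 + B2\<^sup>2)) * (norm (Dv k x - G x))\<^sup>2 + (2 * (B1\<^sup>2 + B2\<^sup>2)) * (norm (v k x - u x))\<^sup>2"
      unfolding eq .
  qed
  show ?thesis
    unfolding C1_approximation_def
    by (intro conjI allI t1 t2 has_weak_gradient_add[OF U] has_weak_gradient_mult_C1[OF U] has_weak_gradient_C1[OF U]
        C1_with_gradient_add C1_with_gradient_mult \<psi> \<rho> u')
qed

text \<open>All approximants equal \<open>c\<close> exactly on the face, so the trace is found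
  without any limit.\<close>

lemma has_trace_const:
  assumes U: "U \<in> sets lebesgue" "bounded U" and u: "C1_approximation U u G v Dv"
    and \<psi>: "C1_with_gradient \<psi> D\<psi>" and \<rho>: "C1_with_gradient \<rho> D\<rho>"
    and t: "\<And>x'. \<psi> (x', t) = 0" "\<And>x'. \<rho> (x', t) = c"
  shows "has_trace U A t (\<lambda>x. \<psi> x * u x + \<rho> x) (\<lambda>_. c)"
  by (rule has_traceI[OF C1_approximation_mult_add[OF U u \<psi> \<rho>]])
     (simp add: t L2_tendsto_def L2_def set_borel_measurable_def set_integrable_def)

text \<open>A sequence of local bounds \<open>F k \<le> \<theta> F (k + 1) + B (d + 2 k)\<close> is solved by comparison with
  the affine supersolution \<open>P k = 2 B / (1 - \<theta>) (d + 2 k)\<close>.\<close>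

lemma geometric_comparison:
  fixes F :: "nat \<Rightarrow> real"
  assumes \<theta>: "0 \<le> \<theta>" "\<theta> < 1" and B: "0 \<le> B" and d: "4 * \<theta> / (1 - \<theta>) \<le> d" "0 \<le> d"
    and F: "\<And>k. k < N \<Longrightarrow> F k \<le> \<theta> * F (Suc k) + B * (d + 2 * real k)"
  shows "F 0 \<le> 2 * B / (1 - \<theta>) * d + \<theta> ^ N * F N"
proof -
  define P where "P k = 2 * B / (1 - \<theta>) * (d + 2 * real k)" for k
  \<comment> \<open>After multiplication by \<open>1 - \<theta>\<close> this reduces to
    \<open>4 * \<theta> \<le> (1 - \<theta>) * (d + 2 * real k)\<close>. This condition is what
    forces the slab to have a minimal length.\<close>
  have P: "\<theta> * P (Suc k) + B * (d + 2 * real k) \<le> P k" for k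
  proof -
    let ?X = "d + 2 * real k"
    have "4 * \<theta> \<le> (1 - \<theta>) * d" using d \<theta> by (simp add: pos_divide_le_eq mult.commute)
    then have "4 * \<theta> \<le> (1 - \<theta>) * ?X"
      using \<theta> by (simp add: distrib_left add_increasing2)
    then have le: "B * (4 * \<theta>) \<le> B * ((1 - \<theta>) * ?X)" using B by (rule mult_left_mono)
    have P1: "(1 - \<theta>) * P k = 2 * B * ?X" and P2: "(1 - \<theta>) * P (Suc k) = 2 * B * (?X + 2)"
      using \<theta> by (simp_all add: P_def)
    have "(1 - \<theta>) * (\<theta> * P (Suc k) + B * ?X) = \<theta> * ((1 - \<theta>) * P (Suc k)) + (1 - \<theta>) * (B * ?X)"
      by (simp add: algebra_simps)
    also have "\<dots> \<le> (1 - \<theta>) * P k"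
      unfolding P1 P2 using le by (simp add: algebra_simps)
    finally have "(1 - \<theta>) * (\<theta> * P (Suc k) + B * ?X) \<le> (1 - \<theta>) * P k" .
    then show ?thesis using \<theta> by simp
  qed
  have "F 0 - P 0 \<le> \<theta> ^ n * (F n - P n)" if "n \<le> N" for n
    using that
  proof (induction n)
    case (Suc n)
    then have "F 0 - P 0 \<le> \<theta> ^ n * (F n - P n)" by simp
    also have "\<dots> \<le> \<theta> ^ n * (\<theta> * (F (Suc n) - P (Suc n)))"
      using F[of n] P[of n] Suc.prems \<theta> by (intro mult_left_mono) (auto simp: right_diff_distrib)
    finally show ?case by (simp add: mult_ac)
  qed simp
  from this[of N] have "F 0 \<le> P 0 + \<theta> ^ N * F N - \<theta> ^ N * P N" by (simp add: right_diff_distrib)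
  moreover have "0 \<le> \<theta> ^ N * P N" using \<theta> B d by (simp add: P_def)
  ultimately show ?thesis by (simp add: P_def)
qed

text \<open>Each of the \<open>N + 1\<close> copies of \<open>\<theta> ^ N\<close> is at most one of
  the terms of the geometric series. This absorbs a total energy that grows linearly in
  \<open>L\<close>.\<close>

lemma Suc_times_power_le:
  fixes \<theta> :: real
  assumes "0 \<le> \<theta>" "\<theta> < 1"
  shows "(real N + 1) * \<theta> ^ N \<le> 1 / (1 - \<theta>)"
proof -
  have "(real N + 1) * \<theta> ^ N = (\<Sum>k\<le>N. \<theta> ^ N)" by simp
  also have "\<dots> \<le> (\<Sum>k\<le>N. \<theta> ^ k)" by (intro sum_mono power_decreasing) (use assms in auto)
  also have "\<dots> = (1 - \<theta> ^ Suc N) / (1 - \<theta>)" using assms by (simp add: sum_gp0)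
  also have "\<dots> \<le> 1 / (1 - \<theta>)" using assms by (intro divide_right_mono) auto
  finally show ?thesis .
qed

subsection \<open>The energy estimate\<close>

context nozzle_chart
begin

lemma truncation_sets: "truncation \<Omega> L \<in> sets lebesgue" and bounded_truncation: "bounded (truncation \<Omega> L)"
  unfolding truncation_eq_slab using open_slab[of "-L" L] bounded_slab by auto

lemma slab_sets: "slab \<Omega> a b \<in> sets lebesgue"
  using open_slab[of a b] by auto

lemma cross_section_lmeasurable: "cross_section \<Omega> t \<in> lmeasurable"
  using open_cross_section[of t] bounded_cross_section[of t] by (intro bounded_set_imp_lmeasurable) auto

lemma L2_cross_section_continuous:
  assumes "C1_with_gradient v Dv"
  shows "(\<lambda>x. v (x, t)) \<in> L2 (cross_section \<Omega> t)"
  using open_cross_section[of t] bounded_cross_section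
  by (intro L2_continuous continuous_on_compose2[OF C1_with_gradientD(2)[OF assms]] continuous_intros) auto

lemma CT_nonneg: "0 \<le> CT" and CP_nonneg: "0 \<le> CP" and CD_pos: "0 < CD"
  using C0_pos C1_pos K ball_vol_pos by (auto simp: CT_def CP_def CD_def)

text \<open>The weak formulation says something about a test function only if it has a trace on the
  top face, whereas \<open>H_trunc\<close> provides one on the bottom face. Applying
  \<open>trace_C1\<close> to differences of approximants shows that their restrictions to the top
  face form a Cauchy sequence.\<close>

lemma trace_Cauchy:
  assumes L: "0 < L" and v: "\<And>k. C1_with_gradient (v k) (Dv k)"
    and grad: "L2_tendsto (truncation \<Omega> L) Dv G"
    and bot: "L2_tendsto (cross_section \<Omega> (- L)) (\<lambda>k x'. v k (x', - L)) (\<lambda>_. 0)"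
  obtains g where "L2_tendsto (cross_section \<Omega> L) (\<lambda>k x'. v k (x', L)) g"
proof (rule L2_complete[OF cross_section_lmeasurable])
  show "(\<lambda>x'. v k (x', L)) \<in> L2 (cross_section \<Omega> L)" for k by (rule L2_cross_section_continuous[OF v])
  define bb where "bb k = (LINT x:cross_section \<Omega> (-L)|lebesgue. (norm (v k (x, -L) - 0))\<^sup>2)" for k
  define gg where "gg k = (LINT x:truncation \<Omega> L|lebesgue. (norm (Dv k x - G x))\<^sup>2)" for k
  define e where "e k = CT * (2 * bb k + L * (2 * gg k))" for k
  have "e \<longlonglongrightarrow> CT * (2 * 0 + L * (2 * 0))"
    unfolding e_def using bot grad unfolding L2_tendsto_def bb_def gg_def by (intro tendsto_intros) auto
  then have e0: "e \<longlonglongrightarrow> 0" by simp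
  have le: "(LINT x:cross_section \<Omega> L|lebesgue. (norm (v j (x, L) - v k (x, L)))\<^sup>2) \<le> e j + e k" for j k
  proof -
    have "(LINT x:cross_section \<Omega> L|lebesgue. (norm (v j (x, L) - v k (x, L)))\<^sup>2) \<le>
      CT * ((LINT x:cross_section \<Omega> (-L)|lebesgue. (norm (v j (x, -L) - v k (x, -L)))\<^sup>2)
        + L * (LINT x:truncation \<Omega> L|lebesgue. (norm (Dv j x - Dv k x))\<^sup>2))"
      by (rule trace_C1[OF C1_with_gradient_diff[OF v v] L])
    also have "\<dots> \<le> CT * ((2 * bb j + 2 * bb k) + L * (2 * gg j + 2 * gg k))"
      using L2_tendsto_pair_le[OF bot, of j k] L2_tendsto_pair_le[OF grad, of j k] L CT_nonneg
      unfolding bb_def gg_def by (intro mult_left_mono add_mono) auto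
    finally show ?thesis by (simp add: e_def algebra_simps)
  qed
  fix r :: real assume "0 < r"
  then obtain N where N: "\<And>n. N \<le> n \<Longrightarrow> norm (e n - 0) < r / 2"
    using LIMSEQ_D[OF e0, of "r/2"] by auto
  show "\<exists>N. \<forall>j\<ge>N. \<forall>k\<ge>N. (LINT x:cross_section \<Omega> L|lebesgue. (norm (v j (x, L) - v k (x, L)))\<^sup>2) < r"
  proof (intro exI[of _ N] allI impI)
    fix j k assume "N \<le> j" "N \<le> k"
    then show "(LINT x:cross_section \<Omega> L|lebesgue. (norm (v j (x, L) - v k (x, L)))\<^sup>2) < r"
      using le[of j k] N[of j] N[of k] by auto
  qed
qed (rule that)

text \<open>The factor \<open>4 * CT\<close> arises in bounding the squared trace by the energy, and
  \<open>C1 / ball_vol\<close> bounds the inverse area of the top face.\<close>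

definition CE :: real where "CE = 4 * CT * C1 / ball_vol"

text \<open>Testing with the solution itself: its trace on the top face is controlled by its energy,
  because it vanishes on the bottom face.\<close>

lemma energy_bound:
  assumes L: "0 < L" and sol: "truncated_solution \<Omega> L m \<phi>"
  obtains G' v Dv where "C1_approximation (truncation \<Omega> L) \<phi> G' v Dv"
    "(LINT x:truncation \<Omega> L|lebesgue. (norm (G' x))\<^sup>2) \<le> CE * m\<^sup>2 * L"
    "\<forall>G. has_weak_gradient (truncation \<Omega> L) \<phi> G \<longrightarrow>
       (LINT x:truncation \<Omega> L|lebesgue. (norm (G x - G' x))\<^sup>2) = 0"
proof -
  let ?U = "truncation \<Omega> L" and ?A = "cross_section \<Omega> L"
  have H: "\<phi> \<in> H_trunc \<Omega> L" and weak: "\<And>\<eta> G\<phi> G\<eta> g. \<lbrakk>\<eta> \<in> H_trunc \<Omega> L; has_weak_gradient ?U \<phi> G\<phi>; has_weak_gradient ?U \<eta> G\<eta>; has_trace ?U ?A L \<eta> g\<rbrakk>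
      \<Longrightarrow> (LINT x:?U|lebesgue. G\<phi> x \<bullet> G\<eta> x) = m / measure lebesgue ?A * (LINT x':?A|lebesgue. g x')"
    using sol unfolding truncated_solution_def by blast+
  obtain G' v Dv where app: "C1_approximation ?U \<phi> G' v Dv"
    and bot: "L2_tendsto (cross_section \<Omega> (- L)) (\<lambda>k x'. v k (x', - L)) (\<lambda>_. 0)"
    using H unfolding H_trunc_def has_trace_def C1_approximation_def by blast
  have G': "has_weak_gradient ?U \<phi> G'" and v: "\<And>k. C1_with_gradient (v k) (Dv k)" and grad: "L2_tendsto ?U Dv G'"
    using app by (auto simp: C1_approximation_def)
  obtain g where g: "L2_tendsto ?A (\<lambda>k x'. v k (x', L)) g"
    using trace_Cauchy[OF L v grad bot] by blast
  note tr = has_traceI[OF app g]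
  define J where "J = m / measure lebesgue ?A * (LINT x':?A|lebesgue. g x')"
  \<comment> \<open>The equation holds for every choice of weak gradients, so all products of two
    weak gradients of \<phi> have the same integral. Expanding the square of a difference then gives
    \<open>J - 2 * J + J = 0\<close>, which identifies any weak gradient with the approximated one
    almost everywhere.\<close>
  have J: "(LINT x:?U|lebesgue. X x \<bullet> Y x) = J" if "has_weak_gradient ?U \<phi> X" "has_weak_gradient ?U \<phi> Y" for X Y
    unfolding J_def by (rule weak[OF H that tr])
  define E where "E = (LINT x:?U|lebesgue. (norm (G' x))\<^sup>2)"
  have EJ: "E = J" using J[OF G' G'] by (simp add: E_def power2_norm_eq_inner)
  have E0: "0 \<le> E" unfolding E_def by (rule set_integral_nonneg_lebesgue) simp
  have G'L: "G' \<in> L2 ?U" using G' by (simp add: has_weak_gradient_def)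
  have zero: "(LINT x:?U|lebesgue. (norm (G x - G' x))\<^sup>2) = 0" if G: "has_weak_gradient ?U \<phi> G" for G
  proof -
    have GL: "G \<in> L2 ?U" using G by (simp add: has_weak_gradient_def)
    note i = L2_inner_integrable[OF GL GL] L2_inner_integrable[OF GL G'L] L2_inner_integrable[OF G'L G'L]
    have "(LINT x:?U|lebesgue. (norm (G x - G' x))\<^sup>2) = (LINT x:?U|lebesgue. (G x \<bullet> G x - 2 * (G x \<bullet> G' x)) + G' x \<bullet> G' x)"
      by (simp add: power2_norm_eq_inner inner_diff inner_commute algebra_simps)
    also have "\<dots> = J - 2 * J + J"
      using i by (subst set_integral_add(2), simp, simp, subst set_integral_diff(2)) (auto simp: J[OF G G] J[OF G G'] J[OF G' G'])
    finally show ?thesis by simp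
  qed
  let ?S = "measure lebesgue ?A"
  have S: "0 < ?S" "ball_vol \<le> C1 * ?S"
    using measure_cross_section_ge[of L] ball_vol_pos C1_pos
    by (auto simp: zero_less_mult_iff dest: less_le_trans)
  have vL: "(\<lambda>x'. v k (x', L)) \<in> L2 ?A" for k by (rule L2_cross_section_continuous[OF v])
  have vgL: "(\<lambda>x'. v k (x', L) - g x') \<in> L2 ?A" for k using g by (auto simp: L2_tendsto_def)
  have gL: "g \<in> L2 ?A" using L2_diff(1)[OF vL[of 0] vgL[of 0]] by simp
  define gg where "gg = (LINT x':?A|lebesgue. (norm (g x'))\<^sup>2)"
  \<comment> \<open>\<open>trace_C1\<close> for the approximants, passed to the limit: the bottom
    trace disappears, and the two replacements of an approximant by its limit cost a factor 2
    each.\<close>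
  have gg: "gg \<le> 4 * CT * L * E"
  proof -
    define e where "e k = 2 * (CT * ((LINT x:cross_section \<Omega> (-L)|lebesgue. (norm (v k (x, -L) - 0))\<^sup>2)
         + L * (2 * E + 2 * (LINT x:?U|lebesgue. (norm (Dv k x - G' x))\<^sup>2)))) + 2 * (LINT x':?A|lebesgue. (norm (v k (x', L) - g x'))\<^sup>2)" for k
    have "e \<longlonglongrightarrow> 2 * (CT * (0 + L * (2 * E + 2 * 0))) + 2 * 0"
      unfolding e_def using bot grad g unfolding L2_tendsto_def by (intro tendsto_intros) auto
    moreover have "gg \<le> e k" for k
    proof -
      have "gg \<le> 2 * (LINT x':?A|lebesgue. (norm (v k (x', L)))\<^sup>2) + 2 * (LINT x':?A|lebesgue. (norm (v k (x', L) - g x'))\<^sup>2)"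
        using L2_diff(2)[OF vL[of k] vgL[of k]] by (simp add: gg_def)
      also have "(LINT x':?A|lebesgue. (norm (v k (x', L)))\<^sup>2) \<le> CT * ((LINT x:cross_section \<Omega> (-L)|lebesgue. (norm (v k (x, -L)))\<^sup>2)
         + L * (LINT x:?U|lebesgue. (norm (Dv k x))\<^sup>2))"
        by (rule trace_C1[OF v L])
      also have "\<dots> \<le> CT * ((LINT x:cross_section \<Omega> (-L)|lebesgue. (norm (v k (x, -L)))\<^sup>2)
         + L * (2 * E + 2 * (LINT x:?U|lebesgue. (norm (Dv k x - G' x))\<^sup>2)))"
      proof -
        have "(\<lambda>x. Dv k x - G' x) \<in> L2 ?U" using grad by (auto simp: L2_tendsto_def)
        from L2_add(2)[OF G'L this] show ?thesis
          using L CT_nonneg by (intro mult_left_mono add_left_mono) (auto simp: E_def)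
      qed
      finally show ?thesis by (simp add: e_def)
    qed
    ultimately have "gg \<le> 2 * (CT * (0 + L * (2 * E + 2 * 0))) + 2 * 0"
      by (intro LIMSEQ_le_const) auto
    then show ?thesis by (simp add: mult_ac)
  qed
  have "E\<^sup>2 = (m / ?S)\<^sup>2 * (LINT x':?A|lebesgue. g x')\<^sup>2" unfolding EJ J_def by (rule power_mult_distrib)
  also have "\<dots> \<le> (m / ?S)\<^sup>2 * (?S * gg)"
    unfolding gg_def by (intro mult_left_mono set_integral_Cauchy_Schwarz_const gL cross_section_lmeasurable) auto
  also have "\<dots> \<le> (m / ?S)\<^sup>2 * (?S * (4 * CT * L * E))"
    using S gg by (intro mult_left_mono) auto
  also have "\<dots> = E * (4 * CT * L * m\<^sup>2 / ?S)" using S by (simp add: power2_eq_square)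
  \<comment> \<open>The energy is linear in the top trace, while the squared trace is at most linear
    in the energy; hence one factor \<open>E\<close> can be cancelled.\<close>
  finally have "E * E \<le> E * (4 * CT * L * m\<^sup>2 / ?S)" by (simp add: power2_eq_square)
  moreover have "0 \<le> 4 * CT * L * m\<^sup>2 / ?S" using S L CT_nonneg by simp
  ultimately have "E \<le> 4 * CT * L * m\<^sup>2 / ?S"
  proof (cases "E = 0")
    case False
    then have "0 < E" using E0 by simp
    then show ?thesis using \<open>E * E \<le> _\<close> by (simp only: mult_le_cancel_left_pos)
  qed simp
  also have "\<dots> = (4 * CT * L * m\<^sup>2) * (1 / ?S)" by simp
  also have "\<dots> \<le> (4 * CT * L * m\<^sup>2) * (C1 / ball_vol)"
    using S L CT_nonneg ball_vol_pos by (intro mult_left_mono) (auto simp: field_simps)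
  also have "\<dots> = CE * m\<^sup>2 * L" by (simp add: CE_def)
  finally show ?thesis using that[OF app] zero by (simp add: E_def)
qed

text \<open>The test function equals \<open>\<phi> - c1\<close> in the middle, \<open>0\<close> far below and the constant
  \<open>c2 - c1\<close> far above, so that the flux through the top face enters only through \<open>m (c2 - c1)\<close>.\<close>

lemma local_flux_inequality:
  assumes L: "0 < L" and sol: "truncated_solution \<Omega> L m \<phi>" and app: "C1_approximation (truncation \<Omega> L) \<phi> G v Dv"
    and ab: "a \<le> b" "- L \<le> a - 1" "b + 1 \<le> L"
  defines "E \<equiv> \<lambda>a b. LINT x:slab \<Omega> a b|lebesgue. (norm (G x))\<^sup>2"
  shows "E a b \<le> m * (c2 - c1)
    + ((LINT x:slab \<Omega> (a - 1) a|lebesgue. (norm (\<phi> x - c1))\<^sup>2) + E (a - 1) a)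
    + ((LINT x:slab \<Omega> b (b + 1)|lebesgue. (norm (\<phi> x - c2))\<^sup>2) + E b (b + 1))"
proof -
  let ?U = "truncation \<Omega> L" and ?A = "cross_section \<Omega> L"
  note U = truncation_sets[of L] bounded_truncation[of L]
  \<comment> \<open>The test function is \<open>f * \<phi> + r\<close>. On the rising part it is the
    ramp times \<open>\<phi> - c1\<close>, on the falling part it is \<open>\<phi> - c1\<close>
    minus the ramp times \<open>\<phi> - c2\<close>; thus derivatives of the cut-off only meet
    \<phi> minus the constant that belongs to that end.\<close>
  define f where "f t = 1 * ramp (t - (a - 1)) + (-1) * ramp (t - b)" for t
  define f' where "f' t = 1 * ramp' (t - (a - 1)) + (-1) * ramp' (t - b)" for t
  define r where "r t = (- c1) * ramp (t - (a - 1)) + c2 * ramp (t - b)" for t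
  define r' where "r' t = (- c1) * ramp' (t - (a - 1)) + c2 * ramp' (t - b)" for t
  have \<psi>: "C1_with_gradient (\<lambda>x::'a \<times> real. f (snd x)) (\<lambda>x. (0, f' (snd x)))"
    unfolding f_def f'_def by (rule C1_with_gradient_axial[OF ramp_comb_deriv ramp'_cont])
  have \<rho>: "C1_with_gradient (\<lambda>x::'a \<times> real. r (snd x)) (\<lambda>x. (0, r' (snd x)))"
    unfolding r_def r'_def by (rule C1_with_gradient_axial[OF ramp_comb_deriv ramp'_cont])
  define \<eta> where "\<eta> x = f (snd x) * \<phi> x + r (snd x)" for x
  define H where "H x = (f (snd x) *\<^sub>R G x + \<phi> x *\<^sub>R (0, f' (snd x))) + (0, r' (snd x))" for x
  have H: "has_weak_gradient ?U \<eta> H"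
    using C1_approximation_mult_add[OF U app \<psi> \<rho>] unfolding C1_approximation_def \<eta>_def H_def by blast
  have low: "f t = 0" "r t = 0" "f' t = 0" "r' t = 0" if "t \<le> a - 1" for t
    using that ab by (simp_all add: f_def r_def f'_def r'_def ramp_le_0 ramp'_le_0)
  have high: "f t = 0" "r t = c2 - c1" "f' t = 0" "r' t = 0" if "b + 1 \<le> t" for t
    using that ab by (simp_all add: f_def r_def f'_def r'_def ramp_ge_1 ramp'_ge_1)
  have mid: "f t = 1" "f' t = 0" "r' t = 0" if "a \<le> t" "t \<le> b" for t
    using that by (simp_all add: f_def f'_def r'_def ramp_ge_1 ramp_le_0 ramp'_ge_1 ramp'_le_0)
  have "has_trace ?U (cross_section \<Omega> (- L)) (- L) \<eta> (\<lambda>_. 0)"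
    unfolding \<eta>_def by (rule has_trace_const[OF U app \<psi> \<rho>]) (use ab low in auto)
  then have "\<eta> \<in> H_trunc \<Omega> L" using H by (auto simp: H_trunc_def H1_def)
  moreover have "has_trace ?U ?A L \<eta> (\<lambda>_. c2 - c1)"
    unfolding \<eta>_def by (rule has_trace_const[OF U app \<psi> \<rho>]) (use ab high in auto)
  moreover have G: "has_weak_gradient ?U \<phi> G" using app by (simp add: C1_approximation_def)
  ultimately have "(LINT x:?U|lebesgue. G x \<bullet> H x) = m / measure lebesgue ?A * (LINT x':?A|lebesgue. c2 - c1)"
    using sol H unfolding truncated_solution_def by blast
  also have "\<dots> = m * (c2 - c1)"
  proof -
    have "measure lebesgue ?A \<noteq> 0"
      using measure_cross_section_ge[of L] ball_vol_pos by auto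
    moreover have "?A \<in> sets lebesgue" using cross_section_lmeasurable by blast
    ultimately show ?thesis by (simp add: set_lebesgue_integral_def)
  qed
  finally have flux: "(LINT x:?U|lebesgue. G x \<bullet> H x) = m * (c2 - c1)" .
  have GL: "G \<in> L2 ?U" and \<phi>L: "\<phi> \<in> L2 ?U" and HL: "H \<in> L2 ?U"
    using G H by (auto simp: has_weak_gradient_def)
  let ?M = "slab \<Omega> a b" and ?D1 = "slab \<Omega> (a - 1) a" and ?D2 = "slab \<Omega> b (b + 1)"
  have sub: "?M \<subseteq> ?U" "?D1 \<subseteq> ?U" "?D2 \<subseteq> ?U"
    using ab unfolding truncation_eq_slab by (auto simp: slab_def)
  have \<phi>c: "(\<lambda>x. \<phi> x - c) \<in> L2 ?U" for c
    using U by (intro L2_diff(1) \<phi>L L2_continuous) auto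
  let ?h = "\<lambda>x c. (norm (\<phi> x - c))\<^sup>2 + (norm (G x))\<^sup>2"
  \<comment> \<open>In the end slabs the nonnegative term \<open>f\<close> times the squared
    gradient is discarded, and only the term with the derivative of the cut-off has to be
    estimated.\<close>
  have pt: "indicator ?M x * (norm (G x))\<^sup>2 - indicator ?D1 x * ?h x c1 - indicator ?D2 x * ?h x c2
      \<le> indicator ?U x * (G x \<bullet> H x)" for x
  proof (cases "x \<in> ?U")
    case False
    then have "x \<notin> ?M" "x \<notin> ?D1" "x \<notin> ?D2" using sub by blast+
    with False show ?thesis by simp
  next
    case x: True
    then have x\<Omega>: "x \<in> \<Omega>" by (simp add: truncation_def)
    have GH: "G x \<bullet> H x = f (snd x) * (norm (G x))\<^sup>2 + (\<phi> x * f' (snd x) + r' (snd x)) * snd (G x)"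
      by (cases "G x") (simp add: H_def inner_add_right inner_prod_def power2_norm_eq_inner algebra_simps)
    \<comment> \<open>The slope of the ramp is at most 2, exactly the factor for which Young's
      inequality leaves both squares with coefficient 1.\<close>
    have young: "- ?h x c \<le> (s * (\<phi> x - c)) * snd (G x)" if s: "\<bar>s\<bar> \<le> 2" for s c
    proof -
      have "\<bar>(s * (\<phi> x - c)) * snd (G x)\<bar> = \<bar>s\<bar> * (\<bar>\<phi> x - c\<bar> * \<bar>snd (G x)\<bar>)" by (simp add: abs_mult)
      also have "\<dots> \<le> 2 * (norm (\<phi> x - c) * norm (G x))"
        using s norm_snd_le[of "snd (G x)" "fst (G x)"] by (intro mult_mono) auto
      also have "\<dots> \<le> ?h x c"
        using sum_squares_bound[of "norm (\<phi> x - c)" "norm (G x)"] by (simp add: mult.assoc)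
      finally show ?thesis by linarith
    qed
    have f0: "0 \<le> f (snd x)"
    proof (cases "snd x \<le> b")
      case True
      then show ?thesis using ramp_bounds(1)[of "snd x - (a - 1)"] by (simp add: f_def ramp_le_0)
    next
      case False
      then show ?thesis using ab ramp_bounds(2)[of "snd x - b"] by (simp add: f_def ramp_ge_1)
    qed
    consider "snd x \<le> a - 1" | "a - 1 < snd x" "snd x < a" | "a \<le> snd x" "snd x \<le> b"
      | "b < snd x" "snd x < b + 1" | "b + 1 \<le> snd x" by linarith
    then show ?thesis
    proof cases
      case 1
      then show ?thesis using low[of "snd x"] ab x by (simp add: GH slab_def)
    next
      case 2
      then have "f' (snd x) = ramp' (snd x - (a - 1))" "r' (snd x) = - c1 * ramp' (snd x - (a - 1))"
        using ab by (simp_all add: f'_def r'_def ramp'_le_0)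
      then have "G x \<bullet> H x = f (snd x) * (norm (G x))\<^sup>2 + (ramp' (snd x - (a - 1)) * (\<phi> x - c1)) * snd (G x)"
        unfolding GH by (simp add: algebra_simps)
      moreover have "- ?h x c1 \<le> (ramp' (snd x - (a - 1)) * (\<phi> x - c1)) * snd (G x)"
        using ramp'_bounds by (intro young) (auto simp: abs_le_iff intro: order_trans[of _ 0])
      ultimately have "- ?h x c1 \<le> G x \<bullet> H x"
        using mult_nonneg_nonneg[OF f0 zero_le_power2[of "norm (G x)"]] by linarith
      then show ?thesis using 2 ab x x\<Omega> by (simp add: slab_def)
    next
      \<comment> \<open>The heights \<open>a\<close> and \<open>b\<close> themselves lie in none of
        the three open slabs; there the claim says that the squared gradient is nonnegative, so no
        null set has to be removed.\<close>
      case 3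
      then have "G x \<bullet> H x = (norm (G x))\<^sup>2" using mid[of "snd x"] by (simp add: GH)
      then show ?thesis using 3 x by (auto simp: slab_def indicator_def)
    next
      case 4
      then have "f' (snd x) = - ramp' (snd x - b)" "r' (snd x) = c2 * ramp' (snd x - b)"
        using ab by (simp_all add: f'_def r'_def ramp'_ge_1)
      then have "G x \<bullet> H x = f (snd x) * (norm (G x))\<^sup>2 + ((- ramp' (snd x - b)) * (\<phi> x - c2)) * snd (G x)"
        unfolding GH by (simp add: algebra_simps)
      moreover have "- ?h x c2 \<le> ((- ramp' (snd x - b)) * (\<phi> x - c2)) * snd (G x)"
        using ramp'_bounds by (intro young) (auto simp: abs_le_iff intro: order_trans[of _ 0])
      ultimately have "- ?h x c2 \<le> G x \<bullet> H x"
        using mult_nonneg_nonneg[OF f0 zero_le_power2[of "norm (G x)"]] by linarith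
      then show ?thesis using 4 ab x x\<Omega> by (simp add: slab_def)
    next
      case 5
      then show ?thesis using high[of "snd x"] ab x by (simp add: GH slab_def)
    qed
  qed
  have iM: "set_integrable lebesgue ?M (\<lambda>x. (norm (G x))\<^sup>2)"
    by (rule L2D(2)[OF L2_subset(1)[OF GL slab_sets sub(1)]])
  have i1: "set_integrable lebesgue ?D1 (\<lambda>x. (norm (\<phi> x - c1))\<^sup>2)" "set_integrable lebesgue ?D1 (\<lambda>x. (norm (G x))\<^sup>2)"
    by (rule L2D(2)[OF L2_subset(1)[OF \<phi>c slab_sets sub(2)]], rule L2D(2)[OF L2_subset(1)[OF GL slab_sets sub(2)]])
  have i2: "set_integrable lebesgue ?D2 (\<lambda>x. (norm (\<phi> x - c2))\<^sup>2)" "set_integrable lebesgue ?D2 (\<lambda>x. (norm (G x))\<^sup>2)"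
    by (rule L2D(2)[OF L2_subset(1)[OF \<phi>c slab_sets sub(3)]], rule L2D(2)[OF L2_subset(1)[OF GL slab_sets sub(3)]])
  note int = iM set_integral_add(1)[OF i1] set_integral_add(1)[OF i2] L2_inner_integrable[OF GL HL]
  have "(\<integral>x. indicator ?M x *\<^sub>R (norm (G x))\<^sup>2 - indicator ?D1 x *\<^sub>R ?h x c1 - indicator ?D2 x *\<^sub>R ?h x c2 \<partial>lebesgue)
      \<le> (\<integral>x. indicator ?U x *\<^sub>R (G x \<bullet> H x) \<partial>lebesgue)"
    using int pt by (intro integral_mono Bochner_Integration.integrable_diff) (simp_all add: set_integrable_def)
  also have "(\<integral>x. indicator ?M x *\<^sub>R (norm (G x))\<^sup>2 - indicator ?D1 x *\<^sub>R ?h x c1 - indicator ?D2 x *\<^sub>R ?h x c2 \<partial>lebesgue)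
     = (\<integral>x. indicator ?M x *\<^sub>R (norm (G x))\<^sup>2 \<partial>lebesgue) - (\<integral>x. indicator ?D1 x *\<^sub>R ?h x c1 \<partial>lebesgue) - (\<integral>x. indicator ?D2 x *\<^sub>R ?h x c2 \<partial>lebesgue)"
    using int by (subst Bochner_Integration.integral_diff, intro Bochner_Integration.integrable_diff)
       (simp_all add: set_integrable_def Bochner_Integration.integral_diff)
  finally have "E a b - (LINT x:?D1|lebesgue. ?h x c1) - (LINT x:?D2|lebesgue. ?h x c2) \<le> m * (c2 - c1)"
    unfolding flux[symmetric] E_def set_lebesgue_integral_def .
  then show ?thesis
    using set_integral_add(2)[OF i1] set_integral_add(2)[OF i2] by (simp add: E_def)
qed

text \<open>The flux inequality with the constants chosen as the means of the \<open>k\<close>-th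
  approximant over the two end slabs. Poincare's inequality and the drift of the means bound the
  right-hand side up to errors that vanish as \<open>k\<close> tends to infinity.\<close>

lemma energy_slab_decay:
  assumes L: "0 < L" and sol: "truncated_solution \<Omega> L m \<phi>" and app: "C1_approximation (truncation \<Omega> L) \<phi> G v Dv"
    and ab: "a \<le> b" "- L \<le> a - 1" "b + 1 \<le> L"
  defines "E \<equiv> \<lambda>a b. LINT x:slab \<Omega> a b|lebesgue. (norm (G x))\<^sup>2"
  shows "E a b \<le> 1/2 * E (a - 1) (b + 1) + CD * (b + 1 - a) * m\<^sup>2 + (1 + 4 * CP) * (E (a - 1) (b + 1) - E a b)"
proof -
  let ?U = "truncation \<Omega> L"
  have GL: "G \<in> L2 ?U" and \<phi>L: "\<phi> \<in> L2 ?U" and v: "\<And>k. C1_with_gradient (v k) (Dv k)"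
    and t\<phi>: "L2_tendsto ?U v \<phi>" and tG: "L2_tendsto ?U Dv G"
    using app by (auto simp: C1_approximation_def has_weak_gradient_def)
  define e1 where "e1 k = (LINT x:?U|lebesgue. (norm (v k x - \<phi> x))\<^sup>2)" for k
  define e2 where "e2 k = (LINT x:?U|lebesgue. (norm (Dv k x - G x))\<^sup>2)" for k
  have lim: "e1 \<longlonglongrightarrow> 0" "e2 \<longlonglongrightarrow> 0" using t\<phi> tG unfolding L2_tendsto_def e1_def[abs_def] e2_def[abs_def] by blast+
  have slabU: "slab \<Omega> s t \<subseteq> ?U" if "a - 1 \<le> s" "t \<le> b + 1" for s t
    using that ab unfolding truncation_eq_slab by (auto simp: slab_def)
  have grad: "(LINT x:slab \<Omega> s t|lebesgue. (norm (Dv k x))\<^sup>2) \<le> 2 * E s t + 2 * e2 k" if "a - 1 \<le> s" "t \<le> b + 1" for k s t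
  proof -
    have dL: "(\<lambda>x. Dv k x - G x) \<in> L2 ?U" using tG by (simp add: L2_tendsto_def)
    note s = L2_subset[OF dL slab_sets slabU[OF that]]
    show ?thesis
      using L2_add(2)[OF L2_subset(1)[OF GL slab_sets slabU[OF that]] s(1)] s(2) by (simp add: E_def e2_def)
  qed
  have poin: "(LINT x:slab \<Omega> s (s + 1)|lebesgue. (norm (\<phi> x - mean s (v k)))\<^sup>2) \<le> 4 * CP * E s (s + 1) + (2 * e1 k + 4 * CP * e2 k)"
    if "a - 1 \<le> s" "s + 1 \<le> b + 1" for s k
  proof -
    let ?D = "slab \<Omega> s (s + 1)"
    have dL: "(\<lambda>x. v k x - \<phi> x) \<in> L2 ?U" using t\<phi> by (simp add: L2_tendsto_def)
    note d = L2_subset[OF dL slab_sets slabU[OF that]]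
    have mL: "(\<lambda>x. v k x - mean s (v k)) \<in> L2 ?D"
      using C1_with_gradientD(2)[OF v] by (intro L2_slab_continuous continuous_intros) auto
    have "(LINT x:?D|lebesgue. (norm (\<phi> x - mean s (v k)))\<^sup>2) \<le>
        2 * (LINT x:?D|lebesgue. (norm (v k x - mean s (v k)))\<^sup>2) + 2 * (LINT x:?D|lebesgue. (norm (v k x - \<phi> x))\<^sup>2)"
      using L2_diff(2)[OF mL d(1)] by simp
    also have "(LINT x:?D|lebesgue. (norm (v k x - mean s (v k)))\<^sup>2) \<le> CP * (LINT x:?D|lebesgue. (norm (Dv k x))\<^sup>2)"
      by (rule poincare_C1[OF v])
    also have "\<dots> \<le> CP * (2 * E s (s + 1) + 2 * e2 k)"
      by (intro mult_left_mono grad that CP_nonneg)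
    also have "(LINT x:?D|lebesgue. (norm (v k x - \<phi> x))\<^sup>2) \<le> e1 k" using d(2) by (simp add: e1_def)
    finally show ?thesis by (simp add: algebra_simps)
  qed
  define l where "l = b + 1 - a"
  have l: "0 < l" using ab by (simp add: l_def)
  let ?E = "E (a - 1) (b + 1)"
  \<comment> \<open>Young's inequality with the weight \<open>2 * (CD * l)\<close>, chosen so that
    the energy receives the coefficient \<open>1/2\<close>. Any coefficient below 1 would make the
    later ratio \<theta> smaller than 1.\<close>
  have drift: "m * (mean b (v k) - mean (a - 1) (v k)) \<le> 1/2 * ?E + 1/2 * e2 k + CD * l * m\<^sup>2" for k
  proof -
    let ?c = "mean b (v k) - mean (a - 1) (v k)"
    have "?c\<^sup>2 \<le> CD * (b - (a - 1)) * (LINT x:slab \<Omega> (a - 1) (b + 1)|lebesgue. (norm (Dv k x))\<^sup>2)"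
      by (rule mean_increment_C1[OF v]) (use ab in auto)
    also have "\<dots> \<le> CD * (b - (a - 1)) * (2 * ?E + 2 * e2 k)"
      using CD_pos ab by (intro mult_left_mono grad) auto
    also have "b - (a - 1) = l" by (simp add: l_def)
    finally have c: "?c\<^sup>2 \<le> CD * l * (2 * ?E + 2 * e2 k)" .
    have q: "0 < CD * l" using CD_pos l by simp
    have "0 \<le> (?c - 2 * (CD * l) * m)\<^sup>2" by simp
    also have "\<dots> = ?c\<^sup>2 - 4 * (CD * l) * (m * ?c) + 4 * (CD * l) * (CD * l * m\<^sup>2)"
      by (simp add: power2_eq_square algebra_simps)
    finally have "(CD * l) * (4 * (m * ?c)) \<le> (CD * l) * (2 * ?E + 2 * e2 k + 4 * (CD * l * m\<^sup>2))"
      using c by (simp add: algebra_simps)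
    then have "4 * (m * ?c) \<le> 2 * ?E + 2 * e2 k + 4 * (CD * l * m\<^sup>2)"
      using q by (simp only: mult_le_cancel_left_pos)
    then show ?thesis by linarith
  qed
  \<comment> \<open>The hole-filling step: the energy of the two end slabs is expressed by the
    energies of the large and of the inner slab, which are disjointly separated by the heights
    \<open>a\<close> and \<open>b\<close>.\<close>
  have split: "E (a - 1) a + E b (b + 1) \<le> ?E - E a b"
  proof -
    let ?f = "\<lambda>s t x. indicator (slab \<Omega> s t) x *\<^sub>R (norm (G x))\<^sup>2"
    have i: "integrable lebesgue (?f s t)" if "a - 1 \<le> s" "t \<le> b + 1" for s t
      using L2D(2)[OF L2_subset(1)[OF GL slab_sets slabU[OF that]]] by (simp add: set_integrable_def)
    have I: "E s t = (\<integral>x. ?f s t x \<partial>lebesgue)" for s t by (simp add: E_def set_lebesgue_integral_def)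
    have "E (a - 1) a + E b (b + 1) + E a b = (\<integral>x. ?f (a - 1) a x + ?f b (b + 1) x + ?f a b x \<partial>lebesgue)"
      unfolding I using i ab by (subst Bochner_Integration.integral_add | intro Bochner_Integration.integrable_add | simp)+
    also have "\<dots> \<le> (\<integral>x. ?f (a - 1) (b + 1) x \<partial>lebesgue)"
    proof (intro integral_mono Bochner_Integration.integrable_add i)
      fix x
      show "?f (a - 1) a x + ?f b (b + 1) x + ?f a b x \<le> ?f (a - 1) (b + 1) x"
        using ab by (auto simp: slab_def indicator_def)
    qed (use ab in auto)
    finally show ?thesis unfolding I[symmetric] by simp
  qed
  let ?rhs = "1/2 * ?E + CD * l * m\<^sup>2 + (1 + 4 * CP) * (?E - E a b)"
  have step: "E a b \<le> ?rhs + (1/2 * e2 k + 2 * (2 * e1 k + 4 * CP * e2 k))" for k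
  proof -
    have "E a b \<le> m * (mean b (v k) - mean (a - 1) (v k))
      + ((LINT x:slab \<Omega> (a - 1) a|lebesgue. (norm (\<phi> x - mean (a - 1) (v k)))\<^sup>2) + E (a - 1) a)
      + ((LINT x:slab \<Omega> b (b + 1)|lebesgue. (norm (\<phi> x - mean b (v k)))\<^sup>2) + E b (b + 1))"
      unfolding E_def by (rule local_flux_inequality[OF L sol app ab])
    moreover have "(1 + 4 * CP) * (E (a - 1) a + E b (b + 1)) \<le> (1 + 4 * CP) * (?E - E a b)"
      using CP_nonneg by (intro mult_left_mono split) auto
    then have "(E (a - 1) a + 4 * CP * E (a - 1) a) + (E b (b + 1) + 4 * CP * E b (b + 1)) \<le> (1 + 4 * CP) * (?E - E a b)"
      by (simp add: algebra_simps)
    ultimately show ?thesis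
      using drift[of k] poin[of "a - 1" k] poin[of b k] ab by simp
  qed
  have "(\<lambda>k. ?rhs + (1/2 * e2 k + 2 * (2 * e1 k + 4 * CP * e2 k))) \<longlonglongrightarrow> ?rhs + (1/2 * 0 + 2 * (2 * 0 + 4 * CP * 0))"
    by (intro tendsto_intros lim)
  then have "E a b \<le> ?rhs + (1/2 * 0 + 2 * (2 * 0 + 4 * CP * 0))"
    by (rule LIMSEQ_le_const) (use step in auto)
  then show ?thesis by (simp add: l_def)
qed

text \<open>The quotient of the coefficients once \<open>(1 + 4 * CP) * E a b\<close> has been moved
  to the left-hand side of \<open>energy_slab_decay\<close>. It is below 1 because the drift
  contributed \<open>1/2\<close> and not 1.\<close>

definition \<theta> :: real where "\<theta> = (3/2 + 4 * CP) / (2 + 4 * CP)"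

lemma \<theta>: "0 < \<theta>" "\<theta> < 1"
  using CP_nonneg by (auto simp: \<theta>_def field_simps)

text \<open>The slab is enlarged by one unit on each side until it has grown by \<open>N\<close>
  units; \<open>geometric_comparison\<close> then leaves a term linear in \<open>b - a\<close> and
  the total energy damped by \<open>\<theta> ^ N\<close>.\<close>

lemma energy_average_bound:
  assumes L: "0 < L" and sol: "truncated_solution \<Omega> L m \<phi>" and G: "has_weak_gradient (truncation \<Omega> L) \<phi> G"
    and ab: "4 / (1 - \<theta>) < b - a" "- (L / 2) \<le> a - 1" "b + 1 \<le> L / 2"
  shows "(LINT x:slab \<Omega> a b|lebesgue. (norm (G x))\<^sup>2) \<le> (6 * CD / (1 - \<theta>) + 2 * CE / (1 - \<theta>)) * m\<^sup>2 * (b - a)"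
proof -
  let ?U = "truncation \<Omega> L"
  obtain G' v Dv where app: "C1_approximation ?U \<phi> G' v Dv"
    and tot: "(LINT x:?U|lebesgue. (norm (G' x))\<^sup>2) \<le> CE * m\<^sup>2 * L"
    and "\<forall>G. has_weak_gradient ?U \<phi> G \<longrightarrow> (LINT x:?U|lebesgue. (norm (G x - G' x))\<^sup>2) = 0"
    by (rule energy_bound[OF L sol]) (rule that)
  then have zero: "(LINT x:?U|lebesgue. (norm (G x - G' x))\<^sup>2) = 0" using G by blast
  have GL: "G \<in> L2 ?U" "G' \<in> L2 ?U" using G app by (auto simp: has_weak_gradient_def C1_approximation_def)
  define E where "E a b = (LINT x:slab \<Omega> a b|lebesgue. (norm (G' x))\<^sup>2)" for a b
  have "4 \<le> 4 / (1 - \<theta>)" using \<theta> by (simp add: field_simps)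
  with ab have ba: "4 \<le> b - a" by linarith
  \<comment> \<open>The given weak gradient is exchanged for the one that has an approximating
    sequence, as both agree almost everywhere.\<close>
  have EG: "(LINT x:slab \<Omega> a b|lebesgue. (norm (G x))\<^sup>2) = E a b"
  proof -
    have "integrable lebesgue (\<lambda>x. indicator ?U x *\<^sub>R (norm (G x - G' x))\<^sup>2)"
      using L2D(2)[OF L2_diff(1)[OF GL]] by (simp add: set_integrable_def)
    then have "AE x in lebesgue. indicator ?U x *\<^sub>R (norm (G x - G' x))\<^sup>2 = 0"
      using zero by (subst integral_nonneg_eq_0_iff_AE[symmetric]) (auto simp: set_lebesgue_integral_def)
    moreover have "slab \<Omega> a b \<subseteq> ?U" using ab L unfolding truncation_eq_slab by (auto simp: slab_def)
    ultimately have ae: "AE x in lebesgue. indicator (slab \<Omega> a b) x *\<^sub>R (norm (G x))\<^sup>2 = indicator (slab \<Omega> a b) x *\<^sub>R (norm (G' x))\<^sup>2"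
      by (elim eventually_mono) (auto simp: indicator_def)
    show ?thesis
      unfolding E_def set_lebesgue_integral_def
    proof (rule integral_cong_AE[OF _ _ ae])
      have "slab \<Omega> a b \<subseteq> ?U" using ab L unfolding truncation_eq_slab by (auto simp: slab_def)
      then show "(\<lambda>x. indicator (slab \<Omega> a b) x *\<^sub>R (norm (G x))\<^sup>2) \<in> borel_measurable lebesgue"
        "(\<lambda>x. indicator (slab \<Omega> a b) x *\<^sub>R (norm (G' x))\<^sup>2) \<in> borel_measurable lebesgue"
        using L2D(2)[OF L2_subset(1)[OF GL(1) slab_sets]] L2D(2)[OF L2_subset(1)[OF GL(2) slab_sets]]
        by (auto simp: set_integrable_def)
    qed
  qed
  \<comment> \<open>The slab starts inside the truncation of half length, so \<open>N\<close>
    enlargements keep it inside the full truncation.\<close>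
  define N where "N = nat \<lfloor>L / 2\<rfloor>"
  have N: "real N \<le> L / 2" "L / 2 < real N + 1" using L by (auto simp: N_def) linarith+
  define F where "F k = E (a - real k) (b + real k)" for k
  \<comment> \<open>The drift is proportional to \<open>b - a + 1 + 2 * real k\<close>; it is
    rounded up to fit \<open>geometric_comparison\<close> with \<open>d = b - a + 2\<close>.\<close>
  have step: "F k \<le> \<theta> * F (Suc k) + (CD * m\<^sup>2) * ((b - a + 2) + 2 * real k)" if k: "k < N" for k
  proof -
    have kN: "real k + 1 \<le> real N" using k by linarith
    let ?a = "a - real k" and ?b = "b + real k"
    have "E ?a ?b \<le> 1/2 * E (?a - 1) (?b + 1) + CD * (?b + 1 - ?a) * m\<^sup>2 + (1 + 4 * CP) * (E (?a - 1) (?b + 1) - E ?a ?b)"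
      unfolding E_def by (rule energy_slab_decay[OF L sol app]) (use kN N ab ba in linarith)+
    also have "CD * (?b + 1 - ?a) * m\<^sup>2 \<le> (CD * m\<^sup>2) * ((b - a + 2) + 2 * real k)"
    proof -
      have "(CD * m\<^sup>2) * (?b + 1 - ?a) \<le> (CD * m\<^sup>2) * ((b - a + 2) + 2 * real k)"
        using CD_pos by (intro mult_left_mono) auto
      then show ?thesis by (simp add: mult_ac)
    qed
    finally have le: "(2 + 4 * CP) * F k \<le> (3/2 + 4 * CP) * F (Suc k) + (CD * m\<^sup>2) * ((b - a + 2) + 2 * real k)"
      by (simp add: F_def algebra_simps)
    let ?R = "(CD * m\<^sup>2) * ((b - a + 2) + 2 * real k)"
    have R: "0 \<le> ?R" using CD_pos ba by simp
    have p: "0 < 2 + 4 * CP" "1 \<le> 2 + 4 * CP" using CP_nonneg by auto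
    have "F k \<le> ((3/2 + 4 * CP) * F (Suc k) + ?R) / (2 + 4 * CP)"
      using le p(1) by (simp only: pos_le_divide_eq mult.commute)
    also have "\<dots> = \<theta> * F (Suc k) + ?R / (2 + 4 * CP)"
      unfolding \<theta>_def by (subst add_divide_distrib[of "(3/2 + 4 * CP) * F (Suc k)"]) (simp only: times_divide_eq_left)
    also have "?R / (2 + 4 * CP) \<le> ?R" using R p by (simp add: divide_le_eq mult_left_le mult_le_cancel_left1)
    finally show ?thesis by simp
  qed
  have "F 0 \<le> 2 * (CD * m\<^sup>2) / (1 - \<theta>) * (b - a + 2) + \<theta> ^ N * F N"
  proof (rule geometric_comparison)
    show "4 * \<theta> / (1 - \<theta>) \<le> b - a + 2"
    proof -
      have "4 * \<theta> / (1 - \<theta>) \<le> 4 / (1 - \<theta>)" using \<theta> by (intro divide_right_mono) auto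
      then show ?thesis using ab by linarith
    qed
  qed (use \<theta> CD_pos ba step in auto)
  \<comment> \<open>The total energy is of order \<open>L\<close>, and
    \<open>L < 2 * (N + 1)\<close>; \<open>Suc_times_power_le\<close> therefore bounds the damped
    energy independently of \<open>L\<close>.\<close>
  also have "\<theta> ^ N * F N \<le> 2 * CE / (1 - \<theta>) * m\<^sup>2"
  proof -
    have CE0: "0 \<le> CE" using CT_nonneg C1_pos ball_vol_pos by (simp add: CE_def)
    have "slab \<Omega> (a - real N) (b + real N) \<subseteq> ?U"
      using N ab unfolding truncation_eq_slab by (auto simp: slab_def)
    from L2_subset(2)[OF GL(2) slab_sets this] tot have "F N \<le> CE * m\<^sup>2 * L"
      by (simp add: F_def E_def)
    also have "\<dots> \<le> CE * m\<^sup>2 * (2 * (real N + 1))"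
      using CE0 N by (intro mult_left_mono) auto
    finally have "\<theta> ^ N * F N \<le> \<theta> ^ N * (CE * m\<^sup>2 * (2 * (real N + 1)))"
      using \<theta> by (intro mult_left_mono) auto
    also have "\<dots> = (2 * CE * m\<^sup>2) * ((real N + 1) * \<theta> ^ N)" by (simp add: mult_ac)
    also have "\<dots> \<le> (2 * CE * m\<^sup>2) * (1 / (1 - \<theta>))"
      using CE0 \<theta> by (intro mult_left_mono Suc_times_power_le) auto
    finally show ?thesis by simp
  qed
  \<comment> \<open>As \<open>b - a \<ge> 4\<close>, both \<open>b - a + 2 \<le> 3 * (b - a)\<close>
    and \<open>1 \<le> b - a\<close> hold; the first is the origin of the factor 6 in the
    result.\<close>
  also have "2 * (CD * m\<^sup>2) / (1 - \<theta>) * (b - a + 2) + 2 * CE / (1 - \<theta>) * m\<^sup>2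
      \<le> 2 * (CD * m\<^sup>2) / (1 - \<theta>) * (3 * (b - a)) + 2 * CE / (1 - \<theta>) * m\<^sup>2 * (b - a)"
  proof (rule add_mono)
    show "2 * (CD * m\<^sup>2) / (1 - \<theta>) * (b - a + 2) \<le> 2 * (CD * m\<^sup>2) / (1 - \<theta>) * (3 * (b - a))"
      using CD_pos \<theta> ba by (intro mult_left_mono) auto
    have "0 \<le> 2 * CE / (1 - \<theta>) * m\<^sup>2" using CT_nonneg C1_pos ball_vol_pos \<theta> by (simp add: CE_def)
    then show "2 * CE / (1 - \<theta>) * m\<^sup>2 \<le> 2 * CE / (1 - \<theta>) * m\<^sup>2 * (b - a)"
      using ba mult_left_mono[of 1 "b - a" "2 * CE / (1 - \<theta>) * m\<^sup>2"] by simp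
  qed
  also have "\<dots> = (6 * CD / (1 - \<theta>) + 2 * CE / (1 - \<theta>)) * m\<^sup>2 * (b - a)"
    by (simp add: algebra_simps)
  finally show ?thesis by (simp add: EG F_def)
qed

text \<open>Every height is attained in the nozzle, by the image of a point on the axis of the
  cylinder; hence an inclusion of slabs is an inclusion of intervals.\<close>

lemma slab_subset_truncationD:
  assumes "slab \<Omega> a b \<subseteq> truncation \<Omega> L" "a < b"
  shows "- L \<le> a" "b \<le> L"
proof -
  have mem: "\<bar>t\<bar> < L" if "a < t" "t < b" for t
  proof -
    have c: "(0, t) \<in> cylinder" by (simp add: cylinder_def)
    have "S (0, t) \<in> slab \<Omega> a b" using S_\<Omega>[OF c] snd_S[OF c] that by (simp add: slab_def)
    then show ?thesis using assms(1) snd_S[OF c] by (auto simp: truncation_def)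
  qed
  show "- L \<le> a"
  proof (rule ccontr)
    assume "\<not> - L \<le> a"
    then have "a < min b (- L)" using assms(2) by simp
    then obtain t where "a < t" "t < min b (- L)" using dense by blast
    then show False using mem[of t] by (auto simp: abs_less_iff)
  qed
  show "b \<le> L"
  proof (rule ccontr)
    assume "\<not> b \<le> L"
    then have "max a L < b" using assms(2) by simp
    then obtain t where "max a L < t" "t < b" using dense by blast
    then show False using mem[of t] by (auto simp: abs_less_iff)
  qed
qed

lemma average_bound:
  shows "\<exists>l>0. \<exists>C. \<forall>m>0. \<forall>L>0. \<forall>a b \<phi> G.
    b - a > l \<and> slab \<Omega> (a - 1) (b + 1) \<subseteq> truncation \<Omega> (L / 2) \<and>
    truncated_solution \<Omega> L m \<phi> \<and> has_weak_gradient (truncation \<Omega> L) \<phi> G \<longrightarrow>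
    1 / measure lebesgue (slab \<Omega> a b) * (LINT x:slab \<Omega> a b|lebesgue. (norm (G x))\<^sup>2) \<le> C * m\<^sup>2"
proof -
  \<comment> \<open>The constant of the slab estimate. The final one is
    \<open>Q * C0 / ball_vol\<close>, the extra quotient coming from \<open>measure_slab_ge\<close>;
    the minimal length is \<open>4 / (1 - \<theta>)\<close>.\<close>
  define Q where "Q = 6 * CD / (1 - \<theta>) + 2 * CE / (1 - \<theta>)"
  have Q: "0 \<le> Q" using CD_pos \<theta> CT_nonneg C1_pos ball_vol_pos by (simp add: Q_def CE_def)
  have "1 / measure lebesgue (slab \<Omega> a b) * (LINT x:slab \<Omega> a b|lebesgue. (norm (G x))\<^sup>2) \<le> (Q * C0 / ball_vol) * m\<^sup>2"
    if L: "L > 0" and ab: "b - a > 4 / (1 - \<theta>)" and sub: "slab \<Omega> (a - 1) (b + 1) \<subseteq> truncation \<Omega> (L / 2)"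
      and sol: "truncated_solution \<Omega> L m \<phi>" and G: "has_weak_gradient (truncation \<Omega> L) \<phi> G" for m L a b \<phi> G
  proof -
    have "0 < 4 / (1 - \<theta>)" using \<theta> by simp
    then have lt: "0 < b - a" using ab by linarith
    have range: "- (L / 2) \<le> a - 1" "b + 1 \<le> L / 2"
      using slab_subset_truncationD[OF sub] lt by auto
    let ?\<mu> = "measure lebesgue (slab \<Omega> a b)"
    have \<mu>: "ball_vol * (b - a) \<le> C0 * ?\<mu>" using measure_slab_ge[of a b] lt by simp
    then have "0 < C0 * ?\<mu>" using lt ball_vol_pos by (meson less_le_trans mult_pos_pos)
    then have \<mu>0: "0 < ?\<mu>" using C0_pos by (simp add: zero_less_mult_iff)
    have "(LINT x:slab \<Omega> a b|lebesgue. (norm (G x))\<^sup>2) \<le> Q * m\<^sup>2 * (b - a)"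
      unfolding Q_def by (rule energy_average_bound[OF L sol G ab range])
    also have "\<dots> \<le> Q * m\<^sup>2 * (C0 * ?\<mu> / ball_vol)"
      using Q \<mu> ball_vol_pos by (intro mult_left_mono) (auto simp: pos_le_divide_eq mult.commute)
    also have "\<dots> = ((Q * C0 / ball_vol) * m\<^sup>2) * ?\<mu>" by simp
    finally show ?thesis using \<mu>0 by (simp add: pos_divide_le_eq)
  qed
  moreover have "0 < 4 / (1 - \<theta>)" using \<theta> by simp
  ultimately show ?thesis by blast
qed

end

section \<open>Extracting the chart from the definition of a nozzle\<close>

lemma nozzle_imp_chart:
  fixes \<Omega> :: "('a::euclidean_space \<times> real) set"
  assumes "nozzle \<Omega>"
  obtains T S T1 S1 K where "nozzle_chart \<Omega> T S T1 S1 K"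
proof -
  obtain \<alpha> K T T1 T2 S S1 S2 where op: "open \<Omega>"
    and hom: "homeomorphism (closure \<Omega>) (closure cylinder) T S"
    and C2: "C2_up_to_boundary \<Omega> T T1 T2" "C2_up_to_boundary cylinder S S1 S2"
    and slices: "\<forall>k. T ` (\<Omega> \<inter> {x. snd x = k}) = ball 0 1 \<times> {k}"
    and norm: "C2_holder_norm \<alpha> \<Omega> T T1 T2 + C2_holder_norm \<alpha> cylinder S S1 S2 \<le> ennreal K"
    using assms unfolding nozzle_def by (elim conjE exE) (rule that)
  note slice = spec[OF slices]
  \<comment> \<open>The supremum of the first derivative is one of the summands of the norm. The
    maximum with 1 makes the bound positive, as the locale demands.\<close>
  have bound: "norm (f1 x) \<le> max K 1"
    if "C2_holder_norm \<alpha> U f f1 f2 \<le> ennreal K" "x \<in> U"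
    for U :: "('a \<times> real) set" and f :: "'a \<times> real \<Rightarrow> 'a \<times> real" and f1 f2 x
  proof -
    have "ennreal (norm (f1 x)) \<le> (SUP x\<in>U. ennreal (norm (f1 x)))" by (rule SUP_upper[OF that(2)])
    also have "\<dots> \<le> C2_holder_norm \<alpha> U f f1 f2"
    proof -
      have "q \<le> p + q + r + s" for p q r s :: ennreal
        unfolding le_iff_add by (rule exI[of _ "p + r + s"]) (simp add: ac_simps)
      then show ?thesis unfolding C2_holder_norm_def .
    qed
    also have "\<dots> \<le> ennreal (max K 1)" using that(1) by (rule order_trans) (simp add: ennreal_leI)
    finally show ?thesis by (simp add: ennreal_le_iff)
  qed
  have nT: "C2_holder_norm \<alpha> \<Omega> T T1 T2 \<le> ennreal K" and nS: "C2_holder_norm \<alpha> cylinder S S1 S2 \<le> ennreal K"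
    by (rule order_trans[OF _ norm], simp)+
  have ST: "S (T x) = x" if "x \<in> \<Omega>" for x
    by (rule homeomorphism_apply1[OF hom]) (use that closure_subset[of \<Omega>] in blast)
  have T: "T x \<in> cylinder" "snd (T x) = snd x" if "x \<in> \<Omega>" for x
  proof -
    have "T x \<in> ball 0 1 \<times> {snd x}" using slice[of "snd x"] that by blast
    then show "T x \<in> cylinder" "snd (T x) = snd x" by (auto simp: cylinder_def)
  qed
  have S: "S y \<in> \<Omega>" "snd (S y) = snd y" "T (S y) = y" if "y \<in> cylinder" for y
  proof -
    \<comment> \<open>The homeomorphism concerns the closures only; that \<open>S\<close> maps the
      open cylinder into \<Omega> at the same height follows from the slice condition.\<close>
    have "y \<in> T ` (\<Omega> \<inter> {x. snd x = snd y})" unfolding slice using that by (auto simp: cylinder_def)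
    then obtain x where "x \<in> \<Omega> \<inter> {x. snd x = snd y}" and Tx: "y = T x" by (rule imageE)
    then have x: "x \<in> \<Omega>" "snd x = snd y" "y = T x" by simp_all
    have Sy: "S y = x" unfolding x(3) by (rule ST[OF x(1)])
    show "S y \<in> \<Omega>" "snd (S y) = snd y" "T (S y) = y"
      unfolding Sy by (fact x(1), fact x(2), fact x(3)[symmetric])
  qed
  have "nozzle_chart \<Omega> T S T1 S1 (max K 1)"
  proof
    show "continuous_on cylinder S1"
      using C2(2) continuous_on_subset[OF _ closure_subset] by (auto simp: C2_up_to_boundary_def)
    show "norm (T1 x) \<le> max K 1" if "x \<in> \<Omega>" for x by (rule bound[OF nT that])
    show "norm (S1 y) \<le> max K 1" if "y \<in> cylinder" for y by (rule bound[OF nS that])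
  qed (use op T S ST C2 in \<open>auto simp: C2_up_to_boundary_def\<close>)
  then show ?thesis by (rule that)
qed

theorem lemma4p2:
  fixes \<Omega> :: "('a::euclidean_space \<times> real) set"
  assumes "nozzle \<Omega>"
  shows "\<exists>l>0. \<exists>C. \<forall>m>0. \<forall>L>0. \<forall>a b \<phi> G.
    b - a > l \<and> slab \<Omega> (a - 1) (b + 1) \<subseteq> truncation \<Omega> (L / 2) \<and>
    truncated_solution \<Omega> L m \<phi> \<and> has_weak_gradient (truncation \<Omega> L) \<phi> G \<longrightarrow>
    1 / measure lebesgue (slab \<Omega> a b) * (LINT x:slab \<Omega> a b|lebesgue. (norm (G x))\<^sup>2) \<le> C * m\<^sup>2"
proof -
  obtain T S T1 S1 K where "nozzle_chart \<Omega> T S T1 S1 K"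
    using nozzle_imp_chart[OF assms] by blast
  then show ?thesis by (rule nozzle_chart.average_bound)
qed

end
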